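(* Let $X$ be a path connected metrizable topological space with basepoint. If the homomorphism $\lambda:\pi_{1}(X)\rightarrow\pi_{U}(X)$ is injective (for example, if $X$ is compact and shape injective), then a Fischer-Zastrow simply connected covering map of $X$ exists, and it is naturally identified with the restriction of the UU-cover of $X^{LP}$ to a path component: namely, the restriction of the composition $\widetilde{X^{LP}}\xrightarrow{\phi} X^{LP}\xrightarrow{\mathrm{id}} X$ to the path component of the basepoint of $\widetilde{X^{LP}}$ is the Fischer-Zastrow simply connected covering map of $X$.
   Context: Fischer-Zastrow simply connected covering map of $X$: a continuous function $p:\widetilde{X_{FZ}}\to X$ with $\widetilde{X_{FZ}}$ path connected and simply connected such that for every path connected, locally path connected, simply connected space $Y$ and every continuous $f:Y\to X$ there is a unique (up to basepoint, i.e. once the image of one point over $f$ of that point is prescribed) continuous $f_L:Y\to\widetilde{X_{FZ}}$ with $p\circ f_L=f$. $X^{LP}$ is the locally path connected coreflection of $X$: the same set, with the topology generated by the path components of open subsets of $X$; it is metrizable, path connected and locally path connected. Metrizable topological spaces (here $X$ and $X^{LP}$) are given the fine uniformity: entourages are all symmetric sets containing an open set containing the diagonal. For a uniform space $Z$ with basepoint $\ast$ and an entourage $E$, an $E$-chain is a finite sequence $\{x_0,\dots,x_n\}$ with $(x_i,x_{i+1})\in E$ for all $i$; an $E$-homotopy between $E$-chains with the same endpoints is a finite sequence of $E$-chains, each obtained from the previous by adding or removing one point, never an endpoint; $[\alpha]_E$ is the $E$-homotopy class. $Z_E$ is the set of $[\alpha]_E$ with $\alpha$ an $E$-chain starting at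 $\ast$, and its uniform structure has as basis the sets $F^\ast$ ($F\subset E$ an entourage), where $([\alpha]_E,[\beta]_E)\in F^\ast$ iff, with $a,b$ the endpoints of $\alpha,\beta$, $(a,b)\in F$ and the reversal of $\alpha$ followed by $\beta$ is $E$-homotopic to $\{a,b\}$. For $F\subset E$ put $\phi_{EF}([\alpha]_F)=[\alpha]_E$. $\widetilde Z:=\varprojlim Z_E$ with basepoint $([\ast]_E)_E$, and $\phi:\widetilde Z\to Z$ is the endpoint map (the UU-cover when $Z=X^{LP}$). $\pi_E(Z)\subset Z_E$ is the group of classes of $E$-loops at $\ast$ under concatenation and $\pi_U(Z):=\varprojlim\pi_E(Z)$ is the uniform fundamental group. $\lambda:\pi_1(Z)\to\pi_U(Z)$ sends the class of a loop $c:[0,1]\to Z$ at $\ast$ to $([\alpha_E]_E)_E$, where $\alpha_E=\{c(t_0),\dots,c(t_n)\}$ for any partition $0=t_0<\dots<t_n=1$ with $c([t_{i-1},t_i])\times c([t_{i-1},t_i])\subset E$ for each $i$; this is well defined. $X$ is shape injective if the canonical homomorphism $\pi_1(X)\to\check{\pi}_1(X)$ to the first shape group is injective. *)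

theory Defs
  imports "HOL-Analysis.Analysis"
begin

definition loop_at :: "'a topology \<Rightarrow> 'a \<Rightarrow> (real \<Rightarrow> 'a) \<Rightarrow> bool" where
  "loop_at X a c \<longleftrightarrow> pathin X c \<and> c 0 = a \<and> c 1 = a"

definition loop_homotopic :: "'a topology \<Rightarrow> 'a \<Rightarrow> (real \<Rightarrow> 'a) \<Rightarrow> (real \<Rightarrow> 'a) \<Rightarrow> bool" where
  "loop_homotopic X a c d \<longleftrightarrow>
     homotopic_with (\<lambda>h. h 0 = a \<and> h 1 = a) (top_of_set {0..1}) X c d"

definition loop_class :: "'a topology \<Rightarrow> 'a \<Rightarrow> (real \<Rightarrow> 'a) \<Rightarrow> (real \<Rightarrow> 'a) set" where
  "loop_class X a c = {d. loop_homotopic X a c d}"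

definition fundamental_group :: "'a topology \<Rightarrow> 'a \<Rightarrow> (real \<Rightarrow> 'a) set set" where
  "fundamental_group X a = {loop_class X a c | c. loop_at X a c}"

definition simply_connected_space :: "'a topology \<Rightarrow> bool" where
  "simply_connected_space X \<longleftrightarrow> path_connected_space X \<and>
     (\<forall>a c. loop_at X a c \<longrightarrow> loop_homotopic X a c (\<lambda>_. a))"

text \<open>The type argument fixes the type of points of the test spaces \<open>Y\<close>; in a theorem in
  which it is a free type variable, the universal property is asserted for test spaces over
  every type. The first conjunct of the lifting property says that some lift exists; it
  excludes the degenerate case of a point of \<open>Y\<close> with no point over its image.\<close>

definition fischer_zastrow_cover ::
    "'y itself \<Rightarrow> 'a topology \<Rightarrow> 'b topology \<Rightarrow> ('b \<Rightarrow> 'a) \<Rightarrow> bool" where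
  "fischer_zastrow_cover _ X Xt p \<longleftrightarrow>
     continuous_map Xt X p \<and> path_connected_space Xt \<and> simply_connected_space Xt \<and>
     (\<forall>(Y :: 'y topology) f.
        path_connected_space Y \<and> locally_path_connected_space Y \<and> simply_connected_space Y \<and>
        continuous_map Y X f \<longrightarrow>
        (\<exists>g. continuous_map Y Xt g \<and> (\<forall>y \<in> topspace Y. p (g y) = f y)) \<and>
        (\<forall>y0 \<in> topspace Y. \<forall>x0 \<in> topspace Xt. p x0 = f y0 \<longrightarrow>
           (\<exists>g. continuous_map Y Xt g \<and> (\<forall>y \<in> topspace Y. p (g y) = f y) \<and> g y0 = x0 \<and>
              (\<forall>g'. continuous_map Y Xt g' \<and> (\<forall>y \<in> topspace Y. p (g' y) = f y) \<and> g' y0 = x0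
                 \<longrightarrow> (\<forall>y \<in> topspace Y. g' y = g y)))))"

definition lpc_coreflection :: "'a topology \<Rightarrow> 'a topology" where
  "lpc_coreflection X =
     topology_generated_by {C. \<exists>U. openin X U \<and> C \<in> path_components_of (subtopology X U)}"

definition fine_entourages :: "'a topology \<Rightarrow> ('a \<times> 'a) set set" where
  "fine_entourages X =
     {E. E \<subseteq> topspace X \<times> topspace X \<and> sym E \<and>
         (\<exists>W. openin (prod_topology X X) W \<and> Id_on (topspace X) \<subseteq> W \<and> W \<subseteq> E)}"

lemma fine_entourages_Int:
  assumes "E \<in> fine_entourages X" "F \<in> fine_entourages X"
  shows "E \<inter> F \<in> fine_entourages X"
proof -
  obtain V W where "openin (prod_topology X X) V" "Id_on (topspace X) \<subseteq> V" "V \<subseteq> E"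
    and "openin (prod_topology X X) W" "Id_on (topspace X) \<subseteq> W" "W \<subseteq> F"
    using assms by (auto simp: fine_entourages_def)
  then have "\<exists>U. openin (prod_topology X X) U \<and> Id_on (topspace X) \<subseteq> U \<and> U \<subseteq> E \<inter> F"
    by (intro exI[of _ "V \<inter> W"]) auto
  then show ?thesis
    using assms by (auto simp: fine_entourages_def sym_Int)
qed

definition e_chain :: "('a \<times> 'a) set \<Rightarrow> 'a list \<Rightarrow> bool" where
  "e_chain E xs \<longleftrightarrow> xs \<noteq> [] \<and> successively (\<lambda>x y. (x, y) \<in> E) xs"

text \<open>That a move leaves the endpoints alone is rendered by asking that first and last point are unchanged.
  Adding a copy of the last point at the very end has the same result as adding it just before
  the end, so the only effect beyond the positional reading is that \<open>[x]\<close> and \<open>[x, x]\<close>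
  are related. This is needed for the class of \<open>[x]\<close> to be a unit for concatenation.\<close>

definition e_move :: "('a \<times> 'a) set \<Rightarrow> 'a list \<Rightarrow> 'a list \<Rightarrow> bool" where
  "e_move E xs ys \<longleftrightarrow> e_chain E xs \<and> e_chain E ys \<and> hd xs = hd ys \<and> last xs = last ys \<and>
     (\<exists>us z vs. (xs = us @ vs \<and> ys = us @ z # vs) \<or> (xs = us @ z # vs \<and> ys = us @ vs))"

definition e_homotopic :: "('a \<times> 'a) set \<Rightarrow> 'a list \<Rightarrow> 'a list \<Rightarrow> bool" where
  "e_homotopic E xs ys \<longleftrightarrow> e_chain E xs \<and> (e_move E)\<^sup>*\<^sup>* xs ys"

definition e_class :: "('a \<times> 'a) set \<Rightarrow> 'a list \<Rightarrow> 'a list set" where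
  "e_class E xs = {ys. e_homotopic E xs ys}"

text \<open>Concatenation of chains, the last point of the first being the first of the second.\<close>

definition chain_concat :: "'a list \<Rightarrow> 'a list \<Rightarrow> 'a list" where
  "chain_concat xs ys = xs @ tl ys"

text \<open>In what follows a uniform space is given by its set \<open>\<E>\<close> of entourages; the basepoint
  is \<open>a\<close>.\<close>

definition e_cover :: "'a \<Rightarrow> ('a \<times> 'a) set \<Rightarrow> 'a list set set" where
  "e_cover a E = {e_class E xs | xs. e_chain E xs \<and> hd xs = a}"

definition star_entourage ::
    "'a \<Rightarrow> ('a \<times> 'a) set \<Rightarrow> ('a \<times> 'a) set \<Rightarrow> ('a list set \<times> 'a list set) set" where
  "star_entourage a E F =
     {(e_class E xs, e_class E ys) | xs ys.
        e_chain E xs \<and> hd xs = a \<and> e_chain E ys \<and> hd ys = a \<and> (last xs, last ys) \<in> F \<and>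
        e_homotopic E (chain_concat (rev xs) ys) [last xs, last ys]}"

definition uniform_topology :: "'b set \<Rightarrow> ('b \<times> 'b) set set \<Rightarrow> 'b topology" where
  "uniform_topology S \<B> = topology (\<lambda>U. U \<subseteq> S \<and> (\<forall>x\<in>U. \<exists>B\<in>\<B>. B `` {x} \<subseteq> U))"

lemma openin_uniform_topology:
  assumes "\<And>A B. A \<in> \<B> \<Longrightarrow> B \<in> \<B> \<Longrightarrow> \<exists>C\<in>\<B>. C \<subseteq> A \<inter> B"
  shows "openin (uniform_topology S \<B>) U \<longleftrightarrow> U \<subseteq> S \<and> (\<forall>x\<in>U. \<exists>B\<in>\<B>. B `` {x} \<subseteq> U)"
proof -
  have "istopology (\<lambda>U. U \<subseteq> S \<and> (\<forall>x\<in>U. \<exists>B\<in>\<B>. B `` {x} \<subseteq> U))"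
    unfolding istopology_def
  proof (intro conjI allI impI ballI)
    fix U V x
    assume U: "U \<subseteq> S \<and> (\<forall>x\<in>U. \<exists>B\<in>\<B>. B `` {x} \<subseteq> U)"
      and V: "V \<subseteq> S \<and> (\<forall>x\<in>V. \<exists>B\<in>\<B>. B `` {x} \<subseteq> V)" and x: "x \<in> U \<inter> V"
    obtain A B where "A \<in> \<B>" "B \<in> \<B>" "A `` {x} \<subseteq> U" "B `` {x} \<subseteq> V"
      using U V IntD1[OF x] IntD2[OF x] by meson
    moreover obtain C where "C \<in> \<B>" "C \<subseteq> A \<inter> B"
      using assms[OF \<open>A \<in> \<B>\<close> \<open>B \<in> \<B>\<close>] by auto
    ultimately show "\<exists>B\<in>\<B>. B `` {x} \<subseteq> U \<inter> V"
      by (intro bexI[of _ C]) auto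
  next
    fix \<U> x
    assume *: "\<forall>U\<in>\<U>. U \<subseteq> S \<and> (\<forall>x\<in>U. \<exists>B\<in>\<B>. B `` {x} \<subseteq> U)" and "x \<in> \<Union>\<U>"
    then obtain U where U: "U \<in> \<U>" "x \<in> U" by blast
    with * obtain B where "B \<in> \<B>" "B `` {x} \<subseteq> U" by meson
    moreover have "U \<subseteq> \<Union>\<U>" using U(1) by (rule Union_upper)
    ultimately show "\<exists>B\<in>\<B>. B `` {x} \<subseteq> \<Union>\<U>" by (meson subset_trans)
  qed auto
  then show ?thesis
    by (simp add: uniform_topology_def)
qed

definition e_cover_topology ::
    "('a \<times> 'a) set set \<Rightarrow> 'a \<Rightarrow> ('a \<times> 'a) set \<Rightarrow> 'a list set topology" where
  "e_cover_topology \<E> a E =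
     uniform_topology (e_cover a E) {star_entourage a E F | F. F \<in> \<E> \<and> F \<subseteq> E}"

lemma openin_e_cover_topology:
  assumes "\<And>E F. E \<in> \<E> \<Longrightarrow> F \<in> \<E> \<Longrightarrow> E \<inter> F \<in> \<E>"
  shows "openin (e_cover_topology \<E> a E) U \<longleftrightarrow>
    U \<subseteq> e_cover a E \<and> (\<forall>x\<in>U. \<exists>F\<in>\<E>. F \<subseteq> E \<and> star_entourage a E F `` {x} \<subseteq> U)"
proof -
  have "\<exists>C\<in>{star_entourage a E F | F. F \<in> \<E> \<and> F \<subseteq> E}. C \<subseteq> A \<inter> B"
    if AB: "A \<in> {star_entourage a E F | F. F \<in> \<E> \<and> F \<subseteq> E}"
      "B \<in> {star_entourage a E F | F. F \<in> \<E> \<and> F \<subseteq> E}" for A B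
  proof -
    obtain F G where FG: "A = star_entourage a E F" "F \<in> \<E>" "F \<subseteq> E"
      "B = star_entourage a E G" "G \<in> \<E>" "G \<subseteq> E"
      using AB by blast
    have "star_entourage a E (F \<inter> G) \<subseteq> A \<inter> B"
      unfolding FG star_entourage_def by blast
    moreover have "F \<inter> G \<in> \<E>" "F \<inter> G \<subseteq> E"
      using FG assms by auto
    ultimately show ?thesis by blast
  qed
  moreover have "(\<exists>B\<in>{star_entourage a E F | F. F \<in> \<E> \<and> F \<subseteq> E}. B `` {x} \<subseteq> U) \<longleftrightarrow>
      (\<exists>F\<in>\<E>. F \<subseteq> E \<and> star_entourage a E F `` {x} \<subseteq> U)" for x
    by blast
  ultimately show ?thesis
    unfolding e_cover_topology_def by (simp only: openin_uniform_topology)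
qed

text \<open>The map \<open>[\<alpha>]\<^sub>F \<mapsto> [\<alpha>]\<^sub>E\<close> for \<open>F \<subseteq> E\<close>; all members of \<open>A\<close> have the same
  \<open>E\<close>-class, so the union is that class.\<close>

definition e_bonding :: "('a \<times> 'a) set \<Rightarrow> 'a list set \<Rightarrow> 'a list set" where
  "e_bonding E A = (\<Union>xs\<in>A. e_class E xs)"

definition uu_cover ::
    "('a \<times> 'a) set set \<Rightarrow> 'a \<Rightarrow> (('a \<times> 'a) set \<Rightarrow> 'a list set) topology" where
  "uu_cover \<E> a =
     subtopology (product_topology (e_cover_topology \<E> a) \<E>)
       {x. \<forall>E\<in>\<E>. \<forall>F\<in>\<E>. F \<subseteq> E \<longrightarrow> e_bonding E (x F) = x E}"

definition uu_basepoint ::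
    "('a \<times> 'a) set set \<Rightarrow> 'a \<Rightarrow> ('a \<times> 'a) set \<Rightarrow> 'a list set" where
  "uu_basepoint \<E> a = (\<lambda>E\<in>\<E>. e_class E [a])"

definition uu_endpoint ::
    "('a \<times> 'a) set set \<Rightarrow> (('a \<times> 'a) set \<Rightarrow> 'a list set) \<Rightarrow> 'a" where
  "uu_endpoint \<E> x = (THE z. \<forall>E\<in>\<E>. \<forall>xs\<in>x E. last xs = z)"

definition e_loop_group :: "'a \<Rightarrow> ('a \<times> 'a) set \<Rightarrow> 'a list set set" where
  "e_loop_group a E = {e_class E xs | xs. e_chain E xs \<and> hd xs = a \<and> last xs = a}"

definition uniform_fundamental_group ::
    "('a \<times> 'a) set set \<Rightarrow> 'a \<Rightarrow> (('a \<times> 'a) set \<Rightarrow> 'a list set) set" where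
  "uniform_fundamental_group \<E> a =
     {x \<in> Pi\<^sub>E \<E> (e_loop_group a). \<forall>E\<in>\<E>. \<forall>F\<in>\<E>. F \<subseteq> E \<longrightarrow> e_bonding E (x F) = x E}"

definition fine_partition :: "('a \<times> 'a) set \<Rightarrow> (real \<Rightarrow> 'a) \<Rightarrow> real list \<Rightarrow> bool" where
  "fine_partition E c ts \<longleftrightarrow> ts \<noteq> [] \<and> hd ts = 0 \<and> last ts = 1 \<and> sorted_wrt (<) ts \<and>
     successively (\<lambda>s t. c ` {s..t} \<times> c ` {s..t} \<subseteq> E) ts"

definition uniform_hom ::
    "'a topology \<Rightarrow> 'a \<Rightarrow> (real \<Rightarrow> 'a) set \<Rightarrow> ('a \<times> 'a) set \<Rightarrow> 'a list set" where
  "uniform_hom X a g =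
     (THE x. x \<in> uniform_fundamental_group (fine_entourages X) a \<and>
        (\<forall>E \<in> fine_entourages X. \<forall>c\<in>g. \<forall>ts. fine_partition E c ts \<longrightarrow>
           x E = e_class E (map c ts)))"

text \<open>The first shape group is constructed as the inverse limit of the fundamental groups of the
  nerves of pointed open covers. The nerve of a cover \<open>\<U>\<close> is realised by barycentric
  coordinates \<open>\<U> \<Rightarrow> \<real>\<close>, extended by \<open>0\<close> to all sets, with the weak topology.\<close>

definition nerve :: "'a set set \<Rightarrow> 'a set set set" where
  "nerve \<U> = {\<sigma>. finite \<sigma> \<and> \<sigma> \<noteq> {} \<and> \<sigma> \<subseteq> \<U> \<and> \<Inter>\<sigma> \<noteq> {}}"

definition closed_simplex :: "'a set set \<Rightarrow> ('a set \<Rightarrow> real) set" where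
  "closed_simplex \<sigma> = {t. (\<forall>U. 0 \<le> t U) \<and> (\<forall>U. U \<notin> \<sigma> \<longrightarrow> t U = 0) \<and> (\<Sum>U\<in>\<sigma>. t U) = 1}"

definition nerve_topology :: "'a set set \<Rightarrow> ('a set \<Rightarrow> real) topology" where
  "nerve_topology \<U> = topology (\<lambda>S. S \<subseteq> (\<Union>\<sigma>\<in>nerve \<U>. closed_simplex \<sigma>) \<and>
     (\<forall>\<sigma>\<in>nerve \<U>. openin (top_of_set (closed_simplex \<sigma>)) (S \<inter> closed_simplex \<sigma>)))"

lemma openin_nerve_topology:
  "openin (nerve_topology \<U>) S \<longleftrightarrow> S \<subseteq> (\<Union>\<sigma>\<in>nerve \<U>. closed_simplex \<sigma>) \<and>
     (\<forall>\<sigma>\<in>nerve \<U>. openin (top_of_set (closed_simplex \<sigma>)) (S \<inter> closed_simplex \<sigma>))"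
proof -
  have "istopology (\<lambda>S. S \<subseteq> (\<Union>\<sigma>\<in>nerve \<U>. closed_simplex \<sigma>) \<and>
     (\<forall>\<sigma>\<in>nerve \<U>. openin (top_of_set (closed_simplex \<sigma>)) (S \<inter> closed_simplex \<sigma>)))"
    unfolding istopology_def
  proof (intro conjI allI impI ballI)
    fix S T \<sigma>
    assume "S \<subseteq> (\<Union>\<sigma>\<in>nerve \<U>. closed_simplex \<sigma>) \<and>
        (\<forall>\<sigma>\<in>nerve \<U>. openin (top_of_set (closed_simplex \<sigma>)) (S \<inter> closed_simplex \<sigma>))"
      "T \<subseteq> (\<Union>\<sigma>\<in>nerve \<U>. closed_simplex \<sigma>) \<and>
        (\<forall>\<sigma>\<in>nerve \<U>. openin (top_of_set (closed_simplex \<sigma>)) (T \<inter> closed_simplex \<sigma>))"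
      "\<sigma> \<in> nerve \<U>"
    then have "openin (top_of_set (closed_simplex \<sigma>)) (S \<inter> closed_simplex \<sigma>)"
      "openin (top_of_set (closed_simplex \<sigma>)) (T \<inter> closed_simplex \<sigma>)"
      by blast+
    note openin_Int[OF this]
    moreover have "(S \<inter> closed_simplex \<sigma>) \<inter> (T \<inter> closed_simplex \<sigma>)
        = S \<inter> T \<inter> closed_simplex \<sigma>"
      by blast
    ultimately show "openin (top_of_set (closed_simplex \<sigma>)) (S \<inter> T \<inter> closed_simplex \<sigma>)"
      by (simp only:)
  next
    fix \<K> \<sigma>
    assume "\<forall>S\<in>\<K>. S \<subseteq> (\<Union>\<sigma>\<in>nerve \<U>. closed_simplex \<sigma>) \<and>
        (\<forall>\<sigma>\<in>nerve \<U>. openin (top_of_set (closed_simplex \<sigma>)) (S \<inter> closed_simplex \<sigma>))"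
      "\<sigma> \<in> nerve \<U>"
    then have "openin (top_of_set (closed_simplex \<sigma>)) (\<Union>S\<in>\<K>. S \<inter> closed_simplex \<sigma>)"
      by (intro openin_Union) auto
    then show "openin (top_of_set (closed_simplex \<sigma>)) (\<Union>\<K> \<inter> closed_simplex \<sigma>)"
      by (simp only: Int_Union2)
  qed auto
  then show ?thesis
    by (simp add: nerve_topology_def)
qed

definition nerve_vertex :: "'a set \<Rightarrow> 'a set \<Rightarrow> real" where
  "nerve_vertex U0 = (\<lambda>U. if U = U0 then 1 else 0)"

definition partition_of_unity_on :: "'a topology \<Rightarrow> 'a set set \<Rightarrow> ('a set \<Rightarrow> 'a \<Rightarrow> real) \<Rightarrow> bool" where
  "partition_of_unity_on X \<U> \<phi> \<longleftrightarrow>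
     (\<forall>U\<in>\<U>. continuous_map X euclideanreal (\<phi> U) \<and> (\<forall>x\<in>topspace X. 0 \<le> \<phi> U x) \<and>
        X closure_of {x \<in> topspace X. \<phi> U x \<noteq> 0} \<subseteq> U) \<and>
     (\<forall>x\<in>topspace X. \<exists>N. openin X N \<and> x \<in> N \<and> finite {U\<in>\<U>. \<exists>y\<in>N. \<phi> U y \<noteq> 0}) \<and>
     (\<forall>x\<in>topspace X. (\<Sum>U | U \<in> \<U> \<and> \<phi> U x \<noteq> 0. \<phi> U x) = 1)"

text \<open>The condition \<open>\<phi> U0 a = 1\<close> makes the canonical map to the nerve send the basepoint to
  the vertex \<open>U0\<close>. On a paracompact Hausdorff space such pointed covers are cofinal
  among all pairs of an open cover and a distinguished member containing \<open>a\<close>.\<close>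

definition pointed_partition ::
    "'a topology \<Rightarrow> 'a \<Rightarrow> 'a set set \<times> 'a set \<Rightarrow> ('a set \<Rightarrow> 'a \<Rightarrow> real) \<Rightarrow> bool" where
  "pointed_partition X a = (\<lambda>(\<U>, U0) \<phi>. partition_of_unity_on X \<U> \<phi> \<and> \<phi> U0 a = 1)"

definition pointed_covers :: "'a topology \<Rightarrow> 'a \<Rightarrow> ('a set set \<times> 'a set) set" where
  "pointed_covers X a =
     {(\<U>, U0). (\<forall>U\<in>\<U>. openin X U) \<and> \<Union>\<U> = topspace X \<and> U0 \<in> \<U> \<and> a \<in> U0 \<and>
        (\<exists>\<phi>. pointed_partition X a (\<U>, U0) \<phi>)}"

definition canonical_map :: "'a set set \<Rightarrow> ('a set \<Rightarrow> 'a \<Rightarrow> real) \<Rightarrow> 'a \<Rightarrow> 'a set \<Rightarrow> real" where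
  "canonical_map \<U> \<phi> x = (\<lambda>U. if U \<in> \<U> then \<phi> U x else 0)"

definition refinement_projection ::
    "'a set set \<times> 'a set \<Rightarrow> 'a set set \<times> 'a set \<Rightarrow> ('a set \<Rightarrow> 'a set) \<Rightarrow> bool" where
  "refinement_projection = (\<lambda>(\<V>, V0) (\<U>, U0) r.
     (\<forall>V\<in>\<V>. r V \<in> \<U> \<and> V \<subseteq> r V) \<and> V0 \<subseteq> U0 \<and> r V0 = U0)"

text \<open>The linear extension to the nerves of a map \<open>r\<close> between vertices.\<close>

definition simplicial_map :: "('a set \<Rightarrow> 'a set) \<Rightarrow> ('a set \<Rightarrow> real) \<Rightarrow> 'a set \<Rightarrow> real" where
  "simplicial_map r t = (\<lambda>U. \<Sum>V | t V \<noteq> 0 \<and> r V = U. t V)"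

definition nerve_group :: "'a set set \<times> 'a set \<Rightarrow> (real \<Rightarrow> 'a set \<Rightarrow> real) set set" where
  "nerve_group = (\<lambda>(\<U>, U0). fundamental_group (nerve_topology \<U>) (nerve_vertex U0))"

definition nerve_loop_class ::
    "'a set set \<times> 'a set \<Rightarrow> (real \<Rightarrow> 'a set \<Rightarrow> real) \<Rightarrow> (real \<Rightarrow> 'a set \<Rightarrow> real) set" where
  "nerve_loop_class = (\<lambda>(\<U>, U0). loop_class (nerve_topology \<U>) (nerve_vertex U0))"

definition first_shape_group ::
    "'a topology \<Rightarrow> 'a \<Rightarrow> ('a set set \<times> 'a set \<Rightarrow> (real \<Rightarrow> 'a set \<Rightarrow> real) set) set" where
  "first_shape_group X a =
     {x \<in> Pi\<^sub>E (pointed_covers X a) nerve_group.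
        \<forall>u \<in> pointed_covers X a. \<forall>v \<in> pointed_covers X a. \<forall>r. refinement_projection v u r \<longrightarrow>
          (\<Union>c \<in> x v. nerve_loop_class u (simplicial_map r \<circ> c)) = x u}"

definition shape_hom ::
    "'a topology \<Rightarrow> 'a \<Rightarrow> (real \<Rightarrow> 'a) set \<Rightarrow> 'a set set \<times> 'a set \<Rightarrow> (real \<Rightarrow> 'a set \<Rightarrow> real) set" where
  "shape_hom X a g =
     (THE x. x \<in> first_shape_group X a \<and>
        (\<forall>u \<in> pointed_covers X a. \<forall>\<phi>. pointed_partition X a u \<phi> \<longrightarrow>
           (\<forall>c\<in>g. x u = nerve_loop_class u (canonical_map (fst u) \<phi> \<circ> c))))"

definition shape_injective :: "'a topology \<Rightarrow> 'a \<Rightarrow> bool" where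
  "shape_injective X a \<longleftrightarrow> inj_on (shape_hom X a) (fundamental_group X a)"

end

theory Submission
  imports Defs
begin

text \<open>Write \<open>Z\<close> for the coreflection of \<open>X\<close>. For a single entourage \<open>E\<close> of \<open>Z\<close> the endpoint map of the
  chain cover \<open>Z\<^sub>E\<close> is a covering map: over an open \<open>N\<close> with \<open>N \<times> N \<subseteq> E\<close> a class is determined by the
  sheet it lies in and by its end (\<open>openin_sheet\<close>, \<open>sheet_unique\<close>). The inverse limit of these
  coverings is no longer locally trivial, but coordinatewise it still has unique lifting from
  connected spaces (\<open>lift_unique\<close>).

  Lifts are produced by paths. Subdividing a path finely gives an \<open>E\<close>-chain for every \<open>E\<close>; its class
  does not depend on the subdivision, nor on the path within its homotopy class
  (\<open>path_homotopic_imp_e_homotopic\<close>, by cutting the square of a homotopy into a grid). The classes of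
  one path at all \<open>E\<close> form a thread, a point of the limit. If \<open>Y\<close> is path connected and simply
  connected and \<open>f\<close> maps \<open>Y\<close> to \<open>Z\<close>, then extending the thread of a path to \<open>f y0\<close> along the image of any
  path from \<open>y0\<close> to \<open>y\<close> defines the lift at \<open>y\<close>; local path connectedness of \<open>Y\<close> makes it continuous
  (\<open>lift_exists\<close>). In particular the path component of the basepoint consists exactly of the threads of
  paths from the basepoint (\<open>path_component_basepoint\<close>), and it contains the lifts that start in it.
  A continuous map from a locally path connected space to \<open>X\<close> is continuous into \<open>Z\<close>, so all this
  applies to maps into \<open>X\<close>.

  Injectivity of \<open>\<lambda>\<close> enters only in the simple connectedness of that path component. Let a loop there
  start at the thread of \<open>d\<close> and project to the loop \<open>c\<close>. It is the lift of its own projection, and it is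
  closed, so \<open>d\<close> followed by \<open>c\<close> has the same thread as \<open>d\<close>. Hence the loop \<open>d c d\<^sup>-\<^sup>1\<close> has the same
  image under \<open>\<lambda>\<close> as \<open>d d\<^sup>-\<^sup>1\<close>, the two are homotopic, \<open>c\<close> is null homotopic, and lifting a null
  homotopy of \<open>c\<close> contracts the given loop. The injectivity is assumed over \<open>X\<close> but used over \<open>Z\<close>: the two
  spaces have the same paths and path homotopies, and every fine entourage of \<open>X\<close> is one of \<open>Z\<close>
  (\<open>fischer_zastrow_cover_uu_cover\<close>).

  For compact \<open>X\<close>, let \<open>\<kappa>\<close> be the canonical map to the nerve of an open cover. A Lebesgue number
  gives an entourage \<open>E\<close> such that the points \<open>E\<close>-close to a given one are mapped by \<open>\<kappa>\<close> into one simplex. Then an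
  \<open>E\<close>-chain spans an edge path in the nerve, a move of chains crosses a triangle inside a simplex, and
  \<open>\<kappa> \<circ> c\<close> is homotopic to the edge path of any fine chain along \<open>c\<close>. So two loops with the same image under
  \<open>\<lambda>\<close> have the same image in every nerve and thus in the shape group
  (\<open>uniform_hom_inj_if_shape_injective\<close>).\<close>


section \<open>Chains and their homotopies\<close>

lemma e_move_sym: "e_move E xs ys \<Longrightarrow> e_move E ys xs"
  unfolding e_move_def by metis

lemma e_move_insertI:
  assumes "e_chain E (us @ vs)" "e_chain E (us @ z # vs)"
    and "hd (us @ vs) = hd (us @ z # vs)" "last (us @ vs) = last (us @ z # vs)"
  shows "e_move E (us @ vs) (us @ z # vs)"
  unfolding e_move_def using assms
  by (intro conjI exI[of _ us] exI[of _ z] exI[of _ vs]) simp_all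

lemma e_homotopic_refl: "e_chain E xs \<Longrightarrow> e_homotopic E xs xs"
  by (simp add: e_homotopic_def)

lemma e_homotopic_chain:
  assumes "e_homotopic E xs ys"
  shows "e_chain E xs" "e_chain E ys" "hd ys = hd xs" "last ys = last xs"
proof -
  have "(e_move E)\<^sup>*\<^sup>* xs ys" and xs: "e_chain E xs"
    using assms by (auto simp: e_homotopic_def)
  then have "e_chain E ys \<and> hd ys = hd xs \<and> last ys = last xs"
    by (induction rule: rtranclp_induct) (auto simp: e_move_def)
  then show "e_chain E xs" "e_chain E ys" "hd ys = hd xs" "last ys = last xs"
    using xs by auto
qed

lemma e_homotopic_trans [trans]:
  "e_homotopic E xs ys \<Longrightarrow> e_homotopic E ys zs \<Longrightarrow> e_homotopic E xs zs"
  by (auto simp: e_homotopic_def)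

lemma e_homotopic_sym:
  assumes "e_homotopic E xs ys"
  shows "e_homotopic E ys xs"
proof -
  have "symp (e_move E)"
    by (simp add: e_move_sym symp_def)
  then have "(e_move E)\<^sup>*\<^sup>* ys xs"
    using assms by (metis e_homotopic_def sympD symp_rtranclp)
  then show ?thesis
    using e_homotopic_chain[OF assms] by (simp add: e_homotopic_def)
qed

lemma e_class_eq_iff:
  assumes "e_chain E xs"
  shows "e_class E xs = e_class E ys \<longleftrightarrow> e_homotopic E xs ys"
  unfolding e_class_def using assms
  by (auto intro: e_homotopic_refl dest: e_homotopic_sym e_homotopic_trans)

lemma e_class_eqI: "e_homotopic E xs ys \<Longrightarrow> e_class E xs = e_class E ys"
  using e_class_eq_iff e_homotopic_chain(1) by blast

lemma e_chain_append:
  assumes "xs \<noteq> []" "ys \<noteq> []"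
  shows "e_chain E (xs @ ys) \<longleftrightarrow> e_chain E xs \<and> e_chain E ys \<and> (last xs, hd ys) \<in> E"
  using assms by (auto simp: e_chain_def successively_append_iff)

lemma e_chain_Cons: "e_chain E (x # y # zs) \<longleftrightarrow> (x, y) \<in> E \<and> e_chain E (y # zs)"
  by (simp add: e_chain_def)

lemma e_chain_singleton [simp]: "e_chain E [x]"
  by (simp add: e_chain_def)

lemma e_chain_nonempty: "e_chain E xs \<Longrightarrow> xs \<noteq> []"
  by (auto simp: e_chain_def)

lemma e_chain_snoc: "e_chain E xs \<Longrightarrow> (last xs, z) \<in> E \<Longrightarrow> e_chain E (xs @ [z])"
  using e_chain_append[of xs "[z]" E] e_chain_nonempty by auto

lemma e_chain_mono: "e_chain F xs \<Longrightarrow> F \<subseteq> E \<Longrightarrow> e_chain E xs"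
  unfolding e_chain_def by (auto intro: successively_mono)

lemma e_homotopic_mono:
  assumes "e_homotopic F xs ys" "F \<subseteq> E"
  shows "e_homotopic E xs ys"
proof -
  have "e_move F us vs \<Longrightarrow> e_move E us vs" for us vs
    using assms(2) e_chain_mono unfolding e_move_def by blast
  then have "(e_move E)\<^sup>*\<^sup>* xs ys"
    using assms(1) unfolding e_homotopic_def by (metis mono_rtranclp)
  then show ?thesis
    using assms e_chain_mono unfolding e_homotopic_def by blast
qed

lemma e_homotopic_append_left:
  assumes hom: "e_homotopic E xs ys" and us: "e_chain E us" "(last us, hd xs) \<in> E"
  shows "e_homotopic E (us @ xs) (us @ ys)"
proof -
  have *: "(e_move E)\<^sup>*\<^sup>* (us @ xs) (us @ ys)"
  proof -
    have "(e_move E)\<^sup>*\<^sup>* xs ys" "e_chain E xs"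
      using hom by (auto simp: e_homotopic_def)
    then have "(e_move E)\<^sup>*\<^sup>* (us @ xs) (us @ ys) \<and> e_chain E ys \<and> hd ys = hd xs"
    proof (induction rule: rtranclp_induct)
      case (step ys zs)
      then have ne: "us \<noteq> []" "ys \<noteq> []" "zs \<noteq> []"
        using us e_chain_nonempty by (auto simp: e_move_def)
      obtain as z bs where "(ys = as @ bs \<and> zs = as @ z # bs) \<or> (ys = as @ z # bs \<and> zs = as @ bs)"
        using step.hyps by (auto simp: e_move_def)
      then have "\<exists>as z bs. (us @ ys = as @ bs \<and> us @ zs = as @ z # bs)
          \<or> (us @ ys = as @ z # bs \<and> us @ zs = as @ bs)"
        by (metis append.assoc)
      then have "e_move E (us @ ys) (us @ zs)"
        using step ne us by (simp add: e_move_def e_chain_append)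
      moreover have "e_chain E zs" "hd zs = hd ys"
        using step.hyps by (auto simp: e_move_def)
      ultimately show ?case
        using step.IH step.prems by (metis rtranclp.rtrancl_into_rtrancl)
    qed auto
    then show ?thesis by blast
  qed
  have "e_chain E (us @ xs)"
    using us e_homotopic_chain(1)[OF hom] by (simp add: e_chain_append e_chain_nonempty)
  with * show ?thesis
    by (simp add: e_homotopic_def)
qed

lemma e_homotopic_append_right:
  assumes hom: "e_homotopic E xs ys" and vs: "e_chain E vs" "(last xs, hd vs) \<in> E"
  shows "e_homotopic E (xs @ vs) (ys @ vs)"
proof -
  have *: "(e_move E)\<^sup>*\<^sup>* (xs @ vs) (ys @ vs)"
  proof -
    have "(e_move E)\<^sup>*\<^sup>* xs ys" "e_chain E xs"
      using hom by (auto simp: e_homotopic_def)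
    then have "(e_move E)\<^sup>*\<^sup>* (xs @ vs) (ys @ vs) \<and> e_chain E ys \<and> last ys = last xs"
    proof (induction rule: rtranclp_induct)
      case (step ys zs)
      then have ne: "vs \<noteq> []" "ys \<noteq> []" "zs \<noteq> []"
        using vs e_chain_nonempty by (auto simp: e_move_def)
      obtain as z bs where "(ys = as @ bs \<and> zs = as @ z # bs) \<or> (ys = as @ z # bs \<and> zs = as @ bs)"
        using step.hyps by (auto simp: e_move_def)
      then have "\<exists>as z bs. (ys @ vs = as @ bs \<and> zs @ vs = as @ z # bs)
          \<or> (ys @ vs = as @ z # bs \<and> zs @ vs = as @ bs)"
        by (metis append.assoc append_Cons)
      then have "e_move E (ys @ vs) (zs @ vs)"
        using step ne vs by (simp add: e_move_def e_chain_append)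
      moreover have "e_chain E zs" "last zs = last ys"
        using step.hyps by (auto simp: e_move_def)
      ultimately show ?case
        using step.IH step.prems by (metis rtranclp.rtrancl_into_rtrancl)
    qed auto
    then show ?thesis by blast
  qed
  have "e_chain E (xs @ vs)"
    using vs e_homotopic_chain(1)[OF hom] by (simp add: e_chain_append e_chain_nonempty)
  with * show ?thesis
    by (simp add: e_homotopic_def)
qed

lemma e_homotopic_insert:
  assumes "(x, z) \<in> E" "(z, y) \<in> E" "(x, y) \<in> E"
  shows "e_homotopic E [x, y] [x, z, y]"
proof -
  have "e_move E ([x] @ [y]) ([x] @ z # [y])"
    using assms by (intro e_move_insertI) (auto simp: e_chain_def)
  then show ?thesis
    using assms by (auto simp: e_homotopic_def e_chain_def)
qed

lemma e_homotopic_stutter: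
  assumes "(x, x) \<in> E"
  shows "e_homotopic E [x] [x, x]"
proof -
  have "e_move E ([x] @ []) ([x] @ x # [])"
    using assms by (intro e_move_insertI) (auto simp: e_chain_def)
  then show ?thesis
    by (auto simp: e_homotopic_def)
qed

lemma e_homotopic_snoc_insert:
  assumes "e_chain E xs" "(last xs, z) \<in> E" "(z, y) \<in> E" "(last xs, y) \<in> E"
  shows "e_homotopic E (xs @ [y]) (xs @ [z, y])"
proof -
  have xs: "xs = butlast xs @ [last xs]"
    using assms(1) e_chain_nonempty by force
  have "e_homotopic E [last xs, y] [last xs, z, y]"
    using assms by (intro e_homotopic_insert)
  then have "e_homotopic E (butlast xs @ [last xs, y]) (butlast xs @ [last xs, z, y])"
    using assms(1) xs e_homotopic_append_left[of E "[last xs, y]" "[last xs, z, y]" "butlast xs"]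
      e_chain_append[of "butlast xs" "[last xs]" E]
    by (cases "butlast xs = []") auto
  then show ?thesis
    by (subst xs, subst (3) xs) simp
qed

lemma e_homotopic_snoc_stutter:
  assumes "e_chain E xs" "(last xs, last xs) \<in> E"
  shows "e_homotopic E xs (xs @ [last xs])"
proof -
  have xs: "xs = butlast xs @ [last xs]"
    using assms(1) e_chain_nonempty by force
  have "e_homotopic E [last xs] [last xs, last xs]"
    using assms by (intro e_homotopic_stutter)
  then have "e_homotopic E (butlast xs @ [last xs]) (butlast xs @ [last xs, last xs])"
    using assms(1) xs e_homotopic_append_left[of E "[last xs]" "[last xs, last xs]" "butlast xs"]
      e_chain_append[of "butlast xs" "[last xs]" E]
    by (cases "butlast xs = []") auto
  then show ?thesis
    by (subst xs, subst (3) xs) simp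
qed

lemma e_homotopic_Cons:
  assumes "e_homotopic E xs ys" "(x, hd xs) \<in> E"
  shows "e_homotopic E (x # xs) (x # ys)"
  using e_homotopic_append_left[OF assms(1), of "[x]"] assms(2) by simp

lemma e_homotopic_Cons_insert:
  assumes "e_chain E (y # zs)" "(x, z) \<in> E" "(z, y) \<in> E" "(x, y) \<in> E"
  shows "e_homotopic E (x # y # zs) (x # z # y # zs)"
proof (cases zs)
  case Nil
  then show ?thesis using assms by (simp add: e_homotopic_insert)
next
  case (Cons w ws)
  then have "e_chain E zs" "(y, hd zs) \<in> E"
    using assms(1) by (auto simp: e_chain_def)
  then show ?thesis
    using e_homotopic_append_right[OF e_homotopic_insert, of x z E y zs] assms by simp
qed

lemma e_homotopic_concat:
  assumes xs: "e_homotopic E xs xs'" and ys: "e_homotopic E ys ys'" and lh: "last xs = hd ys"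
  shows "e_homotopic E (xs @ tl ys) (xs' @ tl ys')"
proof -
  note cx = e_homotopic_chain[OF xs] and cy = e_homotopic_chain[OF ys]
  have "e_homotopic E (xs @ tl ys) (xs' @ tl ys)"
  proof (cases "tl ys = []")
    case True
    then show ?thesis using xs by simp
  next
    case False
    then have "e_chain E (tl ys)" "(last xs, hd (tl ys)) \<in> E"
      using cy(1) lh by (auto simp: e_chain_def successively_Cons neq_Nil_conv)
    then show ?thesis
      by (rule e_homotopic_append_right[OF xs])
  qed
  also have "e_homotopic E (xs' @ tl ys) (xs' @ tl ys')"
  proof -
    have eq: "xs' @ tl zs = butlast xs' @ zs" if "e_chain E zs" "hd zs = last xs'" for zs
      using that cx(2) e_chain_nonempty
      by (metis append.assoc append_Cons append_Nil append_butlast_last_id list.collapse)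
    have "e_homotopic E (butlast xs' @ ys) (butlast xs' @ ys')"
    proof (cases "butlast xs' = []")
      case True
      then show ?thesis using ys by simp
    next
      case False
      then have "e_chain E (butlast xs')" "(last (butlast xs'), last xs') \<in> E"
        using cx(2) e_chain_append[of "butlast xs'" "[last xs']" E] e_chain_nonempty by force+
      then show ?thesis
        using lh cx(4) by (intro e_homotopic_append_left[OF ys]) auto
    qed
    then show ?thesis
      using eq[of ys] eq[of ys'] cy lh cx(4) by simp
  qed
  finally show ?thesis .
qed

locale reflexive_entourage =
  fixes S :: "'a set" and E :: "('a \<times> 'a) set"
  assumes sub: "E \<subseteq> S \<times> S" and sym: "sym E" and diag: "x \<in> S \<Longrightarrow> (x, x) \<in> E"
begin

lemma symD: "(x, y) \<in> E \<Longrightarrow> (y, x) \<in> E"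
  using sym by (rule symD)

lemma diag_fst: "(x, y) \<in> E \<Longrightarrow> (x, x) \<in> E"
  and diag_snd: "(x, y) \<in> E \<Longrightarrow> (y, y) \<in> E"
  using sub diag by auto

lemma e_chain_subset: "e_chain E xs \<Longrightarrow> hd xs \<in> S \<Longrightarrow> set xs \<subseteq> S"
proof (induction xs rule: induct_list012)
  case (3 x y zs)
  then show ?case using sub by (auto simp: e_chain_Cons)
qed auto

lemma e_chain_last: "e_chain E xs \<Longrightarrow> hd xs \<in> S \<Longrightarrow> last xs \<in> S"
  using e_chain_subset e_chain_nonempty last_in_set by blast

lemma e_chain_rev: "e_chain E xs \<Longrightarrow> e_chain E (rev xs)"
  unfolding e_chain_def successively_rev
  by (auto intro: successively_mono symD)

text \<open>A chain run there and back is shortened at its turning point: once the part beyond the second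
  point \<open>y\<close> has shrunk to \<open>y\<close>, what remains is \<open>x, y, x\<close>, which shrinks to \<open>x, x\<close> and then to \<open>x\<close>.\<close>

lemma backtrack:
  "e_chain E xs \<Longrightarrow> hd xs \<in> S \<Longrightarrow> e_homotopic E (xs @ tl (rev xs)) [hd xs]"
proof (induction xs rule: induct_list012)
  case (3 x y zs)
  have xy: "(x, y) \<in> E" and ch: "e_chain E (y # zs)" and yS: "y \<in> S"
    using 3 sub by (auto simp: e_chain_Cons)
  have IH: "e_homotopic E ((y # zs) @ tl (rev (y # zs))) [y]"
    using 3 ch yS by simp
  have l: "last ((y # zs) @ tl (rev (y # zs))) = y"
    using e_homotopic_chain(4)[OF IH] by simp
  have "e_homotopic E (((y # zs) @ tl (rev (y # zs))) @ [x]) ([y] @ [x])"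
    using l xy by (intro e_homotopic_append_right[OF IH]) (auto intro: symD)
  then have "e_homotopic E (x # ((y # zs) @ tl (rev (y # zs))) @ [x]) (x # [y] @ [x])"
    using xy by (intro e_homotopic_Cons) auto
  also have "e_homotopic E (x # [y] @ [x]) [x, x]"
    using xy diag_fst symD by (auto intro!: e_homotopic_sym[OF e_homotopic_insert])
  also have "e_homotopic E [x, x] [x]"
    using xy diag_fst by (intro e_homotopic_sym[OF e_homotopic_stutter])
  finally have "e_homotopic E (x # ((y # zs) @ tl (rev (y # zs))) @ [x]) [x]" .
  moreover have "x # ((y # zs) @ tl (rev (y # zs))) @ [x] = (x # y # zs) @ tl (rev (x # y # zs))"
    by (cases zs rule: rev_cases) auto
  ultimately show ?case
    by (simp only: list.sel(1))
qed (auto simp: e_chain_def intro: e_homotopic_refl)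

text \<open>A step can be undone by the step back, so prolonging by a fixed point is injective on classes.
  This is why distinct sheets over a small set are disjoint.\<close>

lemma e_homotopic_snoc_cancel:
  assumes xs: "e_chain E xs" and ys: "e_chain E ys" "last ys = last xs" and z: "(last xs, z) \<in> E"
    and hom: "e_homotopic E (xs @ [z]) (ys @ [z])"
  shows "e_homotopic E xs ys"
proof -
  have there_and_back: "e_homotopic E us (us @ [z, last xs])" if "e_chain E us" "last us = last xs" for us
  proof -
    have "e_homotopic E us (us @ [last us])"
      using that z diag_fst by (intro e_homotopic_snoc_stutter) auto
    also have "e_homotopic E (us @ [last us]) (us @ [z, last us])"
      using that z diag_fst symD by (intro e_homotopic_snoc_insert) auto
    finally show ?thesis using that by simp
  qed
  note there_and_back[OF xs refl]
  also have "e_homotopic E (xs @ [z, last xs]) (ys @ [z, last xs])"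
    using z symD e_homotopic_append_right[OF hom, of "[last xs]"] by simp
  also note e_homotopic_sym[OF there_and_back[OF ys]]
  finally show ?thesis .
qed

text \<open>Across a ladder all of whose squares are small, the crossing from one rail to the other
  can be moved from the last rung to the first, one square at a time.\<close>

lemma ladder:
  fixes f g :: "nat \<Rightarrow> 'a"
  assumes "(f 0, g 0) \<in> E"
    and "\<And>i. i < n \<Longrightarrow> {f i, f (Suc i), g i, g (Suc i)} \<times> {f i, f (Suc i), g i, g (Suc i)} \<subseteq> E"
  shows "e_homotopic E (map f [0..<Suc n] @ [g n]) (f 0 # map g [0..<Suc n])"
  using assms(2)
proof (induction n)
  case 0
  then show ?case
    using assms(1) by (auto intro!: e_homotopic_refl simp: e_chain_def)
next
  case (Suc n)
  have IH: "e_homotopic E (map f [0..<Suc n] @ [g n]) (f 0 # map g [0..<Suc n])"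
    using Suc by auto
  let ?xs = "map f [0..<Suc n]"
  have cell: "{f n, f (Suc n), g n, g (Suc n)} \<times> {f n, f (Suc n), g n, g (Suc n)} \<subseteq> E"
    using Suc.prems by blast
  have ch: "e_chain E ?xs"
    using e_homotopic_chain(1)[OF IH] e_chain_append[of ?xs "[g n]" E] by auto
  have l: "last ?xs = f n" by simp
  have "e_homotopic E (?xs @ [f (Suc n), g (Suc n)]) (?xs @ [g (Suc n)])"
    using cell ch l by (intro e_homotopic_sym[OF e_homotopic_snoc_insert]) auto
  also have "e_homotopic E (?xs @ [g (Suc n)]) (?xs @ [g n, g (Suc n)])"
    using cell ch l by (intro e_homotopic_snoc_insert) auto
  also have "e_homotopic E (?xs @ [g n, g (Suc n)]) ((f 0 # map g [0..<Suc n]) @ [g (Suc n)])"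
    using cell e_homotopic_append_right[OF IH, of "[g (Suc n)]"] by auto
  finally show ?case
    by simp
qed

text \<open>For \<open>F \<subseteq> E\<close> the entourage \<open>F\<^sup>*\<close> relates a class to its prolongations by one step in \<open>F\<close>:
  prefixing a null chain \<open>xs, rev xs\<close> turns the defining homotopy of loops into one of chains.\<close>

lemma star_entourage_eq:
  assumes "F \<subseteq> E" "a \<in> S"
  shows "star_entourage a E F =
    {(e_class E xs, e_class E (xs @ [z])) | xs z. e_chain E xs \<and> hd xs = a \<and> (last xs, z) \<in> F}"
    (is "_ = ?R")
proof
  show "star_entourage a E F \<subseteq> ?R"
  proof
    fix p assume "p \<in> star_entourage a E F"
    then obtain xs ys where p: "p = (e_class E xs, e_class E ys)"
      and xs: "e_chain E xs" "hd xs = a" and ys: "e_chain E ys" "hd ys = a"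
      and F: "(last xs, last ys) \<in> F"
      and h: "e_homotopic E (chain_concat (rev xs) ys) [last xs, last ys]"
      unfolding star_entourage_def by blast
    have ne: "xs \<noteq> []" "ys \<noteq> []"
      using xs ys e_chain_nonempty by auto
    have "e_homotopic E ys ((xs @ tl (rev xs)) @ tl ys)"
    proof (cases "tl ys = []")
      case True
      then have "ys = [a]" using ys ne by (cases ys) auto
      then show ?thesis
        using e_homotopic_sym[OF backtrack[OF xs(1)]] xs assms by simp
    next
      case False
      then have ch: "e_chain E (tl ys)" "(a, hd (tl ys)) \<in> E"
        using ys by (auto simp: e_chain_def successively_Cons neq_Nil_conv)
      have b: "e_homotopic E [a] (xs @ tl (rev xs))"
        using e_homotopic_sym[OF backtrack[OF xs(1)]] xs assms by simp
      have "e_homotopic E ([a] @ tl ys) ((xs @ tl (rev xs)) @ tl ys)"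
        using ch by (intro e_homotopic_append_right[OF b]) auto
      moreover have "[a] @ tl ys = ys"
        using ys ne by (cases ys) auto
      ultimately show ?thesis
        by simp
    qed
    also have "(xs @ tl (rev xs)) @ tl ys = butlast xs @ (rev xs @ tl ys)"
      using ne by (cases xs rule: rev_cases) auto
    also have "e_homotopic E (butlast xs @ (rev xs @ tl ys)) (butlast xs @ [last xs, last ys])"
    proof (cases "butlast xs = []")
      case True
      then show ?thesis using h by (simp add: chain_concat_def)
    next
      case False
      then have "e_chain E (butlast xs)" "(last (butlast xs), last xs) \<in> E"
        using xs(1) ne e_chain_append[of "butlast xs" "[last xs]" E] by auto
      then show ?thesis
        using ne h by (intro e_homotopic_append_left) (auto simp: chain_concat_def hd_rev)
    qed
    also have "butlast xs @ [last xs, last ys] = xs @ [last ys]"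
      using ne by (cases xs rule: rev_cases) auto
    finally have "e_class E ys = e_class E (xs @ [last ys])"
      by (rule e_class_eqI)
    then show "p \<in> ?R"
      using p xs F by blast
  qed
  show "?R \<subseteq> star_entourage a E F"
  proof clarify
    fix xs z assume xs: "e_chain E xs" "a = hd xs" and z: "(last xs, z) \<in> F"
    have zE: "(last xs, z) \<in> E" using z assms by auto
    have ne: "xs \<noteq> []" using xs e_chain_nonempty by auto
    have S: "last xs \<in> S" using zE sub by auto
    have b: "e_homotopic E (rev xs @ tl xs) [last xs]"
      using backtrack[OF e_chain_rev[OF xs(1)]] S ne by (simp add: hd_rev)
    have "e_homotopic E (rev xs @ tl xs @ [z]) [last xs, z]"
      using e_homotopic_append_right[OF b, of "[z]"] zE e_homotopic_chain(4)[OF b] by simp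
    then have "e_homotopic E (chain_concat (rev xs) (xs @ [z])) [last xs, last (xs @ [z])]"
      using ne by (simp add: chain_concat_def)
    moreover have "e_chain E (xs @ [z])" "hd (xs @ [z]) = hd xs"
      using xs zE ne by (auto intro: e_chain_snoc)
    ultimately show "(e_class E xs, e_class E (xs @ [z])) \<in> star_entourage (hd xs) E F"
      unfolding star_entourage_def using xs z by fastforce
  qed
qed

end

lemma e_bonding_e_class:
  assumes "e_chain F xs" "F \<subseteq> E"
  shows "e_bonding E (e_class F xs) = e_class E xs"
proof -
  have "e_class E ys = e_class E xs" if "ys \<in> e_class F xs" for ys
    using that assms e_class_eqI e_homotopic_mono unfolding e_class_def by blast
  moreover have "xs \<in> e_class F xs"
    using assms by (simp add: e_class_def e_homotopic_refl)
  ultimately show ?thesis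
    unfolding e_bonding_def by blast
qed

lemma fine_entourages_reflexive:
  assumes "E \<in> fine_entourages X"
  shows "reflexive_entourage (topspace X) E"
  using assms unfolding fine_entourages_def
  by unfold_locales auto

section \<open>Paths in abstract topological spaces\<close>

abbreviation unit_interval :: "real topology" where
  "unit_interval \<equiv> top_of_set {0..1}"

definition path_homotopic :: "'a topology \<Rightarrow> 'a \<Rightarrow> 'a \<Rightarrow> (real \<Rightarrow> 'a) \<Rightarrow> (real \<Rightarrow> 'a) \<Rightarrow> bool" where
  "path_homotopic X x y p q \<longleftrightarrow> homotopic_with (\<lambda>h. h 0 = x \<and> h 1 = y) unit_interval X p q"

definition path_join :: "(real \<Rightarrow> 'a) \<Rightarrow> (real \<Rightarrow> 'a) \<Rightarrow> real \<Rightarrow> 'a" where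
  "path_join p q t = (if t \<le> 1/2 then p (2 * t) else q (2 * t - 1))"

definition path_reverse :: "(real \<Rightarrow> 'a) \<Rightarrow> real \<Rightarrow> 'a" where
  "path_reverse p t = p (1 - t)"

lemma loop_homotopic_path_homotopic: "loop_homotopic X a = path_homotopic X a a"
  by (simp add: fun_eq_iff loop_homotopic_def path_homotopic_def)

lemma path_join_ends [simp]: "path_join p q 0 = p 0" "path_join p q 1 = q 1"
  by (simp_all add: path_join_def)

lemma path_reverse_ends [simp]: "path_reverse p 0 = p 1" "path_reverse p 1 = p 0"
  by (simp_all add: path_reverse_def)

lemma compose_path_join: "f \<circ> path_join p q = path_join (f \<circ> p) (f \<circ> q)"
  by (auto simp: fun_eq_iff path_join_def)

lemma compose_path_reverse: "f \<circ> path_reverse p = path_reverse (f \<circ> p)"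
  by (auto simp: fun_eq_iff path_reverse_def)

lemma prod_top_of_set: "prod_topology (top_of_set A) (top_of_set B) = top_of_set (A \<times> B)"
  by (simp add: subtopology_Times[symmetric])

lemma pathin_join:
  assumes "pathin X p" "pathin X q" "p 1 = q 0"
  shows "pathin X (path_join p q)"
proof -
  let ?g = "\<lambda>x. if x \<le> 1/2 then (p \<circ> (\<lambda>t. 2 * t)) x else (q \<circ> (\<lambda>t. 2 * t -1)) x"
  have "continuous_map unit_interval X ?g"
  proof (rule continuous_map_cases_le)
    show "continuous_map (subtopology unit_interval {x \<in> topspace unit_interval. x \<le> 1/2}) X
        (p \<circ> (\<lambda>t. 2 * t))"
      using assms(1) unfolding pathin_def
      by (rule continuous_map_compose[rotated])
        (auto simp: subtopology_subtopology intro!: continuous_intros)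
    show "continuous_map (subtopology unit_interval {x \<in> topspace unit_interval. 1/2 \<le> x}) X
        (q \<circ> (\<lambda>t. 2 * t - 1))"
      using assms(2) unfolding pathin_def
      by (rule continuous_map_compose[rotated])
        (auto simp: subtopology_subtopology intro!: continuous_intros)
  next
    fix t :: real assume "t = 1/2"
    then show "(p \<circ> (\<lambda>t. 2 * t)) t = (q \<circ> (\<lambda>t. 2 * t - 1)) t"
      using assms(3) by (simp only: o_def) simp
  qed auto
  moreover have "path_join p q = ?g"
    by (auto simp: path_join_def)
  ultimately show ?thesis
    by (simp only: pathin_def)
qed

lemma pathin_reverse:
  assumes "pathin X p"
  shows "pathin X (path_reverse p)"
proof -
  have "continuous_map unit_interval unit_interval (\<lambda>t. 1 - t)"
    by (auto intro!: continuous_intros)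
  then show ?thesis
    using assms continuous_map_compose[of unit_interval unit_interval "\<lambda>t. 1 - t" X p]
    by (simp add: pathin_def path_reverse_def[abs_def] o_def)
qed

lemma path_homotopic_refl: "pathin X p \<Longrightarrow> path_homotopic X (p 0) (p 1) p p"
  by (simp add: path_homotopic_def pathin_def)

lemma path_homotopic_sym: "path_homotopic X x y p q \<Longrightarrow> path_homotopic X x y q p"
  by (simp add: path_homotopic_def homotopic_with_sym)

lemma path_homotopic_trans [trans]:
  "path_homotopic X x y p q \<Longrightarrow> path_homotopic X x y q r \<Longrightarrow> path_homotopic X x y p r"
  unfolding path_homotopic_def by (rule homotopic_with_trans)

lemma path_homotopic_ends:
  assumes "path_homotopic X x y p q"
  shows "p 0 = x" "p 1 = y" "q 0 = x" "q 1 = y"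
  using homotopic_with_imp_property[OF assms[unfolded path_homotopic_def]] by auto

lemma path_homotopic_pathin:
  assumes "path_homotopic X x y p q"
  shows "pathin X p" "pathin X q"
  using homotopic_with_imp_continuous_maps[OF assms[unfolded path_homotopic_def]]
  by (auto simp: pathin_def)

lemma path_homotopic_eq:
  assumes "path_homotopic X x y p q"
    and "\<And>t. t \<in> {0..1} \<Longrightarrow> p' t = p t" "\<And>t. t \<in> {0..1} \<Longrightarrow> q' t = q t"
  shows "path_homotopic X x y p' q'"
  using assms unfolding path_homotopic_def by (elim homotopic_with_eq) auto

lemma path_homotopic_compose:
  assumes "path_homotopic X x y p q" "continuous_map X Z f"
  shows "path_homotopic Z (f x) (f y) (f \<circ> p) (f \<circ> q)"
  using assms unfolding path_homotopic_def
  by (elim homotopic_with_compose_continuous_map_left) auto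

text \<open>Every reparametrisation of paths used below is an instance of this: two paths in a convex
  set with the same ends are homotopic along segments, so their images under one map are
  homotopic.\<close>

lemma path_homotopic_convex:
  fixes S :: "'b :: real_normed_vector set"
  assumes K: "continuous_map (top_of_set S) X K" and S: "convex S"
    and p: "continuous_on {0..1} p" "p ` {0..1} \<subseteq> S"
    and q: "continuous_on {0..1} q" "q ` {0..1} \<subseteq> S"
    and ends: "q 0 = p 0" "q 1 = p 1"
    and eq: "\<And>t. t \<in> {0..1} \<Longrightarrow> P t = K (p t)" "\<And>t. t \<in> {0..1} \<Longrightarrow> Q t = K (q t)"
  shows "path_homotopic X (K (p 0)) (K (p 1)) P Q"
proof -
  have "homotopic_paths S p q"
  proof (rule homotopic_paths_linear)
    show "closed_segment (p t) (q t) \<subseteq> S" if "t \<in> {0..1}" for t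
      using that p q S by (intro closed_segment_subset) auto
  qed (use p q ends in \<open>auto simp: path_def pathstart_def pathfinish_def\<close>)
  then have "homotopic_with (\<lambda>h. h 0 = K (p 0) \<and> h 1 = K (p 1)) unit_interval X (K \<circ> p) (K \<circ> q)"
    unfolding homotopic_paths_def
    by (rule homotopic_with_compose_continuous_map_left[OF _ K])
      (auto simp: pathstart_def pathfinish_def)
  then show ?thesis
    using eq by (auto simp: path_homotopic_def elim!: path_homotopic_eq[unfolded path_homotopic_def])
qed

lemma path_homotopic_reparam:
  assumes p: "pathin X p"
    and \<phi>: "continuous_on {0..1} \<phi>" "\<phi> ` {0..1} \<subseteq> {0..1}" "\<phi> 0 = 0" "\<phi> 1 = 1"
    and eq: "\<And>t. t \<in> {0..1} \<Longrightarrow> q t = p (\<phi> t)"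
  shows "path_homotopic X (p 0) (p 1) q p"
  using path_homotopic_convex[of "{0..1}" X p \<phi> "\<lambda>t. t" q p] assms
  by (auto simp: pathin_def)

lemma path_homotopic_join_const_left:
  assumes "pathin X p"
  shows "path_homotopic X (p 0) (p 1) (path_join (\<lambda>_. p 0) p) p"
proof (rule path_homotopic_reparam[OF assms, where \<phi> = "\<lambda>t. max 0 (2 * t - 1)"])
  show "path_join (\<lambda>_. p 0) p t = p (max 0 (2 * t - 1))" for t
    by (cases "t \<le> 1/2") (simp_all add: path_join_def max_absorb1 max_absorb2)
qed (auto intro!: continuous_intros)

lemma path_homotopic_join_const_right:
  assumes "pathin X p"
  shows "path_homotopic X (p 0) (p 1) (path_join p (\<lambda>_. p 1)) p"
proof (rule path_homotopic_reparam[OF assms, where \<phi> = "\<lambda>t. min 1 (2 * t)"])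
  show "path_join p (\<lambda>_. p 1) t = p (min 1 (2 * t))" for t
    by (cases "t \<le> 1/2") (simp_all add: path_join_def min_absorb1 min_absorb2)
qed (auto intro!: continuous_intros)

lemma path_homotopic_join_reverse_left:
  assumes "pathin X p"
  shows "path_homotopic X (p 1) (p 1) (path_join (path_reverse p) p) (\<lambda>_. p 1)"
proof -
  let ?\<phi> = "\<lambda>t :: real. \<bar>2 * t - 1\<bar>"
  have "path_homotopic X (p (?\<phi> 0)) (p (?\<phi> 1)) (path_join (path_reverse p) p) (\<lambda>_. p 1)"
  proof (rule path_homotopic_convex[where S = "{0..1}" and q = "\<lambda>_. 1"])
    show "path_join (path_reverse p) p t = p (?\<phi> t)" for t
    proof (cases "t \<le> 1/2")
      case True
      then have "?\<phi> t = 1 - 2 * t" by linarith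
      then show ?thesis using True by (simp add: path_join_def path_reverse_def)
    qed (simp add: path_join_def)
  qed (use assms in \<open>auto simp: pathin_def intro!: continuous_intros\<close>)
  then show ?thesis by simp
qed

lemma path_homotopic_join_assoc:
  assumes p: "pathin X p" and q: "pathin X q" and r: "pathin X r" and "p 1 = q 0" "q 1 = r 0"
  shows "path_homotopic X (p 0) (r 1) (path_join (path_join p q) r) (path_join p (path_join q r))"
proof -
  let ?m = "path_join p (path_join q r)"
  \<comment> \<open>the piecewise linear map with slopes 2, 1, 1/2, which takes the break points 1/4, 1/2 of the left
    bracketing to the break points 1/2, 3/4 of the right one; being concave, it is a minimum\<close>
  define \<phi> :: "real \<Rightarrow> real" where "\<phi> t = min (min (2 * t) (t + 1/4)) (t / 2 + 1/2)" for t
  have "pathin X ?m"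
    using assms by (simp add: pathin_join)
  then have "path_homotopic X (?m 0) (?m 1) (path_join (path_join p q) r) ?m"
  proof (rule path_homotopic_reparam[where \<phi> = \<phi>])
    show "continuous_on {0..1} \<phi>"
      unfolding \<phi>_def by (auto intro!: continuous_intros)
    show "path_join (path_join p q) r t = ?m (\<phi> t)" for t
    proof -
      consider "t \<le> 1/4" | "1/4 < t" "t \<le> 1/2" | "1/2 < t" by linarith
      then show ?thesis
      proof cases
        case 1
        then have "\<phi> t = 2 * t" by (simp add: \<phi>_def)
        then show ?thesis using 1 by (simp add: path_join_def)
      next
        case 2
        then have "\<phi> t = t + 1/4" by (simp add: \<phi>_def)
        then show ?thesis using 2 by (simp add: path_join_def algebra_simps)
      next
        case 3
        then have "\<phi> t = t / 2 + 1/2" by (simp add: \<phi>_def)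
        then show ?thesis using 3 by (simp add: path_join_def algebra_simps)
      qed
    qed
  qed (auto simp: \<phi>_def)
  then show ?thesis by simp
qed

lemma path_homotopic_join:
  assumes "path_homotopic X x y p p'" "path_homotopic X y z q q'"
  shows "path_homotopic X x z (path_join p q) (path_join p' q')"
proof -
  let ?II = "prod_topology unit_interval unit_interval"
  obtain h where h: "continuous_map ?II X h"
      "\<And>t. h (0, t) = p t" "\<And>t. h (1, t) = p' t"
      "\<And>s. s \<in> {0..1} \<Longrightarrow> h (s, 0) = x \<and> h (s, 1) = y"
    using assms(1) unfolding path_homotopic_def homotopic_with_def by blast
  obtain k where k: "continuous_map ?II X k"
      "\<And>t. k (0, t) = q t" "\<And>t. k (1, t) = q' t"
      "\<And>s. s \<in> {0..1} \<Longrightarrow> k (s, 0) = y \<and> k (s, 1) = z"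
    using assms(2) unfolding path_homotopic_def homotopic_with_def by blast
  let ?H = "\<lambda>u. if snd u \<le> 1/2 then (h \<circ> (\<lambda>u. (fst u, 2 * snd u))) u
    else (k \<circ> (\<lambda>u. (fst u, 2 * snd u - 1))) u"
  have "continuous_map ?II X ?H"
  proof (rule continuous_map_cases_le)
    show "continuous_map ?II euclideanreal snd"
      by (simp add: prod_top_of_set continuous_intros)
    show "continuous_map (subtopology ?II {u \<in> topspace ?II. snd u \<le> 1/2}) X
        (h \<circ> (\<lambda>u. (fst u, 2 * snd u)))"
      using h(1) by (rule continuous_map_compose[rotated])
        (auto simp: prod_top_of_set subtopology_subtopology intro!: continuous_intros)
    show "continuous_map (subtopology ?II {u \<in> topspace ?II. 1/2 \<le> snd u}) X
        (k \<circ> (\<lambda>u. (fst u, 2 * snd u - 1)))"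
      using k(1) by (rule continuous_map_compose[rotated])
        (auto simp: prod_top_of_set subtopology_subtopology intro!: continuous_intros)
  next
    fix u :: "real \<times> real" assume u: "u \<in> topspace ?II" "snd u = 1/2"
    then obtain t where "u = (t, 1/2)" "t \<in> {0..1}"
      by (cases u) auto
    then show "(h \<circ> (\<lambda>u. (fst u, 2 * snd u))) u = (k \<circ> (\<lambda>u. (fst u, 2 * snd u - 1))) u"
      using h(4) k(4) by simp
  qed auto
  then show ?thesis
    unfolding path_homotopic_def homotopic_with_def
    using h k by (intro exI[of _ ?H]) (auto simp: path_join_def)
qed

lemma simply_connected_convex:
  fixes S :: "'b :: real_normed_vector set"
  assumes "convex S"
  shows "simply_connected_space (top_of_set S)"
  unfolding simply_connected_space_def
proof (intro conjI allI impI)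
  show "path_connected_space (top_of_set S)"
    using convex_imp_path_connected[OF assms] by (metis path_connectedin_def path_connectedin_euclidean)
  fix u c assume "loop_at (top_of_set S) u c"
  then have c: "continuous_on {0..1} c" "c ` {0..1} \<subseteq> S" "c 0 = u" "c 1 = u"
    by (auto simp: loop_at_def pathin_def)
  have "u \<in> S"
    using c(2,3) by (metis atLeastAtMost_iff image_subset_iff order_refl zero_le_one)
  have "path_homotopic (top_of_set S) (c 0) (c 1) c (\<lambda>_. u)"
  proof (rule path_homotopic_convex[where K = "\<lambda>x. x" and S = S and q = "\<lambda>_. u"])
    show "continuous_map (top_of_set S) (top_of_set S) (\<lambda>x. x)"
      by simp
    show "(\<lambda>_. u) ` {0..1::real} \<subseteq> S"
      using \<open>u \<in> S\<close> by blast
  qed (use c assms in simp_all)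
  then show "loop_homotopic (top_of_set S) u c (\<lambda>_. u)"
    using c by (simp add: loop_homotopic_path_homotopic)
qed

section \<open>The class of chains along a path\<close>

text \<open>Fine subdivisions of arbitrary intervals, in a form that allows induction on the list.\<close>

definition fine_on :: "('a \<times> 'a) set \<Rightarrow> (real \<Rightarrow> 'a) \<Rightarrow> real list \<Rightarrow> bool" where
  "fine_on E c ts \<longleftrightarrow> ts \<noteq> [] \<and>
     successively (\<lambda>s t. s < t \<and> c ` {s..t} \<times> c ` {s..t} \<subseteq> E) ts"

lemma fine_on_Cons:
  "fine_on E c (s # t # ts) \<longleftrightarrow> s < t \<and> c ` {s..t} \<times> c ` {s..t} \<subseteq> E \<and> fine_on E c (t # ts)"
  by (auto simp: fine_on_def)

lemma fine_on_less_last: "fine_on E c (s # t # ts) \<Longrightarrow> s < last (t # ts)"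
proof (induction ts arbitrary: s t)
  case (Cons u us)
  then show ?case by (force simp: fine_on_Cons)
qed (simp add: fine_on_Cons)

lemma fine_on_mono: "fine_on F c ts \<Longrightarrow> F \<subseteq> E \<Longrightarrow> fine_on E c ts"
  unfolding fine_on_def by (auto elim!: successively_mono)

lemma fine_partition_iff: "fine_partition E c ts \<longleftrightarrow> fine_on E c ts \<and> hd ts = 0 \<and> last ts = 1"
proof -
  have "sorted_wrt (<) ts \<longleftrightarrow> successively (<) ts"
    by (intro successively_conv_sorted_wrt[symmetric]) (auto simp: transp_def)
  moreover have "fine_on E c ts \<longleftrightarrow> ts \<noteq> [] \<and> successively (<) ts \<and>
      successively (\<lambda>s t. c ` {s..t} \<times> c ` {s..t} \<subseteq> E) ts"
    unfolding fine_on_def successively_conv_nth by meson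
  ultimately show ?thesis
    by (simp only: fine_partition_def) argo
qed

lemma fine_on_chain: "fine_on E c ts \<Longrightarrow> e_chain E (map c ts)"
  unfolding fine_on_def e_chain_def successively_map
  by (auto elim!: successively_mono)

text \<open>Two fine subdivisions of one interval are compared by induction: the earlier of the two
  second points is inserted into the other subdivision, which is a move of chains.\<close>

lemma fine_on_homotopic:
  assumes "fine_on E c ts" "fine_on E c us" "hd ts = hd us" "last ts = last us"
  shows "e_homotopic E (map c ts) (map c us)"
  using assms
proof (induction "length ts + length us" arbitrary: ts us rule: less_induct)
  case less
  have step: "e_homotopic E (map c ts) (map c us)"
    if fine: "fine_on E c ts" "fine_on E c us" and eq: "last ts = last us"
      and ts: "ts = s # t # ts'" and us: "us = s # t' # us'" and tt: "t < t'"
      and IH: "\<And>xs ys. length xs + length ys < length ts + length us \<Longrightarrow> fine_on E c xs \<Longrightarrow>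
        fine_on E c ys \<Longrightarrow> hd xs = hd ys \<Longrightarrow> last xs = last ys \<Longrightarrow>
        e_homotopic E (map c xs) (map c ys)"
    for ts us ts' us' s t t'
  proof -
    have st: "s < t" and sq: "c ` {s..t'} \<times> c ` {s..t'} \<subseteq> E"
      using fine ts us by (auto simp: fine_on_Cons)
    have pts: "(c x, c y) \<in> E" if "x \<in> {s, t, t'}" "y \<in> {s, t, t'}" for x y
    proof -
      have "x \<in> {s..t'}" "y \<in> {s..t'}" using that st tt by auto
      then show ?thesis using sq by blast
    qed
    have "c ` {t..t'} \<subseteq> c ` {s..t'}"
      using st by auto
    then have "c ` {t..t'} \<times> c ` {t..t'} \<subseteq> E"
      using sq by (meson Sigma_mono order_trans)
    then have "fine_on E c (t # t' # us')"
      using fine us tt by (simp add: fine_on_Cons)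
    then have "e_homotopic E (map c (t # ts')) (map c (t # t' # us'))"
      using fine eq ts us by (intro IH) (auto simp: fine_on_Cons)
    then have "e_homotopic E (map c ts) (c s # map c (t # t' # us'))"
      using e_homotopic_Cons[of E "map c (t # ts')" "map c (t # t' # us')" "c s"] pts ts by simp
    also have "e_homotopic E (c s # map c (t # t' # us')) (map c us)"
      using fine us pts fine_on_chain[of E c "t' # us'"]
      by (auto simp: fine_on_Cons intro!: e_homotopic_sym[OF e_homotopic_Cons_insert])
    finally show ?thesis .
  qed
  show ?case
  proof (cases ts)
    case Nil
    then show ?thesis using less.prems by (simp add: fine_on_def)
  next
    case ts: (Cons s ts')
    then obtain us' where us: "us = s # us'"
      using less.prems by (cases us) (auto simp: fine_on_def)
    show ?thesis
    proof (cases ts')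
      case Nil
      then have "us' = []"
        using less.prems ts us fine_on_less_last[of E c s] by (cases us') fastforce+
      then show ?thesis
        using Nil ts us by (simp add: e_homotopic_refl)
    next
      case ts': (Cons t ts'')
      then obtain t' us'' where us': "us' = t' # us''"
        using less.prems ts us fine_on_less_last[of E c s] by (cases us') fastforce+
      consider "t < t'" | "t' < t" | "t = t'" by linarith
      then show ?thesis
      proof cases
        case 1
        then show ?thesis
          using less.prems ts ts' us us' by (intro step[OF _ _ _ _ _ _ less.hyps]) auto
      next
        case 2
        have "e_homotopic E (map c us) (map c ts)"
          using 2 less.prems ts ts' us us'
          by (intro step[OF _ _ _ _ _ _ less.hyps]) auto
        then show ?thesis by (rule e_homotopic_sym)
      next
        case 3
        have "e_homotopic E (map c ts') (map c us')"
          using 3 less.prems ts ts' us us' by (intro less.hyps) (auto simp: fine_on_Cons)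
        moreover have "(c s, c t) \<in> E"
          using less.prems ts ts' by (auto simp: fine_on_Cons)
        ultimately show ?thesis
          using ts ts' us e_homotopic_Cons[of E "map c ts'" "map c us'" "c s"] by simp
      qed
    qed
  qed
qed

lemma square_mono: "A \<subseteq> B \<Longrightarrow> B \<times> B \<subseteq> E \<Longrightarrow> A \<times> A \<subseteq> E"
  by blast

lemma fine_entourage_nbhd:
  assumes "E \<in> fine_entourages X" "x \<in> topspace X"
  obtains N where "openin X N" "x \<in> N" "N \<times> N \<subseteq> E"
proof -
  obtain W where W: "openin (prod_topology X X) W" "Id_on (topspace X) \<subseteq> W" "W \<subseteq> E"
    using assms(1) by (auto simp: fine_entourages_def)
  then have "(x, x) \<in> W"
    using assms(2) by auto
  then obtain U V where "openin X U" "openin X V" "x \<in> U" "x \<in> V" "U \<times> V \<subseteq> W"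
    using W(1) unfolding openin_prod_topology_alt by meson
  then show thesis
    using W(3) by (intro that[of "U \<inter> V"]) auto
qed

text \<open>The open sets whose part in \<open>S\<close> has a small image cover \<open>S\<close>; a Lebesgue number of this cover
  serves as \<open>\<delta>\<close>.\<close>

lemma fine_entourage_uniform:
  fixes S :: "'b :: metric_space set"
  assumes K: "continuous_map (top_of_set S) X K" and S: "compact S" and E: "E \<in> fine_entourages X"
  obtains \<delta> where "0 < \<delta>" "\<And>T. T \<subseteq> S \<Longrightarrow> diameter T < \<delta> \<Longrightarrow> K ` T \<times> K ` T \<subseteq> E"
proof -
  let ?C = "{B. open B \<and> K ` (B \<inter> S) \<times> K ` (B \<inter> S) \<subseteq> E}"
  have "S \<subseteq> \<Union>?C"
  proof
    fix s assume s: "s \<in> S"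
    then have "K s \<in> topspace X"
      using K by (auto simp: continuous_map_def)
    then obtain N where N: "openin X N" "K s \<in> N" "N \<times> N \<subseteq> E"
      using fine_entourage_nbhd[OF E] by blast
    then have "openin (top_of_set S) {x \<in> S. K x \<in> N}"
      using openin_continuous_map_preimage[OF K] by auto
    then obtain B where B: "open B" "{x \<in> S. K x \<in> N} = S \<inter> B"
      by (auto simp: openin_open)
    then have "K ` (B \<inter> S) \<subseteq> N" by auto
    then have "B \<in> ?C"
      using B(1) N(3) by (auto simp: image_subset_iff)
    then show "s \<in> \<Union>?C"
      using B(2) N(2) s by blast
  qed
  moreover have "?C \<noteq> {}"
    by (auto intro!: exI[of _ "{}"])
  ultimately obtain \<delta> where \<delta>: "0 < \<delta>" "\<And>T. T \<subseteq> S \<Longrightarrow> diameter T < \<delta> \<Longrightarrow> \<exists>B\<in>?C. T \<subseteq> B"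
    using Lebesgue_number_lemma[OF S, of ?C] by blast
  show thesis
  proof (rule that[OF \<delta>(1)])
    fix T assume T: "T \<subseteq> S" "diameter T < \<delta>"
    then obtain B where B: "B \<in> ?C" "T \<subseteq> B"
      using \<delta>(2) by meson
    then have "K ` T \<subseteq> K ` (B \<inter> S)"
      using T(1) by auto
    then show "K ` T \<times> K ` T \<subseteq> E"
      using B(1) by (elim square_mono) blast
  qed
qed

lemma fine_partition_grid:
  assumes "n > 0" "\<And>i. i < n \<Longrightarrow> c ` {real i / n..real (Suc i) / n} \<times> c ` {real i / n..real (Suc i) / n} \<subseteq> E"
  shows "fine_partition E c (map (\<lambda>i. real i / n) [0..<Suc n])"
  unfolding fine_partition_iff fine_on_def
proof (intro conjI)
  show "successively (\<lambda>s t. s < t \<and> c ` {s..t} \<times> c ` {s..t} \<subseteq> E) (map (\<lambda>i. real i / n) [0..<Suc n])"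
    unfolding successively_conv_nth
  proof (intro allI impI)
    fix i assume "Suc i < length (map (\<lambda>i. real i / real n) [0..<Suc n])"
    then have "i < n" by simp
    then show "map (\<lambda>i. real i / real n) [0..<Suc n] ! i < map (\<lambda>i. real i / real n) [0..<Suc n] ! Suc i \<and>
      c ` {map (\<lambda>i. real i / real n) [0..<Suc n] ! i..map (\<lambda>i. real i / real n) [0..<Suc n] ! Suc i} \<times>
      c ` {map (\<lambda>i. real i / real n) [0..<Suc n] ! i..map (\<lambda>i. real i / real n) [0..<Suc n] ! Suc i} \<subseteq> E"
      using assms by (simp add: nth_append divide_strict_right_mono del: upt_Suc)
  qed
  show "hd (map (\<lambda>i. real i / n) [0..<Suc n]) = 0"
    by (simp add: hd_map del: upt_Suc)
  show "last (map (\<lambda>i. real i / n) [0..<Suc n]) = 1"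
    using assms(1) by simp
qed simp

lemma grid_cell_subset:
  assumes "i < n"
  shows "{real i / n..real (Suc i) / n} \<subseteq> {0..1}"
  using assms by (auto simp: field_simps intro: order_trans[of _ "real i / n"])

lemma fine_partition_exists:
  assumes "pathin X c" "E \<in> fine_entourages X"
  obtains ts where "fine_partition E c ts"
proof -
  obtain \<delta> where \<delta>: "0 < \<delta>" "\<And>T. T \<subseteq> {0..1} \<Longrightarrow> diameter T < \<delta> \<Longrightarrow> c ` T \<times> c ` T \<subseteq> E"
    using fine_entourage_uniform[of "{0..1}" X c E] assms by (auto simp: pathin_def)
  obtain n where n: "n > 0" "inverse (real n) < \<delta>"
    using ex_inverse_of_nat_less[OF \<delta>(1)] by blast
  have "fine_partition E c (map (\<lambda>i. real i / n) [0..<Suc n])"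
  proof (rule fine_partition_grid[OF n(1)])
    fix i assume i: "i < n"
    have "diameter {real i / n..real (Suc i) / n} = inverse (real n)"
      using n(1) by (simp add: divide_right_mono field_simps)
    then show "c ` {real i / n..real (Suc i) / n} \<times> c ` {real i / n..real (Suc i) / n} \<subseteq> E"
      using \<delta>(2)[OF grid_cell_subset[OF i]] n(2) by simp
  qed
  then show thesis by (rule that)
qed

text \<open>The square of a homotopy is cut into small cells; neighbouring rows of the grid form a
  ladder, and the ends of the rows do not move.\<close>

lemma path_homotopic_imp_e_homotopic:
  assumes hom: "path_homotopic X x y c d" and E: "E \<in> fine_entourages X"
    and ts: "fine_partition E c ts" and us: "fine_partition E d us"
  shows "e_homotopic E (map c ts) (map d us)"
proof -
  interpret reflexive_entourage "topspace X" E
    using E by (rule fine_entourages_reflexive)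
  obtain h where h: "continuous_map (prod_topology unit_interval unit_interval) X h"
      "\<And>t. h (0, t) = c t" "\<And>t. h (1, t) = d t"
      "\<And>s. s \<in> {0..1} \<Longrightarrow> h (s, 0) = x \<and> h (s, 1) = y"
    using hom unfolding path_homotopic_def homotopic_with_def by blast
  have h': "continuous_map (top_of_set ({0..1} \<times> {0..1})) X h"
    using h(1) by (simp add: prod_top_of_set)
  obtain \<delta> where \<delta>: "0 < \<delta>"
    "\<And>T. T \<subseteq> {0..1} \<times> {0..1} \<Longrightarrow> diameter T < \<delta> \<Longrightarrow> h ` T \<times> h ` T \<subseteq> E"
    using fine_entourage_uniform[OF h' compact_Times[OF compact_Icc compact_Icc] E] by blast
  \<comment> \<open>a square cell of side \<open>1 / n\<close> has diameter at most \<open>2 / n\<close>\<close>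
  obtain n where n: "n > 0" "inverse (real n) < \<delta> / 2"
    using ex_inverse_of_nat_less[of "\<delta> / 2"] \<delta>(1) by auto
  define I where "I i = {real i / n..real (Suc i) / n}" for i
  have I_width: "I i = {real i / n..real i / n + inverse (real n)}" for i
    by (simp add: I_def add_divide_distrib inverse_eq_divide add.commute)
  have I01: "I i \<subseteq> {0..1}" if "i < n" for i
    using grid_cell_subset[OF that] by (simp add: I_def)
  have cell: "h ` (I j \<times> I i) \<times> h ` (I j \<times> I i) \<subseteq> E" if "i < n" "j < n" for i j
  proof (rule \<delta>(2))
    show "I j \<times> I i \<subseteq> {0..1} \<times> {0..1}"
      using I01[OF that(1)] I01[OF that(2)] by blast
    have "diameter (I j \<times> I i) \<le> 2 * inverse (real n)"
    proof (rule diameter_le)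
      fix u v assume "u \<in> I j \<times> I i" "v \<in> I j \<times> I i"
      then have "\<bar>fst u - fst v\<bar> \<le> inverse (real n)" "\<bar>snd u - snd v\<bar> \<le> inverse (real n)"
        by (auto simp: I_width abs_le_iff)
      moreover have "norm (u - v) \<le> norm (fst u - fst v) + norm (snd u - snd v)"
        using norm_Pair_le[of "fst u - fst v" "snd u - snd v"] by (cases u, cases v) simp
      ultimately show "norm (u - v) \<le> 2 * inverse (real n)"
        by simp
    qed (simp add: field_simps)
    then show "diameter (I j \<times> I i) < \<delta>"
      using n(2) by simp
  qed
  define row where "row j = map (\<lambda>i. h (real j / n, real i / n)) [0..<Suc n]" for j
  \<comment> \<open>the inner rows are only compared with their neighbours, so fineness matters for the outer two\<close>
  have fine_row: "fine_partition E (\<lambda>t. h (real j / n, t)) (map (\<lambda>i. real i / n) [0..<Suc n])"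
    if "j \<in> {0, n}" for j
  proof (rule fine_partition_grid[OF n(1)])
    fix i assume i: "i < n"
    obtain j' where j': "j' < n" "real j / n \<in> I j'"
    proof (cases "j = 0")
      case True
      then show ?thesis using n(1) that[of 0] by (auto simp: I_def)
    next
      case False
      then have "j = n" using \<open>j \<in> {0, n}\<close> by simp
      then show ?thesis using n(1) that[of "n - 1"] by (auto simp: I_def field_simps)
    qed
    have "(\<lambda>t. h (real j / n, t)) ` I i \<subseteq> h ` (I j' \<times> I i)"
      using j'(2) by auto
    then show "(\<lambda>t. h (real j / n, t)) ` {real i / n..real (Suc i) / n} \<times>
        (\<lambda>t. h (real j / n, t)) ` {real i / n..real (Suc i) / n} \<subseteq> E"
      using cell[OF i j'(1)] unfolding I_def[symmetric] by (rule square_mono)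
  qed
  have xx: "(x, x) \<in> E" and yy: "(y, y) \<in> E"
  proof -
    have "x \<in> topspace X" "y \<in> topspace X"
      using path_homotopic_pathin(1)[OF hom] path_homotopic_ends[OF hom]
        path_start_in_topspace path_finish_in_topspace by metis+
    then show "(x, x) \<in> E" "(y, y) \<in> E" using diag by auto
  qed
  have step: "e_homotopic E (row j) (row (Suc j))" if j: "j < n" for j
  proof -
    let ?f = "\<lambda>i. h (real j / n, real i / n)" and ?g = "\<lambda>i. h (real (Suc j) / n, real i / n)"
    have e: "real j / n \<in> {0..1}" "real (Suc j) / n \<in> {0..1}"
      using j by (auto simp: field_simps)
    then have ends: "?f 0 = x" "?g 0 = x" "?f n = y" "?g n = y"
      using h(4) n(1) by auto
    have lad: "e_homotopic E (row j @ [?g n]) (?f 0 # row (Suc j))"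
      unfolding row_def
    proof (rule ladder)
      fix i assume i: "i < n"
      have "{?f i, ?f (Suc i), ?g i, ?g (Suc i)} \<subseteq> h ` (I j \<times> I i)"
        by (auto simp: I_def divide_right_mono intro!: image_eqI[OF refl])
      then show "{?f i, ?f (Suc i), ?g i, ?g (Suc i)} \<times> {?f i, ?f (Suc i), ?g i, ?g (Suc i)} \<subseteq> E"
        using cell[OF i j] by (rule square_mono)
    qed (use ends xx in simp)
    have "hd (row j) = x" "hd (row (Suc j)) = x"
      using ends(1,2) unfolding row_def by (simp_all add: hd_map del: upt_Suc of_nat_Suc)
    moreover have "last (row j) = y"
      using ends(3) by (simp add: row_def)
    ultimately have hl: "hd (row j) = x" "last (row j) = y" "hd (row (Suc j)) = x"
      by simp_all
    have rj: "e_chain E (row j)" and rsj: "e_chain E (row (Suc j))"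
      using e_homotopic_chain(1,2)[OF lad] e_chain_append[of "row j" "[?g n]" E]
        e_chain_append[of "[?f 0]" "row (Suc j)" E]
      by (auto simp: row_def simp del: upt_Suc)
    have "e_homotopic E (row j) (row j @ [last (row j)])"
      using rj hl yy by (intro e_homotopic_snoc_stutter) auto
    also have "row j @ [last (row j)] = row j @ [?g n]"
      using hl ends by simp
    also note lad
    also have "e_homotopic E (?f 0 # row (Suc j)) (row (Suc j))"
    proof -
      obtain r where r: "row (Suc j) = x # r"
        using hl(3) by (cases "row (Suc j)") (auto simp: row_def simp del: upt_Suc)
      show ?thesis
      proof (cases r)
        case Nil
        then show ?thesis
          using r xx ends by (auto intro: e_homotopic_sym[OF e_homotopic_stutter])
      next
        case (Cons z zs)
        then have "(x, z) \<in> E" "e_chain E (z # zs)"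
          using rsj r by (auto simp: e_chain_Cons)
        then show ?thesis
          using Cons r xx ends by (auto intro: e_homotopic_sym[OF e_homotopic_Cons_insert])
      qed
    qed
    finally show ?thesis .
  qed
  have row0: "row 0 = map c (map (\<lambda>i. real i / n) [0..<Suc n])"
    using h(2) by (simp add: row_def)
  have rown: "row n = map d (map (\<lambda>i. real i / n) [0..<Suc n])"
    using h(3) n(1) by (simp add: row_def)
  have f0: "fine_partition E c (map (\<lambda>i. real i / n) [0..<Suc n])"
    using fine_row[of 0] h(2) by simp
  have fn: "fine_partition E d (map (\<lambda>i. real i / n) [0..<Suc n])"
    using fine_row[of n] h(3) n(1) by simp
  have rows: "e_homotopic E (row 0) (row j)" if "j \<le> n" for j
    using that
  proof (induction j)
    case 0
    have "e_chain E (row 0)"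
      unfolding row0 using f0 by (intro fine_on_chain) (simp only: fine_partition_iff)
    then show ?case by (rule e_homotopic_refl)
  next
    case (Suc j)
    then show ?case using step[of j] e_homotopic_trans by auto
  qed
  have "e_homotopic E (map c ts) (row 0)"
    unfolding row0 using ts f0 by (intro fine_on_homotopic) (auto simp: fine_partition_iff)
  also note rows[OF order_refl]
  also have "e_homotopic E (row n) (map d us)"
    unfolding rown using us fn by (intro fine_on_homotopic) (auto simp: fine_partition_iff)
  finally show ?thesis .
qed

text \<open>For a loop this is the coordinate at \<open>E\<close> of its image under \<open>\<lambda>\<close>; the value does not depend on the
  chosen subdivision (\<open>chain_class_eq\<close>), and paths that are not closed are admitted.\<close>

definition chain_class :: "('a \<times> 'a) set \<Rightarrow> (real \<Rightarrow> 'a) \<Rightarrow> 'a list set" where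
  "chain_class E c = e_class E (map c (SOME ts. fine_partition E c ts))"

lemma chain_class_eq:
  assumes "fine_partition E c ts"
  shows "chain_class E c = e_class E (map c ts)"
proof -
  have "fine_partition E c (SOME ts. fine_partition E c ts)"
    using assms by (rule someI)
  then have "e_homotopic E (map c (SOME ts. fine_partition E c ts)) (map c ts)"
    using assms by (intro fine_on_homotopic) (auto simp: fine_partition_iff)
  then show ?thesis
    by (simp add: chain_class_def e_class_eqI)
qed

lemma fine_partition_chain:
  assumes "fine_partition E c ts"
  shows "e_chain E (map c ts)" "hd (map c ts) = c 0" "last (map c ts) = c 1"
  using assms fine_on_chain[of E c ts]
  by (auto simp: fine_partition_iff fine_on_def hd_map last_map)

lemma chain_class_homotopic:
  assumes "path_homotopic X x y c d" "E \<in> fine_entourages X"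
  shows "chain_class E c = chain_class E d"
proof -
  obtain ts us where "fine_partition E c ts" "fine_partition E d us"
    using assms path_homotopic_pathin fine_partition_exists by metis
  then show ?thesis
    using path_homotopic_imp_e_homotopic[OF assms] by (simp add: chain_class_eq e_class_eqI)
qed

lemma chain_class_bonding:
  assumes "pathin X c" "F \<in> fine_entourages X" "F \<subseteq> E"
  shows "e_bonding E (chain_class F c) = chain_class E c"
proof -
  obtain ts where ts: "fine_partition F c ts"
    using assms fine_partition_exists by blast
  then have "fine_partition E c ts"
    using assms(3) fine_on_mono by (auto simp: fine_partition_iff)
  then show ?thesis
    using ts assms(3) by (simp add: chain_class_eq e_bonding_e_class fine_partition_chain)
qed

lemma fine_partition_small: "c ` {0..1} \<times> c ` {0..1} \<subseteq> E \<Longrightarrow> fine_partition E c [0, 1]"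
  by (simp add: fine_partition_def)

lemma fine_partition_subset:
  assumes "fine_partition E c ts" "t \<in> set ts"
  shows "t \<in> {0..1}"
proof -
  have "hd us \<le> u \<and> u \<le> last us" if "sorted_wrt (<) us" "u \<in> set us" for u :: real and us
    using that by (induction us) (auto split: if_splits intro: less_imp_le)
  then show ?thesis
    using assms by (force simp: fine_partition_def)
qed

lemma fine_on_map:
  assumes "fine_on E c ts" "strict_mono f"
    and "\<And>s t. s \<in> set ts \<Longrightarrow> t \<in> set ts \<Longrightarrow> e ` {f s..f t} \<subseteq> c ` {s..t}"
  shows "fine_on E e (map f ts)"
  using assms(1,3)
proof (induction ts rule: induct_list012)
  case (3 s t ts)
  have sub: "e ` {f s..f t} \<subseteq> c ` {s..t}"
    using 3 by simp
  have sq: "c ` {s..t} \<times> c ` {s..t} \<subseteq> E" and "s < t"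
    using 3 by (auto simp: fine_on_Cons)
  then have "f s < f t"
    using assms(2) by (simp add: strict_mono_less)
  moreover note square_mono[OF sub sq]
  moreover have "fine_on E e (map f (t # ts))"
    using 3 by (intro 3) (auto simp: fine_on_Cons)
  ultimately show ?case
    by (simp add: fine_on_Cons)
qed (auto simp: fine_on_def)

lemma fine_on_glue:
  assumes "fine_on E c xs" "fine_on E c ys" "last xs = hd ys"
  shows "fine_on E c (xs @ tl ys)"
proof -
  obtain y zs where "ys = y # zs"
    using assms(2) by (cases ys) (auto simp: fine_on_def)
  then show ?thesis
    using assms by (cases zs) (auto simp: fine_on_def successively_append_iff)
qed

text \<open>The subdivisions are scaled to the two halves of the interval; their common point \<open>1 / 2\<close> is
  listed once, which on the side of chains is the concatenation that drops the repeated point.\<close>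

lemma fine_partition_join:
  assumes ts: "fine_partition E c ts" and us: "fine_partition E d us" and cd: "c 1 = d 0"
  obtains vs where "fine_partition E (path_join c d) vs"
    "map (path_join c d) vs = map c ts @ tl (map d us)"
proof
  let ?l = "map (\<lambda>t. t / 2) ts" and ?r = "map (\<lambda>t. (t + 1) / 2) us"
  have j1: "path_join c d (t / 2) = c t" if "t \<le> 1" for t
    using that by (simp add: path_join_def)
  have j2: "path_join c d ((t + 1) / 2) = d t" if "t \<ge> 0" for t
    using that cd by (cases "t = 0") (auto simp: path_join_def field_simps)
  have "fine_on E (path_join c d) ?l"
  proof (rule fine_on_map)
    fix s t assume "s \<in> set ts" "t \<in> set ts"
    then have "t \<le> 1" using fine_partition_subset[OF ts] by simp
    show "path_join c d ` {s / 2..t / 2} \<subseteq> c ` {s..t}"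
    proof (rule image_subsetI)
      fix x assume "x \<in> {s / 2..t / 2}"
      then show "path_join c d x \<in> c ` {s..t}"
        using j1[of "2 * x"] \<open>t \<le> 1\<close> by (auto intro!: image_eqI[of _ c "2 * x"])
    qed
  qed (use ts in \<open>auto simp: fine_partition_iff strict_mono_def\<close>)
  moreover have "fine_on E (path_join c d) ?r"
  proof (rule fine_on_map)
    fix s t assume "s \<in> set us" "t \<in> set us"
    then have "0 \<le> s" using fine_partition_subset[OF us] by simp
    show "path_join c d ` {(s + 1) / 2..(t + 1) / 2} \<subseteq> d ` {s..t}"
    proof (rule image_subsetI)
      fix x assume "x \<in> {(s + 1) / 2..(t + 1) / 2}"
      then show "path_join c d x \<in> d ` {s..t}"
        using j2[of "2 * x - 1"] \<open>0 \<le> s\<close> by (auto intro!: image_eqI[of _ d "2 * x - 1"])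
    qed
  qed (use us in \<open>auto simp: fine_partition_iff strict_mono_def\<close>)
  moreover have ne: "ts \<noteq> []" "us \<noteq> []" "hd ts = 0" "last ts = 1" "hd us = 0" "last us = 1"
    using ts us by (auto simp: fine_partition_def)
  ultimately have "fine_on E (path_join c d) (?l @ tl ?r)"
    by (intro fine_on_glue) (auto simp: hd_map last_map)
  moreover have "tl us \<noteq> []"
    using ne by (cases us) auto
  ultimately show "fine_partition E (path_join c d) (?l @ tl ?r)"
    using ne by (auto simp: fine_partition_iff hd_map last_map last_tl map_tl[symmetric])
  have "map (path_join c d) ?l = map c ts"
    using fine_partition_subset[OF ts] j1 by simp
  moreover have "map (path_join c d) (tl ?r) = tl (map d us)"
  proof -
    have "map (path_join c d) ?r = map d us"
      using fine_partition_subset[OF us] j2 by simp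
    then show ?thesis by (simp only: map_tl)
  qed
  ultimately show "map (path_join c d) (?l @ tl ?r) = map c ts @ tl (map d us)"
    by (simp only: map_append)
qed

lemma chain_class_join:
  assumes "fine_partition E c ts" "fine_partition E d us" "c 1 = d 0"
  shows "chain_class E (path_join c d) = e_class E (map c ts @ tl (map d us))"
  using fine_partition_join[OF assms] chain_class_eq by metis

lemma chain_class_join_cong:
  assumes paths: "pathin Z c" "pathin Z c'" "pathin Z d" "pathin Z d'"
    and ends: "c 1 = d 0" "c' 1 = d' 0" and E: "E \<in> fine_entourages Z"
    and eq: "chain_class E c = chain_class E c'" "chain_class E d = chain_class E d'"
  shows "chain_class E (path_join c d) = chain_class E (path_join c' d')"
proof -
  obtain ts ts' us us' where p: "fine_partition E c ts" "fine_partition E c' ts'"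
    "fine_partition E d us" "fine_partition E d' us'"
    using paths fine_partition_exists[OF _ E] by metis
  have "e_homotopic E (map c ts) (map c' ts')" "e_homotopic E (map d us) (map d' us')"
    using p eq by (simp_all add: chain_class_eq e_class_eq_iff fine_partition_chain)
  then have "e_homotopic E (map c ts @ tl (map d us)) (map c' ts' @ tl (map d' us'))"
    using fine_partition_chain[OF p(1)] fine_partition_chain[OF p(3)] ends
    by (intro e_homotopic_concat) simp_all
  then show ?thesis
    using chain_class_join p ends by (metis e_class_eqI)
qed

section \<open>The locally path connected coreflection\<close>

lemma topspace_lpc_coreflection [simp]: "topspace (lpc_coreflection X) = topspace X"
proof -
  have "\<exists>C. (\<exists>U. openin X U \<and> C \<in> path_components_of (subtopology X U)) \<and> x \<in> C"
    if "x \<in> topspace X" for x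
  proof -
    have "x \<in> \<Union> (path_components_of X)"
      using that by (simp add: Union_path_components_of)
    then show ?thesis
      using subtopology_topspace openin_topspace by (metis UnionE)
  qed
  then have "topspace X \<subseteq> \<Union>{C. \<exists>U. openin X U \<and> C \<in> path_components_of (subtopology X U)}"
    by blast
  moreover have "C \<subseteq> topspace X" if "C \<in> path_components_of (subtopology X U)" for C U
    using path_components_of_subset[OF that] by auto
  then have "\<Union>{C. \<exists>U. openin X U \<and> C \<in> path_components_of (subtopology X U)} \<subseteq> topspace X"
    by (intro Union_least) blast
  ultimately show ?thesis
    unfolding lpc_coreflection_def topology_generated_by_topspace by (rule equalityI[rotated])
qed

lemma continuous_map_from_lpc_coreflection: "continuous_map (lpc_coreflection X) X id"
proof -
  have "openin (lpc_coreflection X) U" if U: "openin X U" for U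
  proof (subst openin_subopen, intro ballI)
    fix x assume "x \<in> U"
    then have "x \<in> \<Union> (path_components_of (subtopology X U))"
      using openin_subset[OF U] by (auto simp: Union_path_components_of)
    then obtain C where C: "C \<in> path_components_of (subtopology X U)" "x \<in> C"
      by blast
    then have "openin (lpc_coreflection X) C"
      unfolding lpc_coreflection_def using U by (intro topology_generated_by_Basis) blast
    moreover have "C \<subseteq> U"
      using path_components_of_subset[OF C(1)] by auto
    ultimately show "\<exists>T. openin (lpc_coreflection X) T \<and> x \<in> T \<and> T \<subseteq> U"
      using C(2) by blast
  qed
  then show ?thesis
    by (auto simp: continuous_map_def openin_subset Collect_conj_eq inf_absorb2
        intro: openin_subset[THEN inf_absorb2, THEN ssubst])
qed

text \<open>The couniversal property of the coreflection: if \<open>f y\<close> lies in the path component \<open>C\<close> of \<open>U\<close>, then a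
  path connected neighbourhood of \<open>y\<close> mapped into \<open>U\<close> has a path connected image and is mapped into \<open>C\<close>.\<close>

lemma continuous_map_into_lpc_coreflection:
  assumes Y: "locally_path_connected_space Y" and f: "continuous_map Y X f"
  shows "continuous_map Y (lpc_coreflection X) f"
proof -
  have "openin Y (f -` C \<inter> topspace Y)"
    if U: "openin X U" and C: "C \<in> path_components_of (subtopology X U)" for U C
  proof (subst openin_subopen, intro ballI)
    fix y assume y: "y \<in> f -` C \<inter> topspace Y"
    have CU: "C \<subseteq> U"
      using path_components_of_subset[OF C] by auto
    have "openin Y {z \<in> topspace Y. f z \<in> U}"
      using f U by (rule openin_continuous_map_preimage)
    then obtain V where V: "openin Y V" "path_connectedin Y V" "y \<in> V" "V \<subseteq> {z \<in> topspace Y. f z \<in> U}"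
      using Y y CU unfolding locally_path_connected_space by blast
    have "path_connectedin (subtopology X U) (f ` V)"
      using path_connectedin_continuous_map_image[OF f V(2)] V(4)
      by (auto simp: path_connectedin_subtopology)
    moreover have "f y \<in> C \<inter> f ` V"
      using y V(3) by auto
    ultimately have "f ` V \<subseteq> C"
      using path_components_of_maximal[OF C] by (auto simp: disjnt_iff)
    then have "V \<subseteq> f -` C \<inter> topspace Y"
      using V(4) by auto
    then show "\<exists>T. openin Y T \<and> y \<in> T \<and> T \<subseteq> f -` C \<inter> topspace Y"
      using V by blast
  qed
  moreover have "f ` topspace Y \<subseteq> \<Union>{C. \<exists>U. openin X U \<and> C \<in> path_components_of (subtopology X U)}"
    using continuous_map_image_subset_topspace[OF f] topspace_lpc_coreflection[of X]
    unfolding lpc_coreflection_def topology_generated_by_topspace by blast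
  ultimately show ?thesis
    unfolding lpc_coreflection_def by (intro continuous_on_generated_topo) auto
qed

lemma locally_path_connected_convex:
  fixes S :: "'b :: real_normed_vector set"
  assumes "convex S"
  shows "locally_path_connected_space (top_of_set S)"
  unfolding locally_path_connected_space
proof (intro allI impI)
  fix V x assume "openin (top_of_set S) V \<and> x \<in> V"
  then obtain e where e: "e > 0" "ball x e \<inter> S \<subseteq> V" "x \<in> S"
    unfolding openin_contains_ball by blast
  have "path_connected (ball x e \<inter> S)"
    using assms by (intro convex_imp_path_connected convex_Int) auto
  then show "\<exists>U. openin (top_of_set S) U \<and> path_connectedin (top_of_set S) U \<and> x \<in> U \<and> U \<subseteq> V"
    using e by (intro exI[of _ "ball x e \<inter> S"])
      (auto simp: path_connectedin_subtopology openin_open)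
qed

lemma unit_interval_space:
  "path_connected_space unit_interval" "locally_path_connected_space unit_interval"
  "simply_connected_space unit_interval"
  using simply_connected_convex[of "{0..1::real}"] locally_path_connected_convex[of "{0..1::real}"]
  by (simp_all add: simply_connected_space_def)

lemma pathin_lpc_coreflection: "pathin X c \<Longrightarrow> pathin (lpc_coreflection X) c"
  unfolding pathin_def
  by (intro continuous_map_into_lpc_coreflection locally_path_connected_convex) auto

section \<open>The inverse limit of the chain covers\<close>

lemma fine_entourages_full: "topspace Z \<times> topspace Z \<in> fine_entourages Z"
  unfolding fine_entourages_def
  by (auto simp: sym_def openin_prod_Times_iff intro!: exI[of _ "topspace Z \<times> topspace Z"])

text \<open>The fine uniformity induces the given topology: a neighbourhood \<open>N\<close> of \<open>v\<close> gives the entourage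
  consisting of \<open>N \<times> N\<close> and of all pairs that avoid \<open>v\<close>, which is open because points are closed.\<close>

lemma fine_entourage_at_point:
  assumes "t1_space Z" "openin Z N" "v \<in> N" "E \<in> fine_entourages Z"
  obtains F where "F \<in> fine_entourages Z" "F \<subseteq> E" "\<And>w. (v, w) \<in> F \<Longrightarrow> w \<in> N"
proof -
  let ?M = "topspace Z - {v}"
  have NT: "N \<subseteq> topspace Z"
    using assms(2) by (rule openin_subset)
  have M: "openin Z ?M"
    using assms NT by (intro openin_diff) (auto simp: closedin_t1_singleton)
  have "N \<times> N \<union> ?M \<times> ?M \<in> fine_entourages Z"
    unfolding fine_entourages_def
  proof (intro CollectI conjI exI[of _ "N \<times> N \<union> ?M \<times> ?M"])
    show "openin (prod_topology Z Z) (N \<times> N \<union> ?M \<times> ?M)"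
      using assms(2) M by (intro openin_Un) (auto simp: openin_prod_Times_iff)
  qed (use NT assms in \<open>auto simp: sym_def\<close>)
  then show thesis
    using assms(4) by (intro that[of "E \<inter> (N \<times> N \<union> ?M \<times> ?M)"]) (auto intro: fine_entourages_Int)
qed

lemma topspace_e_cover_topology:
  assumes "E \<in> fine_entourages Z"
  shows "topspace (e_cover_topology (fine_entourages Z) a E) = e_cover a E"
proof -
  have "star_entourage a E E `` {x} \<subseteq> e_cover a E" for x
    unfolding star_entourage_def e_cover_def by blast
  then have "openin (e_cover_topology (fine_entourages Z) a E) (e_cover a E)"
    using assms by (subst openin_e_cover_topology) (auto intro: fine_entourages_Int)
  moreover have "openin (e_cover_topology (fine_entourages Z) a E) U \<Longrightarrow> U \<subseteq> e_cover a E" for U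
    by (subst (asm) openin_e_cover_topology) (auto intro: fine_entourages_Int)
  ultimately show ?thesis
    by (meson openin_subset openin_topspace subset_antisym)
qed

locale uu_space =
  fixes Z :: "'a topology" and a :: 'a
  assumes t1: "t1_space Z" and base: "a \<in> topspace Z"
begin

abbreviation \<E> where "\<E> \<equiv> fine_entourages Z"
abbreviation cover where "cover \<equiv> uu_cover \<E> a"
abbreviation endp where "endp \<equiv> uu_endpoint \<E>"

text \<open>For a path from the basepoint this is the point of the inverse limit at which the lift of the
  path ends.\<close>

definition thread :: "(real \<Rightarrow> 'a) \<Rightarrow> ('a \<times> 'a) set \<Rightarrow> 'a list set" where
  "thread c = (\<lambda>E\<in>\<E>. chain_class E c)"

lemma topspace_cover:
  "topspace cover = {x \<in> Pi\<^sub>E \<E> (e_cover a). \<forall>E\<in>\<E>. \<forall>F\<in>\<E>. F \<subseteq> E \<longrightarrow> e_bonding E (x F) = x E}"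
proof -
  have "(\<Pi>\<^sub>E E\<in>\<E>. topspace (e_cover_topology \<E> a E)) = Pi\<^sub>E \<E> (e_cover a)"
    by (intro PiE_cong topspace_e_cover_topology)
  then show ?thesis
    by (auto simp: uu_cover_def topspace_subtopology)
qed

text \<open>All coordinates of a thread end at the same point: those at \<open>E\<close> and at \<open>F\<close> are both represented by
  a chain that represents the coordinate at \<open>E \<inter> F\<close>.\<close>

lemma cover_component:
  assumes "x \<in> topspace cover" "E \<in> \<E>"
  obtains xs where "x E = e_class E xs" "e_chain E xs" "hd xs = a" "last xs = endp x"
proof -
  have comp: "\<exists>xs. x E = e_class E xs \<and> e_chain E xs \<and> hd xs = a" if "E \<in> \<E>" for E
    using assms(1) that unfolding topspace_cover e_cover_def by (auto simp: PiE_iff)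
  have last_eq: "last ys = last zs"
    if EF: "E \<in> \<E>" "F \<in> \<E>" and ys: "ys \<in> x E" and zs: "zs \<in> x F" for E F ys zs
  proof -
    let ?G = "E \<inter> F"
    have G: "?G \<in> \<E>"
      using EF by (intro fine_entourages_Int)
    obtain us where us: "x ?G = e_class ?G us" "e_chain ?G us"
      using comp[OF G] by blast
    have bond: "e_bonding D (x ?G) = x D" if "D \<in> \<E>" "?G \<subseteq> D" for D
      using assms(1) that G unfolding topspace_cover by blast
    have "x E = e_class E us" "x F = e_class F us"
      using bond[OF EF(1)] bond[OF EF(2)] us(1)
        e_bonding_e_class[OF us(2), of E] e_bonding_e_class[OF us(2), of F] by auto
    then show ?thesis
      using ys zs e_homotopic_chain(4) by (metis e_class_def mem_Collect_eq)
  qed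
  obtain xs where xs: "x E = e_class E xs" "e_chain E xs" "hd xs = a"
    using comp[OF assms(2)] by blast
  then have "xs \<in> x E"
    by (simp add: e_class_def e_homotopic_refl)
  then have "endp x = last xs"
    unfolding uu_endpoint_def using assms(2) last_eq
    by (intro the_equality) (blast, metis)
  then show thesis
    using that xs by simp
qed

lemma thread_component: "E \<in> \<E> \<Longrightarrow> thread c E = chain_class E c"
  by (simp add: thread_def)

lemma thread_in_cover:
  assumes "pathin Z c" "c 0 = a"
  shows "thread c \<in> topspace cover" "endp (thread c) = c 1"
proof -
  have comp: "\<exists>xs. chain_class E c = e_class E xs \<and> e_chain E xs \<and> hd xs = a \<and> last xs = c 1"
    if E: "E \<in> \<E>" for E
  proof -
    obtain ts where "fine_partition E c ts"
      using fine_partition_exists[OF assms(1) E] by blast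
    then show ?thesis
      using fine_partition_chain chain_class_eq assms(2) by metis
  qed
  have "thread c E \<in> e_cover a E" if "E \<in> \<E>" for E
    using comp[OF that] that by (auto simp: thread_component e_cover_def)
  then show mem: "thread c \<in> topspace cover"
    unfolding topspace_cover
    using assms by (auto simp: thread_def chain_class_bonding[where X = Z])
  let ?E = "topspace Z \<times> topspace Z"
  obtain xs where xs: "thread c ?E = e_class ?E xs" "e_chain ?E xs" "last xs = endp (thread c)"
    using cover_component[OF mem fine_entourages_full] by blast
  obtain ys where ys: "thread c ?E = e_class ?E ys" "e_chain ?E ys" "last ys = c 1"
    using comp[OF fine_entourages_full] by (auto simp: thread_component fine_entourages_full)
  show "endp (thread c) = c 1"
    using xs ys e_class_eq_iff e_homotopic_chain(4) by metis
qed

text \<open>Over a set \<open>N\<close> with \<open>N \<times> N \<subseteq> E\<close> the chain cover for \<open>E\<close> is a disjoint union of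
  copies of \<open>N\<close>: the sheet through a class consists of its prolongations by one point of \<open>N\<close>.\<close>

definition sheet :: "('a \<times> 'a) set \<Rightarrow> 'a set \<Rightarrow> 'a list \<Rightarrow> 'a list set set" where
  "sheet E N xs = {e_class E (xs @ [z]) | z. z \<in> N}"

text \<open>Inside \<open>N\<close> two successive steps can be replaced by one, so a sheet contains the small prolongations
  of its members.\<close>

lemma openin_sheet:
  assumes E: "E \<in> \<E>" and N: "openin Z N" "N \<times> N \<subseteq> E"
    and xs: "e_chain E xs" "hd xs = a" "last xs \<in> N"
  shows "openin (e_cover_topology \<E> a E) (sheet E N xs)"
proof -
  interpret reflexive_entourage "topspace Z" E
    using E by (rule fine_entourages_reflexive)
  have ne: "xs \<noteq> []" using xs(1) by (rule e_chain_nonempty)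
  have ch: "e_chain E (xs @ [z])" if "z \<in> N" for z
    using that xs N(2) by (intro e_chain_snoc) auto
  show ?thesis
  proof (subst openin_e_cover_topology[OF fine_entourages_Int], assumption+, intro conjI ballI)
    show "sheet E N xs \<subseteq> e_cover a E"
    proof
      fix x assume "x \<in> sheet E N xs"
      then obtain z where "x = e_class E (xs @ [z])" "z \<in> N"
        by (auto simp: sheet_def)
      moreover have "hd (xs @ [z]) = a"
        using xs(2) ne by simp
      ultimately show "x \<in> e_cover a E"
        unfolding e_cover_def using ch by blast
    qed
    fix x assume "x \<in> sheet E N xs"
    then obtain z where z: "x = e_class E (xs @ [z])" "z \<in> N"
      by (auto simp: sheet_def)
    obtain F where F: "F \<in> \<E>" "F \<subseteq> E" "\<And>w. (z, w) \<in> F \<Longrightarrow> w \<in> N"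
      using fine_entourage_at_point[OF t1 N(1) z(2) E] by blast
    have "star_entourage a E F `` {x} \<subseteq> sheet E N xs"
    proof
      fix y assume "y \<in> star_entourage a E F `` {x}"
      then obtain us w where us: "e_class E us = x" "e_chain E us" "(last us, w) \<in> F"
        "y = e_class E (us @ [w])"
        unfolding star_entourage_eq[OF F(2) base] by auto
      have h: "e_homotopic E us (xs @ [z])"
        using us z by (simp add: e_class_eq_iff)
      then have "last us = z"
        using e_homotopic_chain(4) by force
      then have w: "w \<in> N"
        using F(3) us(3) by blast
      have E': "(z, w) \<in> E" "(last xs, z) \<in> E" "(last xs, w) \<in> E"
        using N(2) z(2) w xs(3) by auto
      have "e_homotopic E (us @ [w]) ((xs @ [z]) @ [w])"
        using E' \<open>last us = z\<close> by (intro e_homotopic_append_right[OF h]) auto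
      also have "e_homotopic E ((xs @ [z]) @ [w]) (xs @ [w])"
        using e_homotopic_sym[OF e_homotopic_snoc_insert[OF xs(1) E'(2,1,3)]] by simp
      finally have "y = e_class E (xs @ [w])"
        using us(4) by (simp add: e_class_eqI)
      then show "y \<in> sheet E N xs"
        using w by (auto simp: sheet_def)
    qed
    then show "\<exists>F\<in>\<E>. F \<subseteq> E \<and> star_entourage a E F `` {x} \<subseteq> sheet E N xs"
      using F by blast
  qed
qed

lemma mem_sheet_self:
  assumes "E \<in> \<E>" "e_chain E xs" "last xs \<in> N" "N \<times> N \<subseteq> E"
  shows "e_class E xs \<in> sheet E N xs"
proof -
  have "e_homotopic E xs (xs @ [last xs])"
    using assms by (intro e_homotopic_snoc_stutter) auto
  then show ?thesis
    using assms(3) by (auto simp: sheet_def dest: e_class_eqI)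
qed

lemma continuous_map_component:
  assumes "E \<in> \<E>"
  shows "continuous_map cover (e_cover_topology \<E> a E) (\<lambda>x. x E)"
  unfolding uu_cover_def using assms
  by (intro continuous_map_from_subtopology continuous_map_product_projection)

text \<open>Every open \<open>V\<close> is small for the full entourage, so the points that end in \<open>V\<close> are covered by
  preimages of sheets over \<open>V\<close>.\<close>

lemma continuous_map_endpoint: "continuous_map cover Z endp"
proof -
  let ?E = "topspace Z \<times> topspace Z"
  note E = fine_entourages_full[of Z]
  interpret reflexive_entourage "topspace Z" ?E
    using E by (rule fine_entourages_reflexive)
  have endp_top: "endp x \<in> topspace Z" if x: "x \<in> topspace cover" for x
  proof -
    obtain xs where "e_chain ?E xs" "hd xs = a" "last xs = endp x"
      using cover_component[OF x E] by blast
    then show ?thesis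
      using e_chain_last base by metis
  qed
  have "openin cover {x \<in> topspace cover. endp x \<in> V}" if V: "openin Z V" for V
  proof (subst openin_subopen, intro ballI)
    fix x assume "x \<in> {x \<in> topspace cover. endp x \<in> V}"
    then have x: "x \<in> topspace cover" "endp x \<in> V" by auto
    obtain xs where xs: "x ?E = e_class ?E xs" "e_chain ?E xs" "hd xs = a" "last xs = endp x"
      using cover_component[OF x(1) E] by blast
    have VV: "V \<times> V \<subseteq> ?E"
      using openin_subset[OF V] by auto
    let ?U = "{y \<in> topspace cover. y ?E \<in> sheet ?E V xs}"
    have "openin cover ?U"
      using openin_sheet[OF E V VV] xs x(2)
      by (intro openin_continuous_map_preimage[OF continuous_map_component[OF E]]) auto
    moreover have "x \<in> ?U"
      using x xs mem_sheet_self[OF E xs(2) _ VV] by auto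
    moreover have "endp y \<in> V" if y: "y \<in> ?U" for y
    proof -
      obtain z where z: "y ?E = e_class ?E (xs @ [z])" "z \<in> V"
        using y by (auto simp: sheet_def)
      obtain ys where ys: "y ?E = e_class ?E ys" "e_chain ?E ys" "last ys = endp y"
        using cover_component[OF _ E, of y] y by blast
      have "last ys = z"
        using z(1) ys e_class_eq_iff[of ?E ys "xs @ [z]"] e_homotopic_chain(4) by force
      then show ?thesis using z ys by simp
    qed
    ultimately show "\<exists>T. openin cover T \<and> x \<in> T \<and> T \<subseteq> {x \<in> topspace cover. endp x \<in> V}"
      by (intro exI[of _ ?U]) auto
  qed
  then show ?thesis
    unfolding continuous_map_def using endp_top by auto
qed

lemma sheet_unique:
  assumes E: "E \<in> \<E>" and NE: "N \<times> N \<subseteq> E"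
    and xs: "e_chain E xs" "last xs \<in> N" and ys: "e_chain E ys" "last ys = last xs"
    and z: "z \<in> N"
  shows "e_class E (xs @ [z]) = e_class E (ys @ [z]) \<longleftrightarrow> e_class E xs = e_class E ys"
proof -
  interpret reflexive_entourage "topspace Z" E
    using E by (rule fine_entourages_reflexive)
  have lz: "(last xs, z) \<in> E" "(last ys, z) \<in> E"
    using NE xs(2) ys(2) z by auto
  have ch: "e_chain E (xs @ [z])"
    using xs lz by (intro e_chain_snoc)
  have "e_homotopic E (xs @ [z]) (ys @ [z]) \<longleftrightarrow> e_homotopic E xs ys"
    using e_homotopic_snoc_cancel[OF xs(1) ys lz(1)] e_homotopic_append_right[of E xs ys "[z]"] lz
    by auto
  then show ?thesis
    using ch xs(1) by (simp add: e_class_eq_iff)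
qed

text \<open>The set where two lifts agree and its complement are both open, as in every coordinate
  both lifts run in sheets over a common small set and points of one sheet are determined by
  their ends.\<close>

lemma lift_unique:
  assumes Y: "connected_space Y" and y0: "y0 \<in> topspace Y"
    and g: "continuous_map Y cover g" and g': "continuous_map Y cover g'"
    and same: "\<And>y. y \<in> topspace Y \<Longrightarrow> endp (g y) = endp (g' y)" and start: "g y0 = g' y0"
    and y: "y \<in> topspace Y"
  shows "g y = g' y"
proof -
  have mem: "g y \<in> topspace cover" "g' y \<in> topspace cover" if "y \<in> topspace Y" for y
    using that g g' by (auto simp: continuous_map_def)
  have coord: "g y E = g' y E" if E: "E \<in> \<E>" for E
  proof -
    have nbhd: "\<exists>T. openin Y T \<and> u \<in> T \<and> (\<forall>v\<in>T. (g v E = g' v E) = (g u E = g' u E))"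
      if u: "u \<in> topspace Y" for u
    proof -
      obtain xs where xs: "g u E = e_class E xs" "e_chain E xs" "hd xs = a" "last xs = endp (g u)"
        using cover_component[OF mem(1)[OF u] E] by blast
      obtain ys where ys: "g' u E = e_class E ys" "e_chain E ys" "hd ys = a" "last ys = endp (g' u)"
        using cover_component[OF mem(2)[OF u] E] by blast
      have l: "last ys = last xs"
        using xs ys same[OF u] by simp
      have "last xs \<in> topspace Z"
        using xs(4) mem(1)[OF u] continuous_map_endpoint by (auto simp: continuous_map_def)
      then obtain N where N: "openin Z N" "last xs \<in> N" "N \<times> N \<subseteq> E"
        using fine_entourage_nbhd[OF E] by blast
      let ?T = "{v \<in> topspace Y. g v E \<in> sheet E N xs} \<inter> {v \<in> topspace Y. g' v E \<in> sheet E N ys}"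
      have cont: "continuous_map Y (e_cover_topology \<E> a E) (\<lambda>v. g v E)"
        "continuous_map Y (e_cover_topology \<E> a E) (\<lambda>v. g' v E)"
        using continuous_map_compose[OF g continuous_map_component[OF E]]
          continuous_map_compose[OF g' continuous_map_component[OF E]] by (simp_all add: o_def)
      have "openin Y ?T"
        using openin_sheet[OF E N(1,3) xs(2,3) N(2)] openin_sheet[OF E N(1,3) ys(2,3)] N(2) l
        by (intro openin_Int openin_continuous_map_preimage[OF cont(1)]
            openin_continuous_map_preimage[OF cont(2)]) auto
      moreover have "u \<in> ?T"
        using u xs ys N l mem_sheet_self[OF E xs(2) N(2,3)] mem_sheet_self[OF E ys(2) _ N(3)] by auto
      moreover have "(g v E = g' v E) = (g u E = g' u E)" if v: "v \<in> ?T" for v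
      proof -
        obtain z w where zw: "g v E = e_class E (xs @ [z])" "z \<in> N"
          "g' v E = e_class E (ys @ [w])" "w \<in> N"
          using v by (auto simp: sheet_def)
        obtain xs' where xs': "g v E = e_class E xs'" "e_chain E xs'" "last xs' = endp (g v)"
          using cover_component[OF mem(1) E, of v] v by blast
        obtain ys' where ys': "g' v E = e_class E ys'" "e_chain E ys'" "last ys' = endp (g' v)"
          using cover_component[OF mem(2) E, of v] v by blast
        have "z = endp (g v)"
          using zw(1) xs' e_class_eq_iff[of E xs' "xs @ [z]"] e_homotopic_chain(4) by force
        moreover have "w = endp (g' v)"
          using zw(3) ys' e_class_eq_iff[of E ys' "ys @ [w]"] e_homotopic_chain(4) by force
        ultimately have "z = w"
          using same v by auto
        then show ?thesis
          using sheet_unique[OF E N(3) xs(2) N(2) ys(2) l zw(2)] zw xs ys \<open>z = w\<close> by simp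
      qed
      ultimately show ?thesis by blast
    qed
    let ?A = "{v \<in> topspace Y. g v E = g' v E}"
    define agree where "agree v \<longleftrightarrow> g v E = g' v E" for v
    have op: "openin Y {v \<in> topspace Y. agree v = b}" for b
    proof (subst openin_subopen, intro ballI)
      fix u assume u: "u \<in> {v \<in> topspace Y. agree v = b}"
      then obtain T where T: "openin Y T" "u \<in> T" "\<forall>v\<in>T. agree v = agree u"
        using nbhd[of u] unfolding agree_def by blast
      have "T \<subseteq> {v \<in> topspace Y. agree v = b}"
      proof
        fix v assume v: "v \<in> T"
        then have "agree v = agree u" using T(3) by blast
        then show "v \<in> {v \<in> topspace Y. agree v = b}"
          using u v openin_subset[OF T(1)] by auto
      qed
      then show "\<exists>T. openin Y T \<and> u \<in> T \<and> T \<subseteq> {v \<in> topspace Y. agree v = b}"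
        using T by blast
    qed
    have "?A = {v \<in> topspace Y. agree v = True}" "topspace Y - ?A = {v \<in> topspace Y. agree v = False}"
      by (auto simp: agree_def)
    then have "openin Y ?A" "openin Y (topspace Y - ?A)"
      using op[of True] op[of False] by (simp_all only:)
    then have "?A = {} \<or> ?A = topspace Y"
      using Y unfolding connected_space_clopen_in closedin_def by auto
    then show ?thesis
      using y0 start y by auto
  qed
  have "g y \<in> extensional \<E>" "g' y \<in> extensional \<E>"
    using mem[OF y] by (auto simp: topspace_cover PiE_def)
  then show ?thesis
    using coord by (rule extensionalityI)
qed

end

section \<open>Lifting to the inverse limit\<close>

text \<open>Simple connectedness speaks of loops only. It is applied to \<open>c\<close> followed by the reverse of \<open>d\<close>, and
  the class of \<open>c\<close> is computed from \<open>c \<simeq> c (d\<^sup>-\<^sup>1 d) \<simeq> (c d\<^sup>-\<^sup>1) d \<simeq> d\<close>.\<close>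

lemma simply_connected_space_chain_class:
  assumes Y: "simply_connected_space Y" and f: "continuous_map Y Z f"
    and paths: "pathin Y c" "pathin Y d" and ends: "c 0 = d 0" "c 1 = d 1"
    and E: "E \<in> fine_entourages Z"
  shows "chain_class E (f \<circ> c) = chain_class E (f \<circ> d)"
proof -
  let ?c = "f \<circ> c" and ?d = "f \<circ> d"
  let ?r = "path_reverse ?d"
  have c: "pathin Z ?c" and d: "pathin Z ?d" and r: "pathin Z ?r"
    using paths f by (auto intro: pathin_compose pathin_reverse)
  have t: "?c 1 \<in> topspace Z" "?c 0 \<in> topspace Z"
    using path_finish_in_topspace[OF c] path_start_in_topspace[OF c] .
  have "loop_at Y (c 0) (path_join c (path_reverse d))"
    using paths ends by (simp add: loop_at_def pathin_join pathin_reverse)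
  then have "path_homotopic Y (c 0) (c 0) (path_join c (path_reverse d)) (\<lambda>_. c 0)"
    using Y by (simp add: simply_connected_space_def loop_homotopic_path_homotopic)
  then have null: "path_homotopic Z (?c 0) (?c 0) (path_join ?c ?r) (\<lambda>_. ?c 0)"
    using path_homotopic_compose[OF _ f]
    by (fastforce simp: compose_path_join compose_path_reverse o_def[of f "\<lambda>_. c 0"])
  have "chain_class E ?c = chain_class E (path_join ?c (\<lambda>_. ?c 1))"
    using chain_class_homotopic[OF path_homotopic_join_const_right[OF c] E] by simp
  also have "\<dots> = chain_class E (path_join ?c (path_join ?r ?d))"
    using chain_class_homotopic[OF path_homotopic_join_reverse_left[OF d] E] c d r t ends
    by (intro chain_class_join_cong[OF _ _ _ _ _ _ E]) (simp_all add: pathin_join)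
  also have "\<dots> = chain_class E (path_join (path_join ?c ?r) ?d)"
    using chain_class_homotopic[OF path_homotopic_join_assoc[OF c r d] E] ends by simp
  also have "\<dots> = chain_class E (path_join (\<lambda>_. ?c 0) ?d)"
    using chain_class_homotopic[OF null E] c d r t ends
    by (intro chain_class_join_cong[OF _ _ _ _ _ _ E]) (simp_all add: pathin_join)
  also have "\<dots> = chain_class E ?d"
    using chain_class_homotopic[OF path_homotopic_join_const_left[OF d] E] ends by simp
  finally show ?thesis .
qed

context uu_space
begin

text \<open>A lift is found by carrying the thread of a path to the starting point along the images of
  paths in \<open>Y\<close>. Within a path connected set that \<open>f\<close> maps into a small set it moves by one step of a
  chain, which is continuity for the uniformity by the sets \<open>F\<^sup>*\<close>.\<close>

lemma lift_exists:
  assumes Y: "path_connected_space Y" "locally_path_connected_space Y" "simply_connected_space Y"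
    and f: "continuous_map Y Z f" and y0: "y0 \<in> topspace Y"
    and d: "pathin Z d" "d 0 = a" "d 1 = f y0"
  obtains g where "continuous_map Y cover g" "\<And>y. y \<in> topspace Y \<Longrightarrow> endp (g y) = f y"
    "g y0 = thread d"
    "\<And>\<gamma>. pathin Y \<gamma> \<Longrightarrow> \<gamma> 0 = y0 \<Longrightarrow> g (\<gamma> 1) = thread (path_join d (f \<circ> \<gamma>))"
proof -
  have "\<exists>\<gamma>. pathin Y \<gamma> \<and> \<gamma> 0 = y0 \<and> \<gamma> 1 = y" if "y \<in> topspace Y" for y
    using Y(1) y0 that unfolding path_connected_space_def by blast
  then obtain \<Gamma> where \<Gamma>: "\<And>y. y \<in> topspace Y \<Longrightarrow> pathin Y (\<Gamma> y) \<and> \<Gamma> y 0 = y0 \<and> \<Gamma> y 1 = y"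
    by metis
  define g where "g y = thread (path_join d (f \<circ> \<Gamma> y))" for y
  have join: "pathin Z (path_join d (f \<circ> \<gamma>))" if "pathin Y \<gamma>" "\<gamma> 0 = y0" for \<gamma>
    using that d f by (intro pathin_join) (auto intro: pathin_compose)
  have indep: "chain_class E (path_join d (f \<circ> \<gamma>)) = g (\<gamma> 1) E"
    if \<gamma>: "pathin Y \<gamma>" "\<gamma> 0 = y0" and E: "E \<in> \<E>" for \<gamma> E
  proof -
    have "\<gamma> 1 \<in> topspace Y"
      using \<gamma>(1) by (rule path_finish_in_topspace)
    then have \<Gamma>': "pathin Y (\<Gamma> (\<gamma> 1))" "\<Gamma> (\<gamma> 1) 0 = y0" "\<Gamma> (\<gamma> 1) 1 = \<gamma> 1"
      using \<Gamma> by auto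
    have "chain_class E (f \<circ> \<gamma>) = chain_class E (f \<circ> \<Gamma> (\<gamma> 1))"
      using \<gamma> \<Gamma>' E by (intro simply_connected_space_chain_class[OF Y(3) f]) auto
    then have "chain_class E (path_join d (f \<circ> \<gamma>)) = chain_class E (path_join d (f \<circ> \<Gamma> (\<gamma> 1)))"
      using d \<gamma> \<Gamma>' E f by (intro chain_class_join_cong) (auto intro: pathin_compose)
    then show ?thesis
      using E by (simp add: g_def thread_component)
  qed
  have transport: "g (\<gamma> 1) = thread (path_join d (f \<circ> \<gamma>))" if "pathin Y \<gamma>" "\<gamma> 0 = y0" for \<gamma>
  proof (rule extensionalityI)
    show "g (\<gamma> 1) \<in> extensional \<E>" "thread (path_join d (f \<circ> \<gamma>)) \<in> extensional \<E>"
      by (auto simp: g_def thread_def)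
    show "g (\<gamma> 1) E = thread (path_join d (f \<circ> \<gamma>)) E" if "E \<in> \<E>" for E
      using indep[OF \<open>pathin Y \<gamma>\<close> \<open>\<gamma> 0 = y0\<close> that] that by (simp add: thread_component)
  qed
  have mem: "g y \<in> topspace cover" "endp (g y) = f y" if "y \<in> topspace Y" for y
    using thread_in_cover[OF join, of "\<Gamma> y"] \<Gamma>[OF that] d by (auto simp: g_def)
  have start: "g y0 = thread d"
  proof (rule extensionalityI)
    show "g y0 \<in> extensional \<E>" "thread d \<in> extensional \<E>"
      by (auto simp: g_def thread_def)
    fix E assume E: "E \<in> \<E>"
    have "g y0 E = chain_class E (path_join d (\<lambda>_. d 1))"
      using indep[of "\<lambda>_. y0" E] y0 E d(3) by (simp add: o_def)
    then show "g y0 E = thread d E"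
      using chain_class_homotopic[OF path_homotopic_join_const_right[OF d(1)] E] E
      by (simp add: thread_component)
  qed
  have "continuous_map Y (e_cover_topology \<E> a E) (\<lambda>y. g y E)" if E: "E \<in> \<E>" for E
    unfolding continuous_map_def
  proof (intro conjI allI impI)
    show "(\<lambda>y. g y E) \<in> topspace Y \<rightarrow> topspace (e_cover_topology \<E> a E)"
      using mem(1) E unfolding topspace_cover topspace_e_cover_topology[OF E] by (auto simp: PiE_iff)
    fix U assume U: "openin (e_cover_topology \<E> a E) U"
    show "openin Y {y \<in> topspace Y. g y E \<in> U}"
    proof (subst openin_subopen, intro ballI)
      fix y assume "y \<in> {y \<in> topspace Y. g y E \<in> U}"
      then have y: "y \<in> topspace Y" "g y E \<in> U" by auto
      then obtain F where F: "F \<in> \<E>" "F \<subseteq> E" "star_entourage a E F `` {g y E} \<subseteq> U"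
        using U openin_e_cover_topology[OF fine_entourages_Int, of Z a E U] by blast
      have "f y \<in> topspace Z"
        using f y(1) by (auto simp: continuous_map_def)
      then obtain N where N: "openin Z N" "f y \<in> N" "N \<times> N \<subseteq> F"
        using fine_entourage_nbhd[OF F(1)] by blast
      have "openin Y {v \<in> topspace Y. f v \<in> N}"
        using f N(1) by (rule openin_continuous_map_preimage)
      then obtain V where V: "openin Y V" "path_connectedin Y V" "y \<in> V"
        "V \<subseteq> {v \<in> topspace Y. f v \<in> N}"
        using Y(2) y N(2) unfolding locally_path_connected_space by blast
      have \<Gamma>y: "pathin Y (\<Gamma> y)" "\<Gamma> y 0 = y0" "\<Gamma> y 1 = y"
        using \<Gamma>[OF y(1)] by auto
      interpret reflexive_entourage "topspace Z" E
        using E by (rule fine_entourages_reflexive)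
      have "g v E \<in> U" if v: "v \<in> V" for v
      proof -
        obtain \<eta> where \<eta>: "pathin Y \<eta>" "\<eta> ` {0..1} \<subseteq> V" "\<eta> 0 = y" "\<eta> 1 = v"
          using V(2,3) v unfolding path_connectedin by (metis image_subset_iff_funcset)
        let ?c = "path_join d (f \<circ> \<Gamma> y)" and ?e = "f \<circ> \<eta>"
        have paths: "pathin Z ?c" "pathin Z ?e" "?c 0 = a" "?c 1 = f y"
          using join \<Gamma>y \<eta>(1) f d by (auto intro: pathin_compose)
        obtain ts where ts: "fine_partition E ?c ts"
          using fine_partition_exists[OF paths(1) E] by blast
        have small: "?e ` {0..1} \<times> ?e ` {0..1} \<subseteq> F"
        proof (rule square_mono[OF _ N(3)], rule image_subsetI)
          fix t :: real assume "t \<in> {0..1}"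
          then have "\<eta> t \<in> V"
            using \<eta>(2) by blast
          then show "?e t \<in> N"
            using V(4) by auto
        qed
        then have e: "fine_partition E ?e [0, 1]"
          by (intro fine_partition_small order_trans[OF _ F(2)])
        have "g v E = chain_class E (path_join d (f \<circ> path_join (\<Gamma> y) \<eta>))"
          using indep[of "path_join (\<Gamma> y) \<eta>" E] \<Gamma>y \<eta> E by (simp add: pathin_join)
        also have "\<dots> = chain_class E (path_join ?c ?e)"
        proof -
          have f\<Gamma>: "pathin Z (f \<circ> \<Gamma> y)"
            using \<Gamma>y(1) f by (rule pathin_compose)
          have "d 1 = (f \<circ> \<Gamma> y) 0" "(f \<circ> \<Gamma> y) 1 = ?e 0"
            using d(3) \<Gamma>y(2,3) \<eta>(3) by simp_all
          note path_homotopic_join_assoc[OF d(1) f\<Gamma> paths(2) this]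
          then show ?thesis
            unfolding compose_path_join by (rule chain_class_homotopic[OF path_homotopic_sym E])
        qed
        also have "\<dots> = e_class E (map ?c ts @ [f v])"
          using chain_class_join[OF ts e] \<Gamma>y \<eta> by simp
        finally have gv: "g v E = e_class E (map ?c ts @ [f v])" .
        have gy: "g y E = e_class E (map ?c ts)"
          using chain_class_eq[OF ts] E by (simp add: g_def thread_component)
        have "f v \<in> N"
          using V(4) v by blast
        then have "(last (map ?c ts), f v) \<in> F"
          using fine_partition_chain(3)[OF ts] paths(4) N by auto
        then have "(g y E, g v E) \<in> star_entourage a E F"
          unfolding star_entourage_eq[OF F(2) base] gv gy
          using fine_partition_chain(1,2)[OF ts] paths(3) by blast
        then show ?thesis
          using F(3) by blast
      qed
      then show "\<exists>T. openin Y T \<and> y \<in> T \<and> T \<subseteq> {y \<in> topspace Y. g y E \<in> U}"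
        using V openin_subset[OF V(1)] by (intro exI[of _ V]) auto
    qed
  qed
  then have "continuous_map Y cover g"
    unfolding uu_cover_def continuous_map_in_subtopology continuous_map_componentwise
    using mem(1) by (auto simp: topspace_cover PiE_def g_def thread_def)
  then show thesis
    using that mem(2) start transport by blast
qed

text \<open>By uniqueness a path in the limit is the lift of its own projection.\<close>

lemma lift_path_end:
  assumes \<gamma>: "pathin cover \<gamma>" and d: "pathin Z d" "d 0 = a" "\<gamma> 0 = thread d"
  shows "\<gamma> 1 = thread (path_join d (endp \<circ> \<gamma>))"
proof -
  have f: "continuous_map unit_interval Z (endp \<circ> \<gamma>)"
    using pathin_compose[OF \<gamma> continuous_map_endpoint] by (simp add: pathin_def)
  have d1: "d 1 = (endp \<circ> \<gamma>) 0"
    using thread_in_cover(2)[OF d(1,2)] d(3) by simp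
  obtain g where g: "continuous_map unit_interval cover g"
    "\<And>t. t \<in> topspace unit_interval \<Longrightarrow> endp (g t) = (endp \<circ> \<gamma>) t" "g 0 = thread d"
    "\<And>\<eta>. pathin unit_interval \<eta> \<Longrightarrow> \<eta> 0 = 0 \<Longrightarrow> g (\<eta> 1) = thread (path_join d (endp \<circ> \<gamma> \<circ> \<eta>))"
    by (rule lift_exists[OF unit_interval_space f _ d(1,2) d1], simp, rule that)
  have "g 1 = \<gamma> 1"
  proof (rule lift_unique[of unit_interval 0 g \<gamma> 1])
    show "connected_space unit_interval"
      using unit_interval_space(1) by (rule path_connected_imp_connected_space)
    show "continuous_map unit_interval cover \<gamma>"
      using \<gamma> by (simp add: pathin_def)
  qed (use g d(3) in simp_all)
  moreover have "g 1 = thread (path_join d (endp \<circ> \<gamma> \<circ> id))"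
    using g(4)[of id] by (simp add: pathin_def)
  ultimately show ?thesis by simp
qed

lemma thread_const: "thread (\<lambda>_. a) = uu_basepoint \<E> a"
proof -
  have "chain_class E (\<lambda>_. a) = e_class E [a]" if E: "E \<in> \<E>" for E
  proof -
    interpret reflexive_entourage "topspace Z" E
      using E by (rule fine_entourages_reflexive)
    have "fine_partition E (\<lambda>_. a) [0, 1]"
      using diag[OF base] by (intro fine_partition_small) auto
    then have "chain_class E (\<lambda>_. a) = e_class E [a, a]"
      by (simp add: chain_class_eq)
    then show ?thesis
      using e_homotopic_stutter diag[OF base] by (metis e_class_eqI)
  qed
  then show ?thesis
    unfolding thread_def uu_basepoint_def by (intro restrict_ext)
qed

lemma thread_homotopic:
  assumes "path_homotopic Z x y c d"
  shows "thread c = thread d"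
  unfolding thread_def using chain_class_homotopic[OF assms] by (intro restrict_ext) auto

text \<open>The end of a path in the limit is the thread of its projection, and the thread of a path is
  reached along the lift of that path.\<close>

lemma path_component_basepoint:
  "path_component_of_set cover (uu_basepoint \<E> a) = {thread d | d. pathin Z d \<and> d 0 = a}"
proof (intro equalityI subsetI)
  fix x assume "x \<in> path_component_of_set cover (uu_basepoint \<E> a)"
  then obtain \<gamma> where \<gamma>: "pathin cover \<gamma>" "\<gamma> 0 = thread (\<lambda>_. a)" "\<gamma> 1 = x"
    by (auto simp: path_component_of_def thread_const)
  have "x = thread (path_join (\<lambda>_. a) (endp \<circ> \<gamma>))"
    using lift_path_end[OF \<gamma>(1) _ _ \<gamma>(2)] base \<gamma>(3) by simp
  moreover have "endp (thread (\<lambda>_. a)) = a"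
    using thread_in_cover(2)[of "\<lambda>_. a"] base by simp
  then have "pathin Z (path_join (\<lambda>_. a) (endp \<circ> \<gamma>))"
    using pathin_compose[OF \<gamma>(1) continuous_map_endpoint] base \<gamma>(2) by (simp add: pathin_join)
  ultimately show "x \<in> {thread d | d. pathin Z d \<and> d 0 = a}"
    by (intro CollectI exI[of _ "path_join (\<lambda>_. a) (endp \<circ> \<gamma>)"]) simp
next
  fix x assume "x \<in> {thread d | d. pathin Z d \<and> d 0 = a}"
  then obtain d where d: "x = thread d" "pathin Z d" "d 0 = a" by blast
  have f: "continuous_map unit_interval Z d"
    using d(2) by (simp add: pathin_def)
  have c: "pathin Z (\<lambda>_. a)" "(\<lambda>_::real. a) 0 = a" "(\<lambda>_::real. a) 1 = d 0"
    using base d by auto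
  obtain g where g: "continuous_map unit_interval cover g" "g 0 = thread (\<lambda>_. a)"
    "\<And>\<eta>. pathin unit_interval \<eta> \<Longrightarrow> \<eta> 0 = 0 \<Longrightarrow> g (\<eta> 1) = thread (path_join (\<lambda>_. a) (d \<circ> \<eta>))"
    by (rule lift_exists[OF unit_interval_space f _ c], simp, rule that)
  have "g 1 = thread (path_join (\<lambda>_. a) d)"
    using g(3)[of id] by (simp add: pathin_def)
  also have "\<dots> = thread d"
    using thread_homotopic[OF path_homotopic_join_const_left[OF d(2)]] d(3) by simp
  finally show "x \<in> path_component_of_set cover (uu_basepoint \<E> a)"
    using g(1,2) d(1) unfolding path_component_of_def pathin_def
    by (auto simp: thread_const intro!: exI[of _ g])
qed

end

section \<open>The path component of the basepoint is simply connected\<close>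

text \<open>In the square of the homotopy the stretch from \<open>1 / 4\<close> to \<open>1 / 2\<close> of the side \<open>s = 0\<close> runs through
  \<open>c\<close>. It can be pushed across the square to the rest of the boundary, which only runs back and forth
  along \<open>d\<close> and so is contracted along \<open>d\<close> to its end.\<close>

lemma path_homotopic_conjugate_imp_null:
  assumes d: "pathin X d" "d 0 = b" "d 1 = z" and c: "c 0 = z" "c 1 = z"
    and hom: "path_homotopic X b b (path_join (path_join d c) (path_reverse d))
      (path_join (path_join d (\<lambda>_. z)) (path_reverse d))"
  shows "path_homotopic X z z c (\<lambda>_. z)"
proof -
  let ?II = "{0..1::real} \<times> {0..1::real}"
  let ?l1 = "path_join (path_join d c) (path_reverse d)"
  let ?l2 = "path_join (path_join d (\<lambda>_. z)) (path_reverse d)"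
  \<comment> \<open>the parameter of \<open>d\<close> reached at a point of the boundary outside that stretch\<close>
  define \<phi> :: "real \<times> real \<Rightarrow> real" where "\<phi> u = min 1 (min (4 * snd u) (2 - 2 * snd u))" for u
  obtain h where "continuous_map (prod_topology unit_interval unit_interval) X h"
    and h0: "\<And>t. h (0, t) = ?l1 t" and h1: "\<And>t. h (1, t) = ?l2 t"
    and hs: "\<And>s. s \<in> {0..1} \<Longrightarrow> h (s, 0) = b \<and> h (s, 1) = b"
    using hom unfolding path_homotopic_def homotopic_with_def by blast
  then have h: "continuous_map (top_of_set ?II) X h"
    by (simp add: prod_top_of_set)
  define \<psi> :: "real \<Rightarrow> real \<times> real" where
    "\<psi> = linepath (0, 1/4) (0, 0) +++ linepath (0, 0) (1, 0) +++ linepath (1, 0) (1, 1) +++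
      linepath (1, 1) (0, 1) +++ linepath (0, 1) (0, 1/2)"
  have "path \<psi>"
    unfolding \<psi>_def by simp
  then have \<psi>: "continuous_on {0..1} \<psi>" "\<psi> 0 = (0, 1/4)" "\<psi> 1 = (0, 1/2)"
    by (simp_all add: path_def \<psi>_def joinpaths_def linepath_def)
  define U where "U = {u \<in> ?II. fst u = 1 \<or> snd u = 0 \<or> snd u = 1 \<or>
    fst u = 0 \<and> (snd u \<le> 1/4 \<or> 1/2 \<le> snd u)}"
  have "path_image \<psi> \<subseteq> U"
    unfolding \<psi>_def U_def
    by (auto simp: path_image_join closed_segment_def)
  then have \<psi>U: "\<psi> t \<in> U" if "t \<in> {0..1}" for t
    using that by (auto simp: path_image_def)
  have hU: "h u = d (\<phi> u)" if uU: "u \<in> U" for u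
  proof -
    obtain s t where u: "u = (s, t)" by (cases u)
    have st: "s \<in> {0..1}" "t \<in> {0..1}" using uU u by (auto simp: U_def)
    have l: "?l2 t = d (\<phi> (s, t)) \<and> (t \<le> 1/4 \<or> 1/2 \<le> t \<longrightarrow> ?l1 t = d (\<phi> (s, t)))"
    proof -
      consider "t \<le> 1/4" | "1/4 < t" "t < 1/2" | "t = 1/2" | "1/2 < t" by linarith
      then show ?thesis
      proof cases
        case 1
        then have "\<phi> (s, t) = 4 * t" by (simp add: \<phi>_def)
        then show ?thesis using 1 by (simp add: path_join_def)
      next
        case 2
        then have "\<phi> (s, t) = 1" by (simp add: \<phi>_def)
        then show ?thesis using 2 d by (simp add: path_join_def)
      next
        case 3
        then show ?thesis using d c by (simp only: 3) (simp add: path_join_def \<phi>_def)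
      next
        case 4
        then have "\<phi> (s, t) = 2 - 2 * t" by (simp add: \<phi>_def)
        then show ?thesis using 4 by (simp add: path_join_def path_reverse_def)
      qed
    qed
    consider "s = 1" | "t = 0" | "t = 1" | "s = 0" "t \<le> 1/4 \<or> 1/2 \<le> t"
      using uU u by (auto simp: U_def)
    then show ?thesis
    proof cases
      case 1
      then show ?thesis using u h1 l by simp
    next
      case 2
      then show ?thesis using u hs[OF st(1)] d by (simp add: \<phi>_def)
    next
      case 3
      then show ?thesis using u hs[OF st(1)] d by (simp add: \<phi>_def)
    next
      case 4
      then show ?thesis using u h0 l by simp
    qed
  qed
  have "path_homotopic X (h (0, (1 + 0) / 4)) (h (0, (1 + 1) / 4)) c (h \<circ> \<psi>)"
  proof (rule path_homotopic_convex[OF h, where q = \<psi>])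
    show "\<psi> ` {0..1} \<subseteq> ?II"
      using \<psi>U unfolding U_def by blast
    show "c t = h (0, (1 + t) / 4)" if "t \<in> {0..1}" for t
      using that d c h0 by (cases "t = 0"; cases "t = 1") (auto simp: path_join_def field_simps)
  qed (use \<psi> in \<open>auto intro!: continuous_intros convex_Times\<close>)
  moreover have "h (0, (1 + 0) / 4) = z" "h (0, (1 + 1) / 4) = z"
    using h0 d c by (simp_all add: path_join_def)
  ultimately have "path_homotopic X z z c (h \<circ> \<psi>)"
    by simp
  also have "path_homotopic X (d (\<phi> (\<psi> 0))) (d (\<phi> (\<psi> 1))) (h \<circ> \<psi>) (\<lambda>_. z)"
  proof (rule path_homotopic_convex[where S = "{0..1}" and q = "\<lambda>_. 1"])
    show "continuous_map (top_of_set {0..1}) X d"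
      using d by (simp add: pathin_def)
    show "continuous_on {0..1} (\<lambda>t. \<phi> (\<psi> t))"
      unfolding \<phi>_def using \<psi>(1) by (intro continuous_intros)
    show "(\<lambda>t. \<phi> (\<psi> t)) ` {0..1} \<subseteq> {0..1}"
    proof (rule image_subsetI)
      fix t :: real assume "t \<in> {0..1}"
      then have "snd (\<psi> t) \<in> {0..1}"
        using \<psi>U[of t] by (auto simp: U_def mem_Times_iff)
      then show "\<phi> (\<psi> t) \<in> {0..1}"
        by (simp add: \<phi>_def)
    qed
    show "(h \<circ> \<psi>) t = d (\<phi> (\<psi> t))" if "t \<in> {0..1}" for t
      using hU[OF \<psi>U[OF that]] by simp
  qed (use \<psi> d in \<open>auto simp: \<phi>_def\<close>)
  then have "path_homotopic X z z (h \<circ> \<psi>) (\<lambda>_. z)"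
    using \<psi> d by (simp add: \<phi>_def)
  finally show ?thesis .
qed

context uu_space
begin

abbreviation component where
  "component \<equiv> path_component_of_set cover (uu_basepoint \<E> a)"

text \<open>The hypothesis is injectivity of \<open>\<lambda>\<close> in terms of representatives. The null homotopy of the
  projected loop lifts to a square whose side \<open>s = 0\<close> is the given loop, while the other three sides lift
  constant paths and so are constant.\<close>

lemma simply_connected_component:
  assumes inj: "\<And>c c'. pathin Z c \<Longrightarrow> pathin Z c' \<Longrightarrow> c 0 = a \<Longrightarrow> c 1 = a \<Longrightarrow> c' 0 = a \<Longrightarrow> c' 1 = a \<Longrightarrow>
    thread c = thread c' \<Longrightarrow> path_homotopic Z a a c c'"
  shows "simply_connected_space (subtopology cover component)"
  unfolding simply_connected_space_def
proof (intro conjI allI impI)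
  show "path_connected_space (subtopology cover component)"
    using path_connectedin_path_component_of[of cover "uu_basepoint \<E> a"]
    unfolding path_connectedin_def by blast
  fix x \<gamma> assume "loop_at (subtopology cover component) x \<gamma>"
  then have \<gamma>: "pathin cover \<gamma>" "\<gamma> 0 = x" "\<gamma> 1 = x" and "\<gamma> 0 \<in> component"
    by (auto simp: loop_at_def pathin_subtopology)
  then obtain d where d: "x = thread d" "pathin Z d" "d 0 = a"
    using path_component_basepoint by auto
  define z where "z = d 1"
  define c where "c = endp \<circ> \<gamma>"
  have c: "pathin Z c" "c 0 = z" "c 1 = z"
    using pathin_compose[OF \<gamma>(1) continuous_map_endpoint] thread_in_cover(2)[OF d(2,3)] d(1) \<gamma>
    by (auto simp: c_def z_def)
  have zZ: "z \<in> topspace Z"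
    using c path_start_in_topspace by fastforce
  let ?k = "\<lambda>_::real. z" and ?r = "path_reverse d"
  have dc: "pathin Z (path_join d c)" "pathin Z (path_join d ?k)" "pathin Z ?r"
    using d c zZ by (auto intro!: pathin_join pathin_reverse simp: z_def)
  have "thread (path_join d c) = thread d"
    using lift_path_end[OF \<gamma>(1) d(2,3)] \<gamma> d(1) by (simp add: c_def)
  also have "\<dots> = thread (path_join d ?k)"
    using thread_homotopic[OF path_homotopic_join_const_right[OF d(2)]] by (simp add: z_def)
  finally have eq: "chain_class E (path_join d c) = chain_class E (path_join d ?k)" if "E \<in> \<E>" for E
    using that thread_component by metis
  have "thread (path_join (path_join d c) ?r) = thread (path_join (path_join d ?k) ?r)"
    unfolding thread_def
  proof (rule restrict_ext)
    fix E assume E: "E \<in> \<E>"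
    show "chain_class E (path_join (path_join d c) ?r) = chain_class E (path_join (path_join d ?k) ?r)"
      using c by (intro chain_class_join_cong[OF dc(1,2,3,3) _ _ E eq[OF E] refl]) (auto simp: z_def)
  qed
  then have "path_homotopic Z a a (path_join (path_join d c) ?r) (path_join (path_join d ?k) ?r)"
    using dc d c zZ by (intro inj pathin_join) (auto simp: z_def)
  then have null: "path_homotopic Z z z c ?k"
    using d c by (intro path_homotopic_conjugate_imp_null[of Z d a z c]) (auto simp: z_def)
  obtain h where "continuous_map (prod_topology unit_interval unit_interval) Z h"
    and h0: "\<And>t. h (0, t) = c t" and h1: "\<And>t. h (1, t) = z"
    and hs: "\<And>s. s \<in> {0..1} \<Longrightarrow> h (s, 0) = z \<and> h (s, 1) = z"
    using null unfolding path_homotopic_def homotopic_with_def by blast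
  then have h: "continuous_map (top_of_set ({0..1} \<times> {0..1})) Z h"
    by (simp add: prod_top_of_set)
  let ?II = "{0..1::real} \<times> {0..1::real}"
  have II: "convex ?II" by (intro convex_Times) auto
  note scII = simply_connected_convex[OF II]
  have pcII: "path_connected_space (top_of_set ?II)"
    using scII by (simp add: simply_connected_space_def)
  have corner: "(0, 0) \<in> topspace (top_of_set ?II)" "d 1 = h (0, 0)"
    using h0 c by (simp_all add: z_def)
  obtain g where g: "continuous_map (top_of_set ?II) cover g"
    "\<And>u. u \<in> topspace (top_of_set ?II) \<Longrightarrow> endp (g u) = h u" "g (0, 0) = thread d"
    by (rule lift_exists[OF pcII locally_path_connected_convex[OF II] scII h corner(1) d(2,3) corner(2)],
        rule that)
  have side: "(g \<circ> e) t = \<delta> t"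
    if e: "continuous_on {0..1} e" "e ` {0..1} \<subseteq> ?II" and \<delta>: "pathin cover \<delta>"
      and start: "g (e 0) = \<delta> 0" and over: "\<And>t. t \<in> {0..1} \<Longrightarrow> h (e t) = endp (\<delta> t)"
      and t: "t \<in> {0..1}" for e \<delta> and t :: real
  proof (rule lift_unique[of unit_interval 0 "g \<circ> e" \<delta> t])
    show "connected_space unit_interval"
      using unit_interval_space(1) by (rule path_connected_imp_connected_space)
    have "continuous_map unit_interval (top_of_set ?II) e"
      using e by auto
    then show "continuous_map unit_interval cover (g \<circ> e)"
      using g(1) by (rule continuous_map_compose)
    show "continuous_map unit_interval cover \<delta>"
      using \<delta> by (simp add: pathin_def)
    show "endp ((g \<circ> e) y) = endp (\<delta> y)" if "y \<in> topspace unit_interval" for y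
    proof -
      have y: "y \<in> {0..1}" using that by simp
      then have "e y \<in> ?II" using e(2) by blast
      then show ?thesis using g(2)[of "e y"] over[OF y] by simp
    qed
  qed (use start t in auto)
  have x: "x \<in> topspace cover" "endp x = z"
    using thread_in_cover[OF d(2,3)] d(1) by (auto simp: z_def)
  have vertical: "continuous_on {0..1} (Pair s)" for s :: real
    using continuous_on_Pair[OF continuous_on_const[of "{0..1}" s] continuous_on_id] .
  have vertical_sub: "Pair s ` {0..1} \<subseteq> ?II" if "s \<in> {0..1}" for s :: real
    using that by auto
  have horizontal: "continuous_on {0..1} (\<lambda>s::real. (s, t))" for t :: real
    by (intro continuous_intros)
  have horizontal_sub: "(\<lambda>s. (s, t)) ` {0..1} \<subseteq> ?II" if "t \<in> {0..1}" for t :: real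
    using that by auto
  have left: "g (0, t) = \<gamma> t" if "t \<in> {0..1}" for t
    using side[OF vertical vertical_sub \<gamma>(1) _ _ that, of 0] g(3) \<gamma> d(1) h0 by (simp add: c_def)
  have const: "pathin cover (\<lambda>_. x)"
    using x by simp
  have bottom: "g (s, 0) = x" if "s \<in> {0..1}" for s
    using side[OF horizontal horizontal_sub const _ _ that, of 0] g(3) d(1) hs x by simp
  have top: "g (s, 1) = x" if "s \<in> {0..1}" for s
    using side[OF horizontal horizontal_sub const _ _ that, of 1] left[of 1] \<gamma> hs x left[of 0] by simp
  have right: "g (1, t) = x" if "t \<in> {0..1}" for t
    using side[OF vertical vertical_sub const _ _ that, of 1] bottom[of 1] h1 x by simp
  have "g ` ?II \<subseteq> component"
  proof -
    have "path_connectedin cover (g ` topspace (top_of_set ?II))"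
      using g(1) pcII by (intro path_connectedin_continuous_map_image[OF g(1)])
        (simp add: path_connectedin_topspace)
    moreover have "x \<in> g ` topspace (top_of_set ?II)"
      using g(3) d(1) by (auto intro!: image_eqI[of _ _ "(0, 0)"])
    ultimately have "g ` topspace (top_of_set ?II) \<subseteq> path_component_of_set cover x"
      by (rule path_component_of_maximal)
    moreover have "path_component_of cover (uu_basepoint \<E> a) x"
      using \<open>\<gamma> 0 \<in> component\<close> \<gamma>(2) by simp
    then have "path_component_of_set cover x = component"
      by (metis path_component_of_equiv)
    ultimately show ?thesis by simp
  qed
  then have g': "continuous_map (prod_topology unit_interval unit_interval) (subtopology cover component) g"
    using g(1) by (simp add: prod_top_of_set continuous_map_in_subtopology image_subset_iff_funcset)
  show "loop_homotopic (subtopology cover component) x \<gamma> (\<lambda>_. x)"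
    unfolding loop_homotopic_def using g' left right bottom top
    by (subst homotopic_with) (auto intro!: exI[of _ g])
qed

text \<open>Every lift has path connected image, so it stays in the path component it starts in.\<close>

lemma fischer_zastrow_component:
  fixes X :: "'a topology"
  assumes Z: "Z = lpc_coreflection X" and pc: "path_connected_space X"
    and inj: "\<And>c c'. pathin Z c \<Longrightarrow> pathin Z c' \<Longrightarrow> c 0 = a \<Longrightarrow> c 1 = a \<Longrightarrow> c' 0 = a \<Longrightarrow> c' 1 = a \<Longrightarrow>
      thread c = thread c' \<Longrightarrow> path_homotopic Z a a c c'"
  shows "fischer_zastrow_cover TYPE('y) X (subtopology cover component) (id \<circ> endp)"
  unfolding fischer_zastrow_cover_def
proof (intro conjI allI impI ballI)
  show sc: "simply_connected_space (subtopology cover component)"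
    using inj by (rule simply_connected_component)
  then show "path_connected_space (subtopology cover component)"
    by (simp add: simply_connected_space_def)
  show "continuous_map (subtopology cover component) X (id \<circ> endp)"
    using continuous_map_from_lpc_coreflection[of X] continuous_map_endpoint
    unfolding Z by (intro continuous_map_compose[of _ "lpc_coreflection X"] continuous_map_from_subtopology)
  fix Y :: "'y topology" and f
  assume *: "path_connected_space Y \<and> locally_path_connected_space Y \<and> simply_connected_space Y \<and>
    continuous_map Y X f"
  then have Y: "path_connected_space Y" "locally_path_connected_space Y" "simply_connected_space Y"
    and f: "continuous_map Y Z f"
    unfolding Z using continuous_map_into_lpc_coreflection by auto
  have lift: "\<exists>g. continuous_map Y (subtopology cover component) g \<and>
      (\<forall>y\<in>topspace Y. endp (g y) = f y) \<and> g y0 = thread d"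
    if y0: "y0 \<in> topspace Y" and d: "pathin Z d" "d 0 = a" "d 1 = f y0" for y0 d
  proof -
    obtain g where g: "continuous_map Y cover g" "\<And>y. y \<in> topspace Y \<Longrightarrow> endp (g y) = f y"
        "g y0 = thread d"
        "\<And>\<gamma>. pathin Y \<gamma> \<Longrightarrow> \<gamma> 0 = y0 \<Longrightarrow> g (\<gamma> 1) = thread (path_join d (f \<circ> \<gamma>))"
      by (rule lift_exists[OF Y f y0 d], rule that)
    have "g y \<in> component" if y: "y \<in> topspace Y" for y
    proof -
      obtain \<gamma> where \<gamma>: "pathin Y \<gamma>" "\<gamma> 0 = y0" "\<gamma> 1 = y"
        using Y(1) y0 y unfolding path_connected_space_def by metis
      moreover have "pathin Z (path_join d (f \<circ> \<gamma>))"
        using \<gamma> d f by (intro pathin_join) (auto intro: pathin_compose)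
      ultimately show ?thesis
        unfolding path_component_basepoint using g(4)[OF \<gamma>(1,2)] d(2)
        by (intro CollectI exI[of _ "path_join d (f \<circ> \<gamma>)"]) simp
    qed
    then show ?thesis
      using g by (intro exI[of _ g]) (auto simp: continuous_map_in_subtopology)
  qed
  show "\<exists>g. continuous_map Y (subtopology cover component) g \<and> (\<forall>y\<in>topspace Y. (id \<circ> endp) (g y) = f y)"
  proof (cases "topspace Y = {}")
    case True
    then show ?thesis
      by (auto simp: continuous_map_def)
  next
    case False
    then obtain y0 where y0: "y0 \<in> topspace Y" by blast
    have "f y0 \<in> topspace X"
      using * y0 by (auto simp: continuous_map_def)
    moreover have "a \<in> topspace X"
      using base by (simp add: Z)
    ultimately obtain d where d: "pathin X d" "d 0 = a" "d 1 = f y0"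
      using pc unfolding path_connected_space_def by blast
    then have "pathin Z d"
      unfolding Z by (intro pathin_lpc_coreflection)
    then show ?thesis
      using lift[OF y0] d by fastforce
  qed
  fix y0 x0 assume y0: "y0 \<in> topspace Y" and x0: "x0 \<in> topspace (subtopology cover component)"
    and "(id \<circ> endp) x0 = f y0"
  then obtain d where d: "x0 = thread d" "pathin Z d" "d 0 = a"
    using path_component_basepoint by auto
  then have "d 1 = f y0"
    using thread_in_cover(2)[OF d(2,3)] \<open>(id \<circ> endp) x0 = f y0\<close> by simp
  then obtain g where g: "continuous_map Y (subtopology cover component) g"
    "\<forall>y\<in>topspace Y. endp (g y) = f y" "g y0 = x0"
    using lift[OF y0 d(2,3)] d(1) by blast
  have uniq: "g' y = g y"
    if g': "continuous_map Y (subtopology cover component) g'"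
      "\<forall>y\<in>topspace Y. endp (g' y) = f y" "g' y0 = x0" and y: "y \<in> topspace Y" for g' y
  proof (rule lift_unique[OF path_connected_imp_connected_space[OF Y(1)] y0])
    show "continuous_map Y cover g'" "continuous_map Y cover g"
      using g(1) g'(1) by (auto simp: continuous_map_in_subtopology)
  qed (use g g' y in auto)
  show "\<exists>g. continuous_map Y (subtopology cover component) g \<and>
      (\<forall>y\<in>topspace Y. (id \<circ> endp) (g y) = f y) \<and> g y0 = x0 \<and>
      (\<forall>g'. continuous_map Y (subtopology cover component) g' \<and>
        (\<forall>y\<in>topspace Y. (id \<circ> endp) (g' y) = f y) \<and> g' y0 = x0 \<longrightarrow>
        (\<forall>y\<in>topspace Y. g' y = g y))"
  proof (intro exI[of _ g] conjI allI impI ballI)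
    fix g' y
    assume "continuous_map Y (subtopology cover component) g' \<and>
      (\<forall>y\<in>topspace Y. (id \<circ> endp) (g' y) = f y) \<and> g' y0 = x0" and "y \<in> topspace Y"
    then show "g' y = g y"
      by (intro uniq) simp_all
  qed (use g in simp_all)
qed

end

section \<open>The homomorphism to the uniform fundamental group\<close>

lemma loop_class_eq_iff:
  assumes "loop_at X a c"
  shows "loop_class X a c = loop_class X a d \<longleftrightarrow> path_homotopic X a a c d"
proof -
  have "d \<in> loop_class X a d" if "path_homotopic X a a c d"
    using path_homotopic_trans[OF path_homotopic_sym[OF that] that]
    by (simp add: loop_class_def loop_homotopic_path_homotopic)
  moreover have "c \<in> loop_class X a c"
    using assms path_homotopic_refl[of X c]
    by (simp add: loop_class_def loop_homotopic_path_homotopic loop_at_def)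
  moreover have "e \<in> loop_class X a c \<longleftrightarrow> e \<in> loop_class X a d" if h: "path_homotopic X a a c d" for e
    using path_homotopic_trans[OF h, of e] path_homotopic_trans[OF path_homotopic_sym[OF h], of e]
    by (auto simp: loop_class_def loop_homotopic_path_homotopic)
  moreover have "path_homotopic X a a c d" if "c \<in> loop_class X a d"
    using that path_homotopic_sym by (simp add: loop_class_def loop_homotopic_path_homotopic)
  ultimately show ?thesis by blast
qed

text \<open>This is the well-definedness of \<open>\<lambda>\<close> together with its values.\<close>

lemma uniform_hom_loop_class:
  assumes c: "loop_at X a c"
  shows "uniform_hom X a (loop_class X a c) = (\<lambda>E\<in>fine_entourages X. chain_class E c)"
proof -
  let ?\<E> = "fine_entourages X" and ?x = "\<lambda>E\<in>fine_entourages X. chain_class E c"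
  have p: "pathin X c" "c 0 = a" "c 1 = a"
    using c by (auto simp: loop_at_def)
  show ?thesis
    unfolding uniform_hom_def
  proof (rule the_equality, intro conjI ballI allI impI)
    have "chain_class E c \<in> e_loop_group a E" if E: "E \<in> ?\<E>" for E
    proof -
      obtain ts where ts: "fine_partition E c ts"
        using fine_partition_exists[OF p(1) E] .
      then show ?thesis
        unfolding e_loop_group_def chain_class_eq[OF ts]
        using fine_partition_chain[OF ts] p by (intro CollectI exI[of _ "map c ts"]) simp
    qed
    then show "?x \<in> uniform_fundamental_group ?\<E> a"
      unfolding uniform_fundamental_group_def using chain_class_bonding[OF p(1)] by auto
    fix E c' ts assume E: "E \<in> ?\<E>" and c': "c' \<in> loop_class X a c" and ts: "fine_partition E c' ts"
    have "path_homotopic X a a c c'"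
      using c' by (simp add: loop_class_def loop_homotopic_path_homotopic)
    then show "?x E = e_class E (map c' ts)"
      using chain_class_homotopic[OF _ E] chain_class_eq[OF ts] E by simp
  next
    fix x assume x: "x \<in> uniform_fundamental_group ?\<E> a \<and>
      (\<forall>E\<in>?\<E>. \<forall>c\<in>loop_class X a c. \<forall>ts. fine_partition E c ts \<longrightarrow> x E = e_class E (map c ts))"
    have cc: "c \<in> loop_class X a c"
      using loop_class_eq_iff[OF c, of c] by (simp add: loop_class_def loop_homotopic_path_homotopic)
    show "x = ?x"
    proof (rule extensionalityI)
      show "x \<in> extensional ?\<E>"
        using x by (auto simp: uniform_fundamental_group_def PiE_def)
      fix E assume E: "E \<in> ?\<E>"
      obtain ts where ts: "fine_partition E c ts"
        using fine_partition_exists[OF p(1) E] .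
      then show "x E = ?x E"
        using x E cc chain_class_eq[OF ts] by auto
    qed simp
  qed
qed

lemma fine_entourages_coreflection: "fine_entourages X \<subseteq> fine_entourages (lpc_coreflection X)"
proof
  fix E assume "E \<in> fine_entourages X"
  then obtain W where W: "E \<subseteq> topspace X \<times> topspace X" "sym E" "openin (prod_topology X X) W"
    "Id_on (topspace X) \<subseteq> W" "W \<subseteq> E"
    by (auto simp: fine_entourages_def)
  let ?Z = "lpc_coreflection X"
  have "continuous_map (prod_topology ?Z ?Z) X fst" "continuous_map (prod_topology ?Z ?Z) X snd"
    using continuous_map_compose[OF continuous_map_fst continuous_map_from_lpc_coreflection]
      continuous_map_compose[OF continuous_map_snd continuous_map_from_lpc_coreflection]
    by (simp_all add: o_def)
  then have "continuous_map (prod_topology ?Z ?Z) (prod_topology X X) (\<lambda>p. (fst p, snd p))"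
    by (rule continuous_map_pairedI)
  then have "openin (prod_topology ?Z ?Z) {p \<in> topspace (prod_topology ?Z ?Z). p \<in> W}"
    using openin_continuous_map_preimage[OF _ W(3)] by fastforce
  moreover have "{p \<in> topspace (prod_topology ?Z ?Z). p \<in> W} = W"
    using W(1,5) by auto
  ultimately show "E \<in> fine_entourages ?Z"
    using W by (auto simp: fine_entourages_def)
qed

lemma t1_space_lpc_coreflection: "t1_space X \<Longrightarrow> t1_space (lpc_coreflection X)"
  unfolding t1_space_closedin_singleton
proof
  fix x assume X: "\<forall>x\<in>topspace X. closedin X {x}" and "x \<in> topspace (lpc_coreflection X)"
  then have x: "x \<in> topspace X" by simp
  have "closedin (lpc_coreflection X) {y \<in> topspace (lpc_coreflection X). id y \<in> {x}}"
    using X x by (intro closedin_continuous_map_preimage[OF continuous_map_from_lpc_coreflection]) auto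
  moreover have "{y \<in> topspace (lpc_coreflection X). id y \<in> {x}} = {x}"
    using x by auto
  ultimately show "closedin (lpc_coreflection X) {x}" by simp
qed

text \<open>Injectivity passes from \<open>X\<close> to its coreflection: a pair of loops with equal threads there has equal
  classes for the fewer entourages of \<open>X\<close>, so it is homotopic in \<open>X\<close>, and the homotopy is continuous into the
  coreflection because its domain is locally path connected.\<close>

theorem fischer_zastrow_cover_uu_cover:
  fixes X :: "'a topology"
  assumes t1: "t1_space X" and pc: "path_connected_space X" and a: "a \<in> topspace X"
    and inj: "inj_on (uniform_hom X a) (fundamental_group X a)"
    and \<E>: "\<E> = fine_entourages (lpc_coreflection X)"
  shows "fischer_zastrow_cover TYPE('y) X
    (subtopology (uu_cover \<E> a) (path_component_of_set (uu_cover \<E> a) (uu_basepoint \<E> a)))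
    (id \<circ> uu_endpoint \<E>)"
proof -
  let ?Z = "lpc_coreflection X"
  interpret uu_space ?Z a
    using t1 a by unfold_locales (auto intro: t1_space_lpc_coreflection)
  have "path_homotopic ?Z a a c c'"
    if Z: "pathin ?Z c" "pathin ?Z c'" "c 0 = a" "c 1 = a" "c' 0 = a" "c' 1 = a"
      and eq: "thread c = thread c'" for c c'
  proof -
    have "pathin X c" "pathin X c'"
      using pathin_compose[OF Z(1) continuous_map_from_lpc_coreflection]
        pathin_compose[OF Z(2) continuous_map_from_lpc_coreflection] by simp_all
    then have loops: "loop_at X a c" "loop_at X a c'"
      using Z by (auto simp: loop_at_def)
    have "chain_class E c = chain_class E c'" if "E \<in> fine_entourages X" for E
      using eq thread_component that fine_entourages_coreflection by (metis subsetD)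
    then have "uniform_hom X a (loop_class X a c) = uniform_hom X a (loop_class X a c')"
      unfolding uniform_hom_loop_class[OF loops(1)] uniform_hom_loop_class[OF loops(2)]
      by (intro restrict_ext)
    moreover have "loop_class X a c \<in> fundamental_group X a" "loop_class X a c' \<in> fundamental_group X a"
      using loops by (auto simp: fundamental_group_def)
    ultimately have "loop_class X a c = loop_class X a c'"
      using inj by (auto dest: inj_onD)
    then have hom: "path_homotopic X a a c c'"
      using loop_class_eq_iff[OF loops(1)] by simp
    have "locally_path_connected_space (prod_topology unit_interval unit_interval)"
      unfolding prod_top_of_set by (intro locally_path_connected_convex convex_Times) auto
    then show ?thesis
      using hom continuous_map_into_lpc_coreflection
      unfolding path_homotopic_def homotopic_with_def by blast
  qed
  then show ?thesis
    unfolding \<E> by (intro fischer_zastrow_component[OF refl pc])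
qed

section \<open>Chains in compact spaces and nerves\<close>

text \<open>Paths attached to the pairs in \<open>E\<close> that compose along small triangles: a one-step
  description of a functor from \<open>E\<close>-homotopy classes of chains to homotopy classes of paths.\<close>

locale edge_paths = reflexive_entourage S E
  for S :: "'a set" and E +
  fixes T :: "'b topology" and \<kappa> :: "'a \<Rightarrow> 'b" and seg :: "'a \<Rightarrow> 'a \<Rightarrow> real \<Rightarrow> 'b"
  assumes seg: "(x, y) \<in> E \<Longrightarrow> pathin T (seg x y) \<and> seg x y 0 = \<kappa> x \<and> seg x y 1 = \<kappa> y"
    and degenerate: "x \<in> S \<Longrightarrow> path_homotopic T (\<kappa> x) (\<kappa> x) (seg x x) (\<lambda>_. \<kappa> x)"
    and triangle: "(x, z) \<in> E \<Longrightarrow> (z, y) \<in> E \<Longrightarrow> (x, y) \<in> E \<Longrightarrow>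
      path_homotopic T (\<kappa> x) (\<kappa> y) (path_join (seg x z) (seg z y)) (seg x y)"
begin

fun chain_path :: "'a list \<Rightarrow> real \<Rightarrow> 'b" where
  "chain_path (x # y # zs) = path_join (seg x y) (chain_path (y # zs))"
| "chain_path xs = (\<lambda>_. \<kappa> (hd xs))"

lemma chain_path:
  "e_chain E xs \<Longrightarrow> hd xs \<in> S \<Longrightarrow>
    pathin T (chain_path xs) \<and> chain_path xs 0 = \<kappa> (hd xs) \<and> chain_path xs 1 = \<kappa> (last xs)"
proof (induction xs rule: induct_list012)
  case 1
  then show ?case by (simp add: e_chain_def)
next
  case (2 x)
  then have "\<kappa> x \<in> topspace T"
    using path_homotopic_pathin(2)[OF degenerate[of x]] by simp
  then show ?case by simp
next
  case (3 x y zs)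
  then have "(x, y) \<in> E" "y \<in> S"
    using sub by (auto simp: e_chain_Cons)
  then show ?case
    using 3 seg[of x y] by (auto simp: e_chain_Cons intro!: pathin_join)
qed

lemma chain_path_refl:
  assumes "e_chain E xs" "hd xs \<in> S"
  shows "path_homotopic T (\<kappa> (hd xs)) (\<kappa> (last xs)) (chain_path xs) (chain_path xs)"
  using chain_path[OF assms] path_homotopic_refl by metis

text \<open>Behind the common beginning of the two chains the inserted point spans a triangle, or, next to
  an end of the chain that it repeats, a degenerate edge.\<close>

lemma chain_path_insert:
  "e_chain E (us @ vs) \<Longrightarrow> e_chain E (us @ z # vs) \<Longrightarrow> hd (us @ vs) = hd (us @ z # vs) \<Longrightarrow>
    last (us @ vs) = last (us @ z # vs) \<Longrightarrow> hd (us @ vs) \<in> S \<Longrightarrow>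
    path_homotopic T (\<kappa> (hd (us @ vs))) (\<kappa> (last (us @ vs)))
      (chain_path (us @ vs)) (chain_path (us @ z # vs))"
proof (induction us rule: induct_list012)
  case 1
  then obtain r where vs: "vs = z # r"
    by (cases vs) (auto simp: e_chain_def)
  have zS: "z \<in> S" and ch: "e_chain E (z # r)"
    using 1 vs by auto
  let ?C = "chain_path (z # r)"
  have C: "pathin T ?C" "?C 0 = \<kappa> z" "?C 1 = \<kappa> (last (z # r))"
    using chain_path[OF ch] zS by auto
  have "path_homotopic T (\<kappa> z) (\<kappa> (last (z # r))) (path_join (seg z z) ?C) (path_join (\<lambda>_. \<kappa> z) ?C)"
    using degenerate[OF zS] chain_path_refl[OF ch] zS by (intro path_homotopic_join) auto
  also have "path_homotopic T (\<kappa> z) (\<kappa> (last (z # r))) (path_join (\<lambda>_. \<kappa> z) ?C) ?C"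
    using path_homotopic_join_const_left[OF C(1)] C by simp
  finally show ?case
    using vs by (simp add: path_homotopic_sym)
next
  case (2 x)
  show ?case
  proof (cases vs)
    case Nil
    then have x: "z = x" "x \<in> S" using 2 by auto
    have k: "pathin T (\<lambda>_. \<kappa> x)"
      using path_homotopic_pathin(2)[OF degenerate[OF x(2)]] .
    have "path_homotopic T (\<kappa> x) (\<kappa> x) (path_join (seg x x) (\<lambda>_. \<kappa> x)) (path_join (\<lambda>_. \<kappa> x) (\<lambda>_. \<kappa> x))"
      using degenerate[OF x(2)] path_homotopic_refl[OF k] by (rule path_homotopic_join)
    also have "path_homotopic T (\<kappa> x) (\<kappa> x) (path_join (\<lambda>_. \<kappa> x) (\<lambda>_. \<kappa> x)) (\<lambda>_. \<kappa> x)"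
      using path_homotopic_join_const_left[OF k] by simp
    finally show ?thesis
      using Nil x by (simp add: path_homotopic_sym)
  next
    case (Cons y r)
    have e: "(x, y) \<in> E" "(x, z) \<in> E" "(z, y) \<in> E" and ch: "e_chain E (y # r)"
      using 2 Cons by (auto simp: e_chain_Cons)
    then have yS: "y \<in> S" using sub by auto
    let ?C = "chain_path (y # r)"
    have C: "pathin T ?C" "?C 0 = \<kappa> y" "?C 1 = \<kappa> (last (y # r))"
      using chain_path[OF ch] yS by auto
    have "path_homotopic T (\<kappa> x) (\<kappa> (last (y # r))) (path_join (path_join (seg x z) (seg z y)) ?C)
        (path_join (seg x y) ?C)"
      using triangle[OF e(2,3,1)] chain_path_refl[OF ch] yS by (intro path_homotopic_join) auto
    then have "path_homotopic T (\<kappa> x) (\<kappa> (last (y # r))) (path_join (seg x y) ?C)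
        (path_join (path_join (seg x z) (seg z y)) ?C)"
      by (rule path_homotopic_sym)
    also have "path_homotopic T (\<kappa> x) (\<kappa> (last (y # r))) (path_join (path_join (seg x z) (seg z y)) ?C)
        (path_join (seg x z) (path_join (seg z y) ?C))"
      using path_homotopic_join_assoc[of T "seg x z" "seg z y" ?C] seg[OF e(2)] seg[OF e(3)] C by simp
    finally show ?thesis
      using Cons by simp
  qed
next
  case (3 x y us)
  have e: "(x, y) \<in> E"
    using 3 by (simp add: e_chain_Cons)
  then have "y \<in> S" using sub by auto
  have "path_homotopic T (\<kappa> y) (\<kappa> (last ((y # us) @ vs))) (chain_path ((y # us) @ vs))
      (chain_path ((y # us) @ z # vs))"
    using "3.IH"(2) "3.prems" \<open>y \<in> S\<close> by (simp add: e_chain_Cons)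
  moreover have "path_homotopic T (\<kappa> x) (\<kappa> y) (seg x y) (seg x y)"
    using seg[OF e] path_homotopic_refl by metis
  ultimately show ?case
    by (simp add: path_homotopic_join)
qed

lemma chain_path_e_homotopic:
  assumes hom: "e_homotopic E xs ys" and S: "hd xs \<in> S"
  shows "path_homotopic T (\<kappa> (hd xs)) (\<kappa> (last xs)) (chain_path xs) (chain_path ys)"
proof -
  have ch: "e_chain E xs" "(e_move E)\<^sup>*\<^sup>* xs ys"
    using hom by (auto simp: e_homotopic_def)
  from ch(2) show ?thesis
  proof (induction rule: rtranclp_induct)
    case base
    show ?case using chain_path_refl[OF ch(1) S] .
  next
    case (step ys zs)
    have "e_homotopic E xs ys"
      using ch(1) step.hyps(1) by (simp add: e_homotopic_def)
    note ends = e_homotopic_chain[OF this]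
    have m: "e_chain E ys" "e_chain E zs" "hd ys = hd zs" "last ys = last zs"
      using step.hyps(2) by (auto simp: e_move_def)
    obtain us z vs where "(ys = us @ vs \<and> zs = us @ z # vs) \<or> (ys = us @ z # vs \<and> zs = us @ vs)"
      using step.hyps(2) by (auto simp: e_move_def)
    then have "path_homotopic T (\<kappa> (hd ys)) (\<kappa> (last ys)) (chain_path ys) (chain_path zs)"
    proof
      assume eq: "ys = us @ vs \<and> zs = us @ z # vs"
      show ?thesis
        using chain_path_insert[of us vs z] m ends S unfolding eq[THEN conjunct1] eq[THEN conjunct2] by simp
    next
      assume eq: "ys = us @ z # vs \<and> zs = us @ vs"
      show ?thesis
        using chain_path_insert[of us vs z] m ends S path_homotopic_sym
        unfolding eq[THEN conjunct1] eq[THEN conjunct2] by metis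
    qed
    then show ?case
      using step.IH ends path_homotopic_trans by metis
  qed
qed

text \<open>Along each interval of the subdivision the path is replaced by the edge between its ends; the
  restrictions of \<open>c\<close> are taken by linear reparametrisation.\<close>

lemma chain_path_follows:
  assumes c: "pathin X c" and \<kappa>: "continuous_map X T \<kappa>"
    and small: "\<And>e. pathin X e \<Longrightarrow> e ` {0..1} \<times> e ` {0..1} \<subseteq> E \<Longrightarrow>
      path_homotopic T (\<kappa> (e 0)) (\<kappa> (e 1)) (\<kappa> \<circ> e) (seg (e 0) (e 1))"
  shows "fine_on E c ts \<Longrightarrow> set ts \<subseteq> {0..1} \<Longrightarrow> c (hd ts) \<in> S \<Longrightarrow>
    path_homotopic T (\<kappa> (c (hd ts))) (\<kappa> (c (last ts))) (\<kappa> \<circ> c \<circ> linepath (hd ts) (last ts))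
      (chain_path (map c ts))"
proof (induction ts rule: induct_list012)
  case 1
  then show ?case by (simp add: fine_on_def)
next
  case (2 t)
  then have "e_chain E [c t]" "hd [c t] \<in> S" by auto
  then have "path_homotopic T (\<kappa> (c t)) (\<kappa> (c t)) (\<lambda>_. \<kappa> (c t)) (\<lambda>_. \<kappa> (c t))"
    using chain_path_refl[of "[c t]"] by simp
  then show ?case
    by (simp add: o_def linepath_refl)
next
  case (3 s t ts)
  let ?l = "last (t # ts)"
  have st: "s < t" "c ` {s..t} \<times> c ` {s..t} \<subseteq> E" "fine_on E c (t # ts)"
    using 3 by (auto simp: fine_on_Cons)
  have in01: "s \<in> {0..1}" "t \<in> {0..1}" "?l \<in> {0..1}"
    using 3 last_in_set[of "t # ts"] by auto
  have seg01: "linepath x y ` {0..1} \<subseteq> {0..1}" if "x \<in> {0..1}" "y \<in> {0..1}" for x y :: real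
    using that closed_segment_subset[of x "{0..1}" y] by (simp add: linepath_image_01)
  have kc: "continuous_map unit_interval T (\<kappa> \<circ> c)"
    using pathin_compose[OF c \<kappa>] by (simp add: pathin_def)
  have "path_homotopic T ((\<kappa> \<circ> c) (linepath s ?l 0)) ((\<kappa> \<circ> c) (linepath s ?l 1)) (\<kappa> \<circ> c \<circ> linepath s ?l)
      (path_join (\<kappa> \<circ> c \<circ> linepath s t) (\<kappa> \<circ> c \<circ> linepath t ?l))"
  proof (rule path_homotopic_convex[OF kc, where q = "linepath s t +++ linepath t ?l"])
    show "continuous_on {0..1} (linepath s t +++ linepath t ?l)"
      by (simp add: path_def[symmetric])
    have "path_image (linepath s t +++ linepath t ?l) \<subseteq> {0..1}"
      using seg01[OF in01(1,2)] seg01[OF in01(2,3)]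
      by (intro subset_path_image_join) (auto simp: path_image_def)
    then show "(linepath s t +++ linepath t ?l) ` {0..1} \<subseteq> {0..1}"
      by (simp add: path_image_def)
  qed (use seg01[OF in01(1,3)] in \<open>auto simp: joinpaths_def path_join_def linepath_0' linepath_1'\<close>)
  then have "path_homotopic T (\<kappa> (c s)) (\<kappa> (c ?l)) (\<kappa> \<circ> c \<circ> linepath s ?l)
      (path_join (\<kappa> \<circ> c \<circ> linepath s t) (\<kappa> \<circ> c \<circ> linepath t ?l))"
    by (simp add: linepath_0' linepath_1')
  also have "path_homotopic T (\<kappa> (c s)) (\<kappa> (c ?l))
      (path_join (\<kappa> \<circ> c \<circ> linepath s t) (\<kappa> \<circ> c \<circ> linepath t ?l))
      (path_join (seg (c s) (c t)) (chain_path (map c (t # ts))))"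
  proof (rule path_homotopic_join)
    let ?e = "c \<circ> linepath s t"
    have "continuous_map unit_interval unit_interval (linepath s t)"
      using seg01[OF in01(1,2)] by auto
    then have "pathin X ?e"
      using c unfolding pathin_def by (rule continuous_map_compose)
    moreover have "linepath s t ` {0..1} \<subseteq> {s..t}"
      using st(1) by (simp add: linepath_image_01 closed_segment_eq_real_ivl)
    then have "?e ` {0..1} \<subseteq> c ` {s..t}"
      by (auto simp: image_comp[symmetric])
    then have "?e ` {0..1} \<times> ?e ` {0..1} \<subseteq> E"
      using st(2) by (rule square_mono)
    ultimately show "path_homotopic T (\<kappa> (c s)) (\<kappa> (c t)) (\<kappa> \<circ> c \<circ> linepath s t) (seg (c s) (c t))"
      using small[of ?e] by (simp add: linepath_0' linepath_1' o_assoc)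
    have "c t \<in> c ` {s..t}"
      using st(1) by simp
    then have "c t \<in> S"
      using st(2) sub by blast
    then show "path_homotopic T (\<kappa> (c t)) (\<kappa> (c ?l)) (\<kappa> \<circ> c \<circ> linepath t ?l)
        (chain_path (map c (t # ts)))"
      using "3.IH"(2)[OF st(3)] "3.prems"(2) by (simp only: list.sel set_simps insert_subset simp_thms)
  qed
  finally show ?case
    by (simp only: last.simps list.distinct if_False list.sel list.map chain_path.simps(1))
qed

lemma loops_homotopic_if_chain_class_eq:
  assumes c: "pathin X c" and d: "pathin X d" and \<kappa>: "continuous_map X T \<kappa>"
    and small: "\<And>e. pathin X e \<Longrightarrow> e ` {0..1} \<times> e ` {0..1} \<subseteq> E \<Longrightarrow>
      path_homotopic T (\<kappa> (e 0)) (\<kappa> (e 1)) (\<kappa> \<circ> e) (seg (e 0) (e 1))"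
    and ts: "fine_partition E c ts" and us: "fine_partition E d us"
    and start: "c 0 \<in> S" and eq: "chain_class E c = chain_class E d"
  shows "path_homotopic T (\<kappa> (c 0)) (\<kappa> (c 1)) (\<kappa> \<circ> c) (\<kappa> \<circ> d)"
proof -
  have "e_homotopic E (map c ts) (map d us)"
    using eq ts us by (simp add: chain_class_eq e_class_eq_iff fine_partition_chain)
  note hom = this and ends = e_homotopic_chain(3,4)[OF this] fine_partition_chain(2,3)[OF ts]
    fine_partition_chain(2,3)[OF us]
  have d01: "d 0 = c 0" "d 1 = c 1"
    using ends by simp_all
  have ts01: "set ts \<subseteq> {0..1}" and us01: "set us \<subseteq> {0..1}"
    using fine_partition_subset[OF ts] fine_partition_subset[OF us] by blast+
  have 1: "linepath 0 1 = (id :: real \<Rightarrow> real)"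
    by (auto simp: linepath_def)
  have "path_homotopic T (\<kappa> (c 0)) (\<kappa> (c 1)) (\<kappa> \<circ> c) (chain_path (map c ts))"
    using chain_path_follows[OF c \<kappa> small, of ts] ts01 ts start 1
    by (simp add: fine_partition_iff)
  also have "path_homotopic T (\<kappa> (c 0)) (\<kappa> (c 1)) (chain_path (map c ts)) (chain_path (map d us))"
    using chain_path_e_homotopic[OF hom] ends start by simp
  also have "path_homotopic T (\<kappa> (c 0)) (\<kappa> (c 1)) (chain_path (map d us)) (\<kappa> \<circ> d)"
  proof (rule path_homotopic_sym)
    show "path_homotopic T (\<kappa> (c 0)) (\<kappa> (c 1)) (\<kappa> \<circ> d) (chain_path (map d us))"
      using chain_path_follows[OF d \<kappa> small, of us] us01 us start 1 d01
      by (simp add: fine_partition_iff)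
  qed
  finally show ?thesis .
qed

end

text \<open>By local finiteness, near a point only the members whose support contains the point are
  active, and these have the point in common.\<close>

lemma canonical_map_local:
  assumes P: "partition_of_unity_on X \<U> \<phi>" and x: "x \<in> topspace X"
  obtains N \<sigma> where "openin X N" "x \<in> N" "\<sigma> \<in> nerve \<U>"
    "\<And>y. y \<in> N \<Longrightarrow> canonical_map \<U> \<phi> y \<in> closed_simplex \<sigma>"
proof -
  have nonneg: "0 \<le> \<phi> U y" and supp: "X closure_of {x \<in> topspace X. \<phi> U x \<noteq> 0} \<subseteq> U"
    if "U \<in> \<U>" "y \<in> topspace X" for U y
    using P that by (auto simp: partition_of_unity_on_def)
  have total: "(\<Sum>U | U \<in> \<U> \<and> \<phi> U y \<noteq> 0. \<phi> U y) = 1" if "y \<in> topspace X" for y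
    using P that by (auto simp: partition_of_unity_on_def)
  obtain M where M: "openin X M" "x \<in> M" "finite {U \<in> \<U>. \<exists>y\<in>M. \<phi> U y \<noteq> 0}"
    using P x by (auto simp: partition_of_unity_on_def)
  define C where "C U = X closure_of {x \<in> topspace X. \<phi> U x \<noteq> 0}" for U
  define A where "A = {U \<in> \<U>. \<exists>y\<in>M. \<phi> U y \<noteq> 0}"
  define \<sigma> where "\<sigma> = {U \<in> A. x \<in> C U}"
  define N where "N = M - \<Union>(C ` (A - \<sigma>))"
  have MX: "M \<subseteq> topspace X" using M(1) by (rule openin_subset)
  have inC: "y \<in> C U" if "\<phi> U y \<noteq> 0" "y \<in> topspace X" for y U
    unfolding C_def using that closure_of_subset[of "{x \<in> topspace X. \<phi> U x \<noteq> 0}" X] by auto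
  have N: "openin X N"
    unfolding N_def using M by (intro openin_diff closedin_Union) (auto simp: A_def C_def)
  have xN: "x \<in> N"
    using M(2) by (auto simp: N_def \<sigma>_def)
  have active: "{U \<in> \<U>. \<phi> U y \<noteq> 0} \<subseteq> \<sigma>" if y: "y \<in> N" for y
  proof
    fix U assume U: "U \<in> {U \<in> \<U>. \<phi> U y \<noteq> 0}"
    then have "U \<in> A" "y \<in> C U"
      using y inC MX by (auto simp: A_def N_def)
    then show "U \<in> \<sigma>"
      using y by (auto simp: N_def)
  qed
  have fin: "finite \<sigma>"
    using M(3) unfolding \<sigma>_def A_def[symmetric] by (rule rev_finite_subset) blast
  have sub: "\<sigma> \<subseteq> \<U>"
    by (auto simp: \<sigma>_def A_def)
  have "\<sigma> \<noteq> {}"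
    using total[OF x] active[OF xN] by auto
  moreover have "x \<in> \<Inter>\<sigma>"
    using supp[OF _ x] sub by (auto simp: \<sigma>_def C_def)
  ultimately have "\<sigma> \<in> nerve \<U>"
    using fin sub unfolding nerve_def by blast
  moreover have "canonical_map \<U> \<phi> y \<in> closed_simplex \<sigma>" if y: "y \<in> N" for y
  proof -
    have yX: "y \<in> topspace X" using y MX by (auto simp: N_def)
    have "(\<Sum>U\<in>\<sigma>. canonical_map \<U> \<phi> y U) = (\<Sum>U\<in>\<sigma>. \<phi> U y)"
      using sub by (intro sum.cong) (auto simp: canonical_map_def)
    also have "\<dots> = (\<Sum>U | U \<in> \<U> \<and> \<phi> U y \<noteq> 0. \<phi> U y)"
      using fin active[OF y] sub by (intro sum.mono_neutral_right) auto
    finally show ?thesis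
      using total[OF yX] nonneg yX active[OF y] by (auto simp: closed_simplex_def canonical_map_def)
  qed
  ultimately show thesis
    using that N xN by blast
qed

lemma continuous_map_closed_simplex_nerve:
  assumes "\<sigma> \<in> nerve \<U>"
  shows "continuous_map (top_of_set (closed_simplex \<sigma>)) (nerve_topology \<U>) id"
proof -
  have "openin (nerve_topology \<U>) (\<Union>\<sigma>\<in>nerve \<U>. closed_simplex \<sigma>)"
    unfolding openin_nerve_topology
  proof (intro conjI ballI order_refl)
    fix \<tau> assume "\<tau> \<in> nerve \<U>"
    then have "(\<Union>\<sigma>\<in>nerve \<U>. closed_simplex \<sigma>) \<inter> closed_simplex \<tau> = closed_simplex \<tau>"
      by blast
    then show "openin (top_of_set (closed_simplex \<tau>)) ((\<Union>\<sigma>\<in>nerve \<U>. closed_simplex \<sigma>) \<inter> closed_simplex \<tau>)"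
      by simp
  qed
  then have "closed_simplex \<sigma> \<subseteq> topspace (nerve_topology \<U>)"
    using assms openin_subset by blast
  moreover have "openin (top_of_set (closed_simplex \<sigma>)) {t \<in> closed_simplex \<sigma>. t \<in> S}"
    if "openin (nerve_topology \<U>) S" for S
    using that assms unfolding openin_nerve_topology by (simp add: Int_def conj_commute)
  ultimately show ?thesis
    by (auto simp: continuous_map_def)
qed

lemma continuous_map_canonical_map:
  assumes "partition_of_unity_on X \<U> \<phi>"
  shows "continuous_map X euclidean (canonical_map \<U> \<phi>)"
proof -
  have "continuous_map X euclideanreal (\<lambda>x. canonical_map \<U> \<phi> x U)" for U
    using assms by (cases "U \<in> \<U>") (auto simp: canonical_map_def partition_of_unity_on_def)
  then show ?thesis
    by (simp add: euclidean_product_topology[symmetric] continuous_map_componentwise_UNIV)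
qed

lemma continuous_map_canonical_map_nerve:
  assumes P: "partition_of_unity_on X \<U> \<phi>"
  shows "continuous_map X (nerve_topology \<U>) (canonical_map \<U> \<phi>)"
proof -
  let ?\<kappa> = "canonical_map \<U> \<phi>"
  have loc: "\<exists>N. openin X N \<and> x \<in> N \<and> continuous_map (subtopology X N) (nerve_topology \<U>) ?\<kappa>"
    if x: "x \<in> topspace X" for x
  proof -
    obtain N \<sigma> where N: "openin X N" "x \<in> N" "\<sigma> \<in> nerve \<U>"
      "\<And>y. y \<in> N \<Longrightarrow> ?\<kappa> y \<in> closed_simplex \<sigma>"
      using canonical_map_local[OF P x] by blast
    have "continuous_map (subtopology X N) (top_of_set (closed_simplex \<sigma>)) ?\<kappa>"
      using continuous_map_from_subtopology[OF continuous_map_canonical_map[OF P]] N(4)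
      by (auto simp: continuous_map_in_subtopology)
    then have "continuous_map (subtopology X N) (nerve_topology \<U>) (id \<circ> ?\<kappa>)"
      using continuous_map_closed_simplex_nerve[OF N(3)] by (rule continuous_map_compose)
    then show ?thesis
      using N by auto
  qed
  show ?thesis
    unfolding continuous_map_def
  proof (intro conjI allI impI)
    show "?\<kappa> \<in> topspace X \<rightarrow> topspace (nerve_topology \<U>)"
    proof
      fix x assume x: "x \<in> topspace X"
      then obtain N where "x \<in> N" "continuous_map (subtopology X N) (nerve_topology \<U>) ?\<kappa>"
        using loc by blast
      then show "?\<kappa> x \<in> topspace (nerve_topology \<U>)"
        using x by (auto simp: continuous_map_def)
    qed
    fix S assume S: "openin (nerve_topology \<U>) S"
    show "openin X {x \<in> topspace X. ?\<kappa> x \<in> S}"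
    proof (subst openin_subopen, intro ballI)
      fix x assume x: "x \<in> {x \<in> topspace X. ?\<kappa> x \<in> S}"
      then obtain N where N: "openin X N" "x \<in> N"
        "continuous_map (subtopology X N) (nerve_topology \<U>) ?\<kappa>"
        using loc by blast
      then have "openin (subtopology X N) {y \<in> topspace (subtopology X N). ?\<kappa> y \<in> S}"
        using S by (intro openin_continuous_map_preimage)
      then have "openin X {y \<in> topspace (subtopology X N). ?\<kappa> y \<in> S}"
        using N(1) openin_open_subtopology by blast
      then show "\<exists>T. openin X T \<and> x \<in> T \<and> T \<subseteq> {x \<in> topspace X. ?\<kappa> x \<in> S}"
        using x N(2) by (intro exI[of _ "{y \<in> topspace (subtopology X N). ?\<kappa> y \<in> S}"]) auto
    qed
  qed
qed

definition segment_path :: "('s \<Rightarrow> real) \<Rightarrow> ('s \<Rightarrow> real) \<Rightarrow> real \<Rightarrow> 's \<Rightarrow> real" where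
  "segment_path p q t = (\<lambda>U. (1 - t) * p U + t * q U)"

lemma segment_path_in_closed_simplex:
  assumes "p \<in> closed_simplex \<sigma>" "q \<in> closed_simplex \<sigma>" "t \<in> {0..1}"
  shows "segment_path p q t \<in> closed_simplex \<sigma>"
  using assms by (auto simp: closed_simplex_def segment_path_def sum.distrib sum_distrib_left[symmetric])

lemma continuous_on_segment_path:
  assumes "continuous_on A f" "continuous_on A g" "continuous_on A r"
  shows "continuous_on A (\<lambda>x. segment_path (f x) (g x) (r x))"
  unfolding segment_path_def
  using assms(1,2)[THEN continuous_on_product_then_coordinatewise] assms(3)
  by (intro continuous_on_coordinatewise_then_product continuous_intros) auto

text \<open>A closed simplex is convex, so the straight-line homotopy stays inside; it is continuous for the
  weak topology because it runs in a single simplex.\<close>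

lemma path_homotopic_closed_simplex:
  assumes \<sigma>: "\<sigma> \<in> nerve \<U>"
    and p: "pathin (top_of_set (closed_simplex \<sigma>)) p" and q: "pathin (top_of_set (closed_simplex \<sigma>)) q"
    and ends: "q 0 = p 0" "q 1 = p 1"
  shows "path_homotopic (nerve_topology \<U>) (p 0) (p 1) p q"
proof -
  let ?h = "\<lambda>u. segment_path (p (snd u)) (q (snd u)) (fst u)"
  have pq: "continuous_on {0..1} p" "p ` {0..1} \<subseteq> closed_simplex \<sigma>"
    "continuous_on {0..1} q" "q ` {0..1} \<subseteq> closed_simplex \<sigma>"
    using p q by (auto simp: pathin_def)
  have h1: "continuous_on ({0..1} \<times> {0..1}) ?h"
    by (intro continuous_on_segment_path continuous_intros
        continuous_on_compose2[OF pq(1)] continuous_on_compose2[OF pq(3)]) auto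
  have h2: "?h ` ({0..1} \<times> {0..1}) \<subseteq> closed_simplex \<sigma>"
    using pq(2,4) by (intro image_subsetI segment_path_in_closed_simplex) auto
  have "continuous_map (top_of_set ({0..1} \<times> {0..1})) (top_of_set (closed_simplex \<sigma>)) ?h"
    using h1 h2 by (simp only: continuous_map_subtopology_eu) blast
  then have "continuous_map (prod_topology unit_interval unit_interval)
      (top_of_set (closed_simplex \<sigma>)) ?h"
    by (simp only: prod_top_of_set)
  then have "continuous_map (prod_topology unit_interval unit_interval) (nerve_topology \<U>) (id \<circ> ?h)"
    using continuous_map_closed_simplex_nerve[OF \<sigma>] by (rule continuous_map_compose)
  then show ?thesis
    unfolding path_homotopic_def homotopic_with_def
    using ends by (intro exI[of _ ?h]) (auto simp: segment_path_def algebra_simps)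
qed

lemma pathin_segment_path:
  assumes "p \<in> closed_simplex \<sigma>" "q \<in> closed_simplex \<sigma>"
  shows "pathin (top_of_set (closed_simplex \<sigma>)) (segment_path p q)"
  using segment_path_in_closed_simplex[OF assms]
    continuous_on_segment_path[OF continuous_on_const continuous_on_const continuous_on_id, of "{0..1}" p q]
  by (auto simp: pathin_def)

text \<open>For \<open>E\<close> given by a Lebesgue number of the cover by sets that are mapped into one simplex, all
  points \<open>E\<close>-close to a given point are mapped into one simplex. This makes the straight segments between
  images of \<open>E\<close>-close points edge paths, and makes short pieces of a path homotopic to them.\<close>

lemma canonical_map_loops_homotopic:
  assumes X: "compact_space X" "metrizable_space X" and P: "partition_of_unity_on X \<U> \<phi>"
    and c: "loop_at X a c" and d: "loop_at X a d"
    and eq: "\<And>E. E \<in> fine_entourages X \<Longrightarrow> chain_class E c = chain_class E d"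
  shows "path_homotopic (nerve_topology \<U>) (canonical_map \<U> \<phi> a) (canonical_map \<U> \<phi> a)
    (canonical_map \<U> \<phi> \<circ> c) (canonical_map \<U> \<phi> \<circ> d)"
proof -
  let ?\<kappa> = "canonical_map \<U> \<phi>" and ?T = "nerve_topology \<U>"
  let ?seg = "\<lambda>x y. segment_path (?\<kappa> x) (?\<kappa> y)"
  obtain M dist where "Metric_space M dist" and Xm: "X = Metric_space.mtopology M dist"
    using X(2) by (auto simp: metrizable_space_def)
  interpret Metric_space M dist by fact
  define C where "C = {N. openin X N \<and> (\<exists>\<sigma>\<in>nerve \<U>. ?\<kappa> ` N \<subseteq> closed_simplex \<sigma>)}"
  have top: "topspace X = M" by (simp add: Xm)
  have cover: "M \<subseteq> \<Union>C"
  proof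
    fix x assume "x \<in> M"
    then obtain N \<sigma> where "openin X N" "x \<in> N" "\<sigma> \<in> nerve \<U>" "\<And>y. y \<in> N \<Longrightarrow> ?\<kappa> y \<in> closed_simplex \<sigma>"
      using canonical_map_local[OF P] top by metis
    then have "N \<in> C" unfolding C_def by blast
    with \<open>x \<in> N\<close> show "x \<in> \<Union>C" by blast
  qed
  have "compactin mtopology M"
    using X(1) unfolding Xm by (simp add: compact_space_def)
  moreover have "openin mtopology N" if "N \<in> C" for N
    using that unfolding C_def Xm by simp
  ultimately have "\<exists>\<epsilon>>0. \<forall>x\<in>M. \<exists>N\<in>C. mball x \<epsilon> \<subseteq> N"
    using cover by (intro lebesgue_number)
  then obtain \<epsilon> where \<epsilon>: "\<epsilon> > 0" "\<And>x. x \<in> M \<Longrightarrow> \<exists>N\<in>C. mball x \<epsilon> \<subseteq> N"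
    by blast
  define E where "E = {(x, y). x \<in> M \<and> y \<in> M \<and> dist x y < \<epsilon>}"
  have "E \<in> fine_entourages X"
    unfolding fine_entourages_def
  proof (intro CollectI conjI)
    show "sym E"
      by (auto simp: E_def sym_def commute)
    let ?W = "\<Union>x\<in>M. mball x (\<epsilon> / 2) \<times> mball x (\<epsilon> / 2)"
    have "openin (prod_topology X X) ?W"
      unfolding Xm by (intro openin_Union) (auto simp: openin_prod_Times_iff)
    moreover have "Id_on M \<subseteq> ?W"
      using \<epsilon>(1) by auto
    moreover have "?W \<subseteq> E"
    proof clarify
      fix x y z assume "x \<in> M" "y \<in> mball x (\<epsilon> / 2)" "z \<in> mball x (\<epsilon> / 2)"
      then show "(y, z) \<in> E"
        using triangle[of y x z] by (auto simp: E_def commute)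
    qed
    ultimately show "\<exists>W. openin (prod_topology X X) W \<and> Id_on (topspace X) \<subseteq> W \<and> W \<subseteq> E"
      unfolding top by blast
  qed (auto simp: E_def top)
  then interpret reflexive_entourage M E
    using fine_entourages_reflexive top by metis
  have simplex: "\<exists>\<sigma>\<in>nerve \<U>. \<forall>y. (x, y) \<in> E \<longrightarrow> ?\<kappa> y \<in> closed_simplex \<sigma>" if xM: "x \<in> M" for x
  proof -
    obtain N \<sigma> where "mball x \<epsilon> \<subseteq> N" "\<sigma> \<in> nerve \<U>" "?\<kappa> ` N \<subseteq> closed_simplex \<sigma>"
      using \<epsilon>(2)[OF xM] unfolding C_def by blast
    moreover have "y \<in> mball x \<epsilon>" if "(x, y) \<in> E" for y
      using that by (auto simp: E_def mball_def)
    ultimately show ?thesis by blast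
  qed
  have ends: "?seg x y 0 = ?\<kappa> x" "?seg x y 1 = ?\<kappa> y" for x y
    by (auto simp: segment_path_def)
  have to_nerve: "pathin ?T p" if "pathin (top_of_set (closed_simplex \<sigma>)) p" "\<sigma> \<in> nerve \<U>" for \<sigma> p
    using pathin_compose[OF that(1) continuous_map_closed_simplex_nerve[OF that(2)]] by simp
  have small: "path_homotopic ?T (?\<kappa> (e 0)) (?\<kappa> (e 1)) (?\<kappa> \<circ> e) (?seg (e 0) (e 1))"
    if e: "pathin X e" "e ` {0..1} \<times> e ` {0..1} \<subseteq> E" for e
  proof -
    have eE: "(e 0, e t) \<in> E" if "t \<in> {0..1}" for t
      using e(2) that by (auto simp: image_subset_iff)
    then have "e 0 \<in> M" using sub by force
    then obtain \<sigma> where \<sigma>: "\<sigma> \<in> nerve \<U>" "\<And>y. (e 0, y) \<in> E \<Longrightarrow> ?\<kappa> y \<in> closed_simplex \<sigma>"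
      using simplex by blast
    have "pathin euclidean (?\<kappa> \<circ> e)"
      using e(1) continuous_map_canonical_map[OF P] by (rule pathin_compose)
    then have "pathin (top_of_set (closed_simplex \<sigma>)) (?\<kappa> \<circ> e)"
      using \<sigma>(2) eE by (auto simp: pathin_subtopology)
    moreover have "pathin (top_of_set (closed_simplex \<sigma>)) (?seg (e 0) (e 1))"
      using \<sigma>(2) eE by (intro pathin_segment_path) auto
    ultimately show ?thesis
      using path_homotopic_closed_simplex[OF \<sigma>(1)] ends by (metis comp_apply)
  qed
  interpret edge_paths M E ?T ?\<kappa> ?seg
  proof
    fix x y assume xy: "(x, y) \<in> E"
    then have "x \<in> M" using sub by auto
    then obtain \<sigma> where \<sigma>: "\<sigma> \<in> nerve \<U>" "\<And>y. (x, y) \<in> E \<Longrightarrow> ?\<kappa> y \<in> closed_simplex \<sigma>"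
      using simplex by blast
    then show "pathin ?T (?seg x y) \<and> ?seg x y 0 = ?\<kappa> x \<and> ?seg x y 1 = ?\<kappa> y"
      using xy diag_fst[OF xy] ends by (auto intro: to_nerve pathin_segment_path)
  next
    fix x assume x: "x \<in> M"
    then have "path_homotopic ?T (?\<kappa> x) (?\<kappa> x) (?\<kappa> \<circ> (\<lambda>_. x)) (?seg x x)"
      using small[of "\<lambda>_. x"] diag[OF x] top by (auto simp: image_constant_conv)
    then show "path_homotopic ?T (?\<kappa> x) (?\<kappa> x) (?seg x x) (\<lambda>_. ?\<kappa> x)"
      using path_homotopic_sym by (fastforce simp: o_def)
  next
    fix x z y assume xz: "(x, z) \<in> E" and zy: "(z, y) \<in> E" and xy: "(x, y) \<in> E"
    then have "x \<in> M" using sub by auto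
    then obtain \<sigma> where \<sigma>: "\<sigma> \<in> nerve \<U>" "\<And>y. (x, y) \<in> E \<Longrightarrow> ?\<kappa> y \<in> closed_simplex \<sigma>"
      using simplex by blast
    then have in\<sigma>: "?\<kappa> x \<in> closed_simplex \<sigma>" "?\<kappa> y \<in> closed_simplex \<sigma>" "?\<kappa> z \<in> closed_simplex \<sigma>"
      using xz xy diag_fst by auto
    have "path_homotopic ?T (path_join (?seg x z) (?seg z y) 0) (path_join (?seg x z) (?seg z y) 1)
        (path_join (?seg x z) (?seg z y)) (?seg x y)"
      using in\<sigma> ends
      by (intro path_homotopic_closed_simplex[OF \<sigma>(1)] pathin_join pathin_segment_path) auto
    then show "path_homotopic ?T (?\<kappa> x) (?\<kappa> y) (path_join (?seg x z) (?seg z y)) (?seg x y)"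
      using ends by simp
  qed
  have cd: "pathin X c" "pathin X d" "c 0 = a" "c 1 = a"
    using c d by (auto simp: loop_at_def)
  obtain ts us where "fine_partition E c ts" "fine_partition E d us"
    using fine_partition_exists[OF _ \<open>E \<in> fine_entourages X\<close>] cd by metis
  moreover have "c 0 \<in> M"
    using path_start_in_topspace[OF cd(1)] top by simp
  ultimately show ?thesis
    using loops_homotopic_if_chain_class_eq[OF cd(1,2) continuous_map_canonical_map_nerve[OF P] small]
      eq[OF \<open>E \<in> fine_entourages X\<close>] cd(3,4) by simp
qed

lemma canonical_map_basepoint:
  assumes "pointed_partition X a (\<U>, U0) \<phi>" "U0 \<in> \<U>" "a \<in> topspace X"
  shows "canonical_map \<U> \<phi> a = nerve_vertex U0"
proof -
  have P: "partition_of_unity_on X \<U> \<phi>" and one: "\<phi> U0 a = 1"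
    using assms(1) by (auto simp: pointed_partition_def)
  obtain N \<sigma> where "\<sigma> \<in> nerve \<U>" "canonical_map \<U> \<phi> a \<in> closed_simplex \<sigma>"
    using canonical_map_local[OF P assms(3)] by metis
  then have s: "(\<Sum>U\<in>\<sigma>. canonical_map \<U> \<phi> a U) = 1" "finite \<sigma>"
    and nn: "\<And>U. 0 \<le> canonical_map \<U> \<phi> a U" and z: "\<And>U. U \<notin> \<sigma> \<Longrightarrow> canonical_map \<U> \<phi> a U = 0"
    by (auto simp: closed_simplex_def nerve_def)
  have c1: "canonical_map \<U> \<phi> a U0 = 1"
    using one assms(2) by (simp add: canonical_map_def)
  then have "U0 \<in> \<sigma>" using z by force
  then have "(\<Sum>U\<in>\<sigma> - {U0}. canonical_map \<U> \<phi> a U) = 0"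
    using s c1 by (simp add: sum_diff1)
  then have "\<forall>U\<in>\<sigma> - {U0}. canonical_map \<U> \<phi> a U = 0"
    using s(2) nn by (subst (asm) sum_nonneg_eq_0_iff) auto
  then show ?thesis
    using c1 z by (auto simp: nerve_vertex_def fun_eq_iff)
qed

text \<open>Two classes of loops with the same image under \<open>\<lambda>\<close> induce the same class in every nerve, so the
  conditions that define their images in the shape group are equivalent, and the images agree.\<close>

theorem uniform_hom_inj_if_shape_injective:
  assumes X: "compact_space X" "metrizable_space X" and a: "a \<in> topspace X"
    and shape: "shape_injective X a"
  shows "inj_on (uniform_hom X a) (fundamental_group X a)"
proof (rule inj_onI)
  fix g g' assume "g \<in> fundamental_group X a" "g' \<in> fundamental_group X a"
    and hom: "uniform_hom X a g = uniform_hom X a g'"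
  then obtain c d where c: "loop_at X a c" "g = loop_class X a c"
    and d: "loop_at X a d" "g' = loop_class X a d"
    by (auto simp: fundamental_group_def)
  have eq: "chain_class E c = chain_class E d" if "E \<in> fine_entourages X" for E
    using hom that unfolding c(2) d(2) uniform_hom_loop_class[OF c(1)] uniform_hom_loop_class[OF d(1)]
    by (metis restrict_apply')
  have mem: "c \<in> g" "d \<in> g'"
    using loop_class_eq_iff[OF c(1), of c] loop_class_eq_iff[OF d(1), of d] c d
    by (auto simp: loop_class_def loop_homotopic_path_homotopic)
  have same: "nerve_loop_class u (canonical_map (fst u) \<phi> \<circ> c')
      = nerve_loop_class u (canonical_map (fst u) \<phi> \<circ> c)"
    if u: "u \<in> pointed_covers X a" and \<phi>: "pointed_partition X a u \<phi>" and c': "c' \<in> g \<union> g'" for u \<phi> c'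
  proof -
    obtain \<U> U0 where uU: "u = (\<U>, U0)" by (cases u)
    have "path_homotopic X a a c c' \<or> path_homotopic X a a d c'"
      using c' c(2) d(2) by (auto simp: loop_class_def loop_homotopic_path_homotopic)
    then have "loop_at X a c'" and "chain_class E c' = chain_class E c" if "E \<in> fine_entourages X" for E
      using chain_class_homotopic[OF _ that] eq[OF that] path_homotopic_ends path_homotopic_pathin
      unfolding loop_at_def by metis+
    then have "path_homotopic (nerve_topology \<U>) (canonical_map \<U> \<phi> a) (canonical_map \<U> \<phi> a)
        (canonical_map \<U> \<phi> \<circ> c') (canonical_map \<U> \<phi> \<circ> c)"
      using \<phi> c(1) uU fine_entourages_full
      by (intro canonical_map_loops_homotopic[OF X]) (auto simp: pointed_partition_def)
    moreover have "canonical_map \<U> \<phi> a = nerve_vertex U0"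
      using canonical_map_basepoint[of X a \<U> U0 \<phi>] u \<phi> a uU by (auto simp: pointed_covers_def)
    ultimately have hom: "path_homotopic (nerve_topology \<U>) (nerve_vertex U0) (nerve_vertex U0)
        (canonical_map \<U> \<phi> \<circ> c') (canonical_map \<U> \<phi> \<circ> c)"
      by simp
    then have "loop_at (nerve_topology \<U>) (nerve_vertex U0) (canonical_map \<U> \<phi> \<circ> c')"
      using path_homotopic_ends(1,2)[OF hom] path_homotopic_pathin(1)[OF hom] by (simp add: loop_at_def)
    then show ?thesis
      using hom by (simp add: uU nerve_loop_class_def loop_class_eq_iff)
  qed
  have "(\<forall>u\<in>pointed_covers X a. \<forall>\<phi>. pointed_partition X a u \<phi> \<longrightarrow>
        (\<forall>c\<in>g. x u = nerve_loop_class u (canonical_map (fst u) \<phi> \<circ> c))) \<longleftrightarrow>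
      (\<forall>u\<in>pointed_covers X a. \<forall>\<phi>. pointed_partition X a u \<phi> \<longrightarrow>
        (\<forall>c\<in>g'. x u = nerve_loop_class u (canonical_map (fst u) \<phi> \<circ> c)))" for x
    using same mem by (metis UnI1 UnI2)
  then have "shape_hom X a g = shape_hom X a g'"
    unfolding shape_hom_def by (simp only:)
  then show "g = g'"
    using shape \<open>g \<in> _\<close> \<open>g' \<in> _\<close> by (auto simp: shape_injective_def dest: inj_onD)
qed

section \<open>The cover of a path connected metrizable space\<close>

theorem theorem7:
  fixes X :: "'a topology" and a :: 'a
  assumes "metrizable_space X" and "path_connected_space X" and "a \<in> topspace X"
  shows "(inj_on (uniform_hom X a) (fundamental_group X a) \<longrightarrow>
            (let \<E> = fine_entourages (lpc_coreflection X);
                 P = path_component_of_set (uu_cover \<E> a) (uu_basepoint \<E> a)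
             in fischer_zastrow_cover TYPE('y) X (subtopology (uu_cover \<E> a) P)
                  (id \<circ> uu_endpoint \<E>)))
         \<and> (compact_space X \<and> shape_injective X a \<longrightarrow>
            inj_on (uniform_hom X a) (fundamental_group X a))"
proof -
  have t1: "t1_space X"
    using assms(1) by (rule metrizable_imp_t1_space)
  show ?thesis
    unfolding Let_def
    using fischer_zastrow_cover_uu_cover[OF t1 assms(2,3)]
      uniform_hom_inj_if_shape_injective[OF _ assms(1,3)] by blast
qed

end
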